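(* Let $p\ge7$ be a prime, $l\ge1$, and let $V$ be a proper, non-degenerate open subset of $(0,1)$. Suppose every boundary point of $V$ has the form $\frac{s}{p^l}$ for some integer $s$, and that the greatest common divisor of all such $s$ is not divisible by $p$. Then $\chi_V\in\mathcal{C}$ if and only if $$V=(\tfrac1{p^l},\tfrac2{p^l})\cup(\tfrac3{p^l},\tfrac4{p^l})\cup\cdots\cup(\tfrac{p^l-2}{p^l},\tfrac{p^l-1}{p^l})\quad\text{or}\quad V=(0,\tfrac1{p^l})\cup(\tfrac2{p^l},\tfrac3{p^l})\cup\cdots\cup(\tfrac{p^l-1}{p^l},1).$$
   Context: An open set $V\subseteq(0,1)$ is non-degenerate if $(0,1)\setminus V$ has no isolated points. $\chi_V$ is the characteristic function of $V$. $L^2=L^2(0,1)$; each $\varphi\in L^2$ is identified with its odd $2$-periodic extension to $\mathbb{R}$. $\mathcal{C}$ is the set of $\varphi\in L^2$ such that the span of $\{\varphi(kx):k\in\mathbb{N}\}$ is dense in $L^2$. *)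

theory Defs
  imports "HOL-Analysis.Analysis"
begin

definition unitI :: "real measure" where
  "unitI = restrict_space lborel {0<..<1}"

definition L2 :: "(real \<Rightarrow> real) \<Rightarrow> bool" where
  "L2 f \<longleftrightarrow> f \<in> borel_measurable unitI \<and> integrable unitI (\<lambda>x. (f x)\<^sup>2)"

text \<open>Odd 2-periodic extension of a function given on (0,1)
  (values at integers are irrelevant, set to 0).\<close>
definition odd_ext :: "(real \<Rightarrow> real) \<Rightarrow> real \<Rightarrow> real" where
  "odd_ext \<phi> x = (let y = x - 2 * of_int \<lfloor>x / 2\<rfloor> in
     if 0 < y \<and> y < 1 then \<phi> y
     else if 1 < y \<and> y < 2 then - \<phi> (2 - y) else 0)"

definition complete_dilates :: "(real \<Rightarrow> real) \<Rightarrow> bool" where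
  "complete_dilates \<phi> \<longleftrightarrow> L2 \<phi> \<and>
     (\<forall>f. L2 f \<longrightarrow> (\<forall>\<epsilon>>0. \<exists>n::nat. \<exists>c::nat \<Rightarrow> real.
        integral\<^sup>L unitI (\<lambda>x. (f x - (\<Sum>k=1..n. c k * odd_ext \<phi> (real k * x)))\<^sup>2) < \<epsilon>))"

definition nondegenerate :: "real set \<Rightarrow> bool" where
  "nondegenerate V \<longleftrightarrow> open V \<and> V \<subseteq> {0<..<1} \<and>
     (\<forall>x \<in> {0<..<1} - V. x islimpt ({0<..<1} - V))"

end

theory Submission
  imports Defs "HOL-Complex_Analysis.Complex_Analysis" "HOL-Number_Theory.Number_Theory"
begin

text \<open>
  Put \<open>N = p ^ l\<close> and let \<open>A n / (\<pi> * n)\<close> be the sine coefficients of the indicator function of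
  \<open>V\<close>; then \<open>A\<close> is even and \<open>2 * N\<close>-periodic. For a completely multiplicative, square summable
  \<open>\<mu>\<close> the functional pairing the sine coefficients with \<open>\<mu>\<close> is bounded on \<open>L\<^sup>2\<close>, and dilation by
  \<open>k\<close> multiplies it by \<open>\<mu> k\<close>; so completeness forces \<open>\<Sum> A n * \<mu> n / n \<noteq> 0\<close> for every such \<open>\<mu>\<close>.

  Let \<open>g\<close> be a unit class modulo \<open>2 * N\<close> whose primes have a divergent sum of reciprocals. Taking \<open>\<mu>\<close>
  equal to a multiple of \<open>z\<close> on many large primes in \<open>g\<close> and to \<open>n \<mapsto> 1 / n ^ s\<close> elsewhere, these
  nonzero values converge to an exponential sum \<open>\<Sum> C j * exp (\<xi> j * z)\<close> over roots of unity
  \<open>\<xi> j\<close>. By Hurwitz it has no zeros, so by Borel-Caratheodory it is a single exponential, which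
  gives \<open>A (g * n) = \<plusminus> A n\<close>. Counting in arithmetic progressions shows that such classes generate
  all unit classes, hence \<open>A (u * n) = \<sigma> u * A n\<close> for a real character \<open>\<sigma>\<close>. Fourier inversion carries
  this over to the jumps of the indicator function at the points \<open>s / N\<close>, and comparing small \<open>s\<close> leaves
  only the trivial character and strictly alternating jumps.

  Conversely, the two alternating sets have \<open>2 * indicator V = q x \<plusminus> q (N * x)\<close> almost everywhere on the unit
  interval, with \<open>q\<close> the square wave. Sifting \<open>q\<close> by the odd primes yields \<open>sin (\<pi> * x) \<plusminus> sin (N * \<pi> * x)\<close>
  in the closed span of the dilates, and alternating Cesaro means yield \<open>sin (\<pi> * x)\<close>.
\<close>

section \<open>Sifting by primes\<close>

text \<open>A single twist mixes all the coefficients; two limits separate them. A finite set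
  \<open>Q\<close> of primes in the class \<open>g\<close> gets the common value \<open>w\<close>,
  and a component that scales by \<xi> under \<open>g\<close> collects the product of the factors
  \<open>1 / (1 - \<xi> * w / q)\<close>. With \<open>w = z / L\<close>, where \<open>L\<close> is
  the sum of the \<open>1 / q\<close>, this tends to \<open>exp (\<xi> * z)\<close>. Square
  summability demands \<open>norm w < 1\<close>, so \<open>L\<close> has to exceed every
  \<open>norm z\<close>: this is why divergence of the reciprocals, and not just infinitude of the
  primes, is asked of \<open>g\<close>. Unit classes without it are bypassed: together they hold a
  sparse set of primes, and every unit class has a member divisible by none of them. The second
  limit is in the exponent \<open>s\<close>: the relation found first is one between Dirichlet
  series at integer arguments, and letting \<open>s\<close> grow isolates their coefficients. The
  bound \<open>p \<ge> 7\<close> belongs to the combinatorial end, where cell values in {0, 1} have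
  to collide with the character within the cells below \<open>p\<close>.\<close>

lemma summable_tail_small:
  fixes f :: "nat \<Rightarrow> real"
  assumes "summable f" "\<And>n. f n \<ge> 0" "e > 0"
  obtains K where "\<And>F. finite F \<Longrightarrow> F \<subseteq> {K..} \<Longrightarrow> sum f F < e"
proof -
  from assms obtain K where K: "\<And>m n. m \<ge> K \<Longrightarrow> norm (sum f {m..<n}) < e"
    unfolding summable_Cauchy by blast
  show ?thesis
  proof (rule that[of K])
    fix F assume F: "finite F" "F \<subseteq> {K..}"
    have "F \<subseteq> {K..<Suc (Max F)}"
      using F by (auto simp: less_Suc_eq_le)
    then have "sum f F \<le> sum f {K..<Suc (Max F)}"
      by (intro sum_mono2) (auto simp: assms)
    also have "\<dots> < e" using K[of K "Suc (Max F)"] by (simp add: abs_less_iff)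
    finally show "sum f F < e" .
  qed
qed

text \<open>The indices in question form a single residue class modulo \<open>q\<close>, because
  \<open>b\<close> is invertible there; hence \<open>i div q\<close> determines \<open>i\<close>,
  and it takes at most \<open>x div q + 1\<close> values.\<close>

lemma card_progression_multiples:
  fixes q a b x :: nat
  assumes "prime q" "coprime q b"
  shows "card {i. i < x \<and> q dvd a + b * i} \<le> x div q + 1"
proof -
  let ?S = "{i. i < x \<and> q dvd a + b * i}"
  have q0: "q > 0" using assms(1) prime_gt_0_nat by blast
  have "inj_on (\<lambda>i. i div q) ?S"
  proof (rule inj_onI)
    fix i j assume ij: "i \<in> ?S" "j \<in> ?S" "i div q = j div q"
    have "[a + b * i = a + b * j] (mod q)"
      using ij by (auto simp: cong_def)
    then have "[b * i = b * j] (mod q)"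
      by (simp add: cong_add_lcancel_nat)
    then have "[i = j] (mod q)"
      using assms(2) by (simp add: cong_mult_lcancel_nat coprime_commute)
    then show "i = j" using ij(3) by (metis cong_def div_mult_mod_eq)
  qed
  moreover have "(\<lambda>i. i div q) ` ?S \<subseteq> {..x div q}"
    by (auto intro: div_le_mono)
  ultimately have "card ?S \<le> card {..x div q}"
    by (intro card_inj_on_le[of "\<lambda>i. i div q"]) auto
  then show ?thesis by simp
qed

text \<open>The finitely many members of \<open>T\<close> below \<open>K1\<close> are avoided by a
  congruence to 1 modulo their product, the others by counting. Among \<open>x\<close> terms of the
  progression each \<open>q\<close> spoils at most \<open>x / q + 1\<close>. The terms
  \<open>x / q\<close> add up to at most \<open>x / 4\<close>, as the tail beyond \<open>K1\<close>
  is small; the ones count the elements of \<open>T\<close> up to \<open>y\<close>, and convergence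
  makes these sparse too.\<close>

lemma progression_avoids_sparse_primes:
  fixes m u :: nat and T :: "nat set"
  assumes m: "m > 0" and u: "coprime u m"
    and T: "\<And>q. q \<in> T \<Longrightarrow> prime q" "\<And>q. q \<in> T \<Longrightarrow> coprime q m"
    and summ: "summable (\<lambda>q. indicator T q / real q)"
  obtains n where "n > 0" "[n = u] (mod m)" "\<And>q. q \<in> T \<Longrightarrow> \<not> q dvd n"
proof -
  let ?f = "\<lambda>q. indicator T q / real q"
  obtain K1 where K1: "\<And>F. finite F \<Longrightarrow> F \<subseteq> {K1..} \<Longrightarrow> sum ?f F < 1 / 4"
    using summable_tail_small[OF summ, of "1 / 4"] by auto
  define T0 where "T0 = T \<inter> {..<K1}"
  define P where "P = \<Prod>T0"
  have fin0: "finite T0" by (simp add: T0_def)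
  have P0: "P > 0" unfolding P_def using T(1) by (intro prod_pos) (auto simp: T0_def prime_gt_0_nat)
  have cop: "coprime m P"
    unfolding P_def by (intro prod_coprime_right) (auto simp: T0_def coprime_commute T(2))
  obtain n1 where n1: "[n1 = u] (mod m)" "[n1 = 1] (mod P)"
    using binary_chinese_remainder_nat[OF cop] by blast
  define M where "M = m * P"
  define n0 where "n0 = n1 + M"
  have M0: "M > 0" using m P0 by (simp add: M_def)
  have n0: "[n0 = u] (mod m)" "[n0 = 1] (mod P)" "n0 > 0"
    using n1 M0 by (auto simp: n0_def M_def cong_def)
  \<comment> \<open>\<open>y\<close> is about \<open>M * x\<close>, so the tolerance must contain
    \<open>1 / M\<close> for \<open>y / (4 * M)\<close> to stay near \<open>x / 4\<close>.\<close>
  obtain K2 where K2: "\<And>F. finite F \<Longrightarrow> F \<subseteq> {K2..} \<Longrightarrow> sum ?f F < 1 / (4 * real M)"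
    using summable_tail_small[OF summ, of "1 / (4 * real M)"] M0 by auto
  \<comment> \<open>Chosen so that \<open>x / 2\<close> exceeds \<open>K2 + n0\<close>, the part of
    the count that is not proportional to \<open>x\<close>.\<close>
  define x where "x = 2 * (K2 + n0) + 1"
  define y where "y = n0 + M * x"
  define bad where "bad = {i. i < x \<and> (\<exists>q\<in>T. q dvd n0 + M * i)}"
  define T1 where "T1 = T \<inter> {K1..y}"
  have notT0: "q \<in> T1" if "q \<in> T" "q dvd n0 + M * i" "i < x" for q i
  proof -
    have "q \<le> n0 + M * i" using that(2) n0(3) by (intro dvd_imp_le) auto
    also have "\<dots> \<le> y" using that(3) by (simp add: y_def)
    finally have "q \<le> y" .
    moreover have "q \<ge> K1"
    proof (rule ccontr)
      assume "\<not> q \<ge> K1"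
      then have "q dvd P" unfolding P_def using that fin0 by (intro dvd_prodI) (auto simp: T0_def)
      then have "q dvd M * i" "[n0 = 1] (mod q)"
        using n0(2) by (auto simp: M_def intro: cong_dvd_modulus_nat)
      with that(2) have "q dvd n0" by (simp add: dvd_add_left_iff)
      with \<open>[n0 = 1] (mod q)\<close> have "q dvd 1" using cong_dvd_iff by blast
      with T(1)[OF that(1)] show False by (metis not_prime_unit)
    qed
    ultimately show ?thesis using that by (simp add: T1_def)
  qed
  have copM: "coprime q M" if "q \<in> T1" for q
  proof -
    have "coprime q t" if "t \<in> T0" for t
      using that \<open>q \<in> T1\<close> T(1) by (intro primes_coprime) (auto simp: T0_def T1_def)
    then have "coprime q P" unfolding P_def by (rule prod_coprime_right)
    then show ?thesis using T(2)[of q] that by (simp add: M_def T1_def)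
  qed
  have fin1: "finite T1" by (simp add: T1_def)
  have "bad \<subseteq> (\<Union>q\<in>T1. {i. i < x \<and> q dvd n0 + M * i})"
    using notT0 by (auto simp: bad_def)
  then have "card bad \<le> card (\<Union>q\<in>T1. {i. i < x \<and> q dvd n0 + M * i})"
    using fin1 by (intro card_mono) auto
  also have "\<dots> \<le> (\<Sum>q\<in>T1. card {i. i < x \<and> q dvd n0 + M * i})"
    by (rule card_UN_le[OF fin1])
  also have "\<dots> \<le> (\<Sum>q\<in>T1. x div q + 1)"
    using copM T(1) by (intro sum_mono card_progression_multiples) (auto simp: T1_def)
  finally have "real (card bad) \<le> real (\<Sum>q\<in>T1. x div q + 1)" by (rule of_nat_mono)
  also have "\<dots> \<le> (\<Sum>q\<in>T1. real x * ?f q + 1)"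
    unfolding of_nat_sum
    by (intro sum_mono) (auto simp: T1_def intro: order.trans[OF of_nat_div_le_of_nat])
  also have "\<dots> = real x * sum ?f T1 + real (card T1)"
    by (simp add: sum.distrib sum_distrib_left)
  also have "real x * sum ?f T1 \<le> real x * (1 / 4)"
  proof (intro mult_left_mono less_imp_le[OF K1])
    show "T1 \<subseteq> {K1..}" by (auto simp: T1_def)
  qed (use fin1 in auto)
  also have "real (card T1) \<le> real K2 + real y / (4 * real M)"
  proof -
    have "card T1 \<le> card ({..<K2} \<union> (T \<inter> {K2..y}))"
      by (intro card_mono) (auto simp: T1_def)
    also have "\<dots> \<le> card {..<K2} + card (T \<inter> {K2..y})" by (rule card_Un_le)
    finally have "real (card T1) \<le> real K2 + real (card (T \<inter> {K2..y}))" by simp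
    also have "real (card (T \<inter> {K2..y})) = (\<Sum>q\<in>T \<inter> {K2..y}. 1)" by simp
    \<comment> \<open>Counting by reciprocals: \<open>1 \<le> y / q\<close> whenever
      \<open>q \<le> y\<close>.\<close>
    also have "\<dots> \<le> (\<Sum>q\<in>T \<inter> {K2..y}. real y * ?f q)"
      using T(1) by (intro sum_mono) (auto simp: divide_simps dest: prime_gt_0_nat)
    also have "\<dots> = real y * sum ?f (T \<inter> {K2..y})" by (simp add: sum_distrib_left)
    also have "\<dots> \<le> real y * (1 / (4 * real M))"
      by (intro mult_left_mono less_imp_le[OF K2]) auto
    finally show ?thesis by simp
  qed
  also have "real y / (4 * real M) \<le> real n0 + real x / 4"
  proof -
    have "real y / (4 * real M) = real n0 / (4 * real M) + real x / 4"
      using M0 by (simp add: y_def field_simps)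
    also have "real n0 / (4 * real M) \<le> real n0 / 1"
      using M0 by (intro divide_left_mono) auto
    finally show ?thesis by simp
  qed
  also have "real x * (1 / 4) + (real K2 + (real n0 + real x / 4)) < real x"
    by (simp add: x_def)
  finally have "card bad < card {..<x}" by simp
  then have "\<not> {..<x} \<subseteq> bad"
    by (metis card_mono finite_Collect_conjI finite_Collect_less_nat bad_def not_less)
  then obtain i where i: "i < x" "\<And>q. q \<in> T \<Longrightarrow> \<not> q dvd n0 + M * i"
    by (auto simp: bad_def)
  show ?thesis
    by (rule that[of "n0 + M * i"]) (use i n0 in \<open>auto simp: M_def cong_def mult.assoc\<close>)
qed

text \<open>Stands in for Dirichlet's theorem. Only finitely many classes modulo \<open>m\<close>
  have primes with a convergent sum of reciprocals, so all these primes together still have one and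
  can be avoided inside the class of \<open>u\<close>. The class of \<open>u\<close> is then a
  product of rich classes, while nothing is claimed about its own primes.\<close>

lemma unit_class_rich_prime_factors:
  fixes m u :: nat
  assumes "m > 0" "coprime u m"
  obtains n where "n > 0" "[n = u] (mod m)"
    "\<And>q. prime q \<Longrightarrow> q dvd n \<Longrightarrow> \<not> summable (\<lambda>k. indicator {k. prime k \<and> [k = q] (mod m)} k / real k)"
proof -
  define rich where "rich g \<longleftrightarrow> \<not> summable (\<lambda>k. indicator {k. prime k \<and> [k
      = g] (mod m)} k / real k)" for g :: nat
  define T where "T = {q. prime q \<and> coprime q m \<and> \<not> rich q}"
  have richmod: "rich g \<longleftrightarrow> rich (g mod m)" for g
    by (simp add: rich_def)
  have "summable (\<lambda>q. \<Sum>g\<in>{g. g < m \<and> \<not> rich g}. indicator {k. prime k \<and> [k = g] (mod m)} q / real q)"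
    by (intro summable_sum) (auto simp: rich_def)
  then have "summable (\<lambda>q. indicator T q / real q)"
  proof (rule summable_comparison_test'[where N = 0])
    fix q :: nat
    show "norm (indicator T q / real q) \<le>
       (\<Sum>g\<in>{g. g < m \<and> \<not> rich g}. indicator {k. prime k \<and> [k = g] (mod m)} q / real q)"
    proof (cases "q \<in> T")
      case True
      then have "q mod m \<in> {g. g < m \<and> \<not> rich g}"
        using assms(1) richmod by (auto simp: T_def)
      then have "indicator {k. prime k \<and> [k = q mod m] (mod m)} q / real q \<le>
         (\<Sum>g\<in>{g. g < m \<and> \<not> rich g}. indicator {k. prime k \<and> [k = g] (mod m)} q / real q)"
        by (intro member_le_sum) auto
      then show ?thesis using True by (simp add: T_def)
    qed (simp add: sum_nonneg)
  qed
  then obtain n where n: "n > 0" "[n = u] (mod m)" "\<And>q. q \<in> T \<Longrightarrow> \<not> q dvd n"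
  proof (rule progression_avoids_sparse_primes[OF assms, rotated 2])
    show "prime q" "coprime q m" if "q \<in> T" for q using that by (simp_all add: T_def)
  qed (rule that)
  show ?thesis
  proof (rule that[OF n(1,2)])
    fix q assume q: "prime q" "q dvd n"
    have "coprime n m" using n(2) assms(2) by (metis cong_imp_coprime cong_sym)
    then have "coprime q m" using q(2) by (meson coprime_divisors dvd_refl)
    then show "\<not> summable (\<lambda>k. indicator {k. prime k \<and> [k = q] (mod m)} k / real k)"
      using n(3)[of q] q unfolding T_def rich_def by blast
  qed
qed

lemma not_summable_obtains_finite:
  fixes S :: "nat set"
  assumes "\<not> summable (\<lambda>k. indicator S k / real k)"
  obtains Q where "finite Q" "Q \<subseteq> S \<inter> {K..}" "(\<Sum>q\<in>Q. 1 / real q) \<ge> L"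
proof -
  let ?f = "\<lambda>k. if k \<ge> K then indicator S k / real k else (0::real)"
  have "\<not> summable ?f"
  proof
    assume "summable ?f"
    moreover have "\<forall>\<^sub>F k in sequentially. ?f k = indicator S k / real k"
      using eventually_ge_at_top[of K] by eventually_elim simp
    ultimately show False using assms summable_cong[of ?f "\<lambda>k. indicator S k / real k"] by blast
  qed
  moreover have "?f k \<ge> 0" for k by simp
  ultimately have "\<not> (\<forall>n. sum ?f {..n} \<le> L)"
    using bounded_imp_summable[of ?f L] by blast
  then have "\<not> (\<forall>n. sum ?f {..<n} \<le> L)"
    unfolding lessThan_Suc_atMost[symmetric] by blast
  then obtain n where n: "sum ?f {..<n} > L" by (auto simp: not_le)
  have "sum ?f {..<n} = (\<Sum>q\<in>S \<inter> {K..<n}. 1 / real q)"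
    by (intro sum.mono_neutral_cong_right) (auto simp: indicator_def)
  then show ?thesis using n by (intro that[of "S \<inter> {K..<n}"]) auto
qed

text \<open>The terms that sifting by \<open>q\<close> removes are the images of the remaining ones under
  \<open>n \<mapsto> q * n\<close>, so the scaling law contributes one Euler factor \<open>1 - x q\<close> per prime.\<close>

lemma infsum_sieve:
  fixes f :: "nat \<Rightarrow> complex" and x :: "nat \<Rightarrow> complex"
  assumes "finite Q" and pr: "\<And>q. q \<in> Q \<Longrightarrow> prime q"
    and summ: "f summable_on {0<..}"
    and sc: "\<And>q n. q \<in> Q \<Longrightarrow> n > 0 \<Longrightarrow> f (q * n) = x q * f n"
  shows "infsum f {n. n > 0 \<and> (\<forall>q\<in>Q. \<not> q dvd n)} = (\<Prod>q\<in>Q. 1 - x q) * infsum f {0<..}"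
  using assms(1) pr sc
proof (induction Q rule: finite_induct)
  case empty
  then show ?case by (simp add: greaterThan_def)
next
  case (insert q Q)
  let ?S = "{n. n > 0 \<and> (\<forall>q\<in>Q. \<not> q dvd n)}"
  let ?S' = "{n. n > 0 \<and> (\<forall>q\<in>insert q Q. \<not> q dvd n)}"
  have q: "prime q" and q0: "q > 0" using insert.prems(1) by (auto simp: prime_gt_0_nat)
  have dv: "t dvd q * n \<longleftrightarrow> t dvd n" if "t \<in> Q" for t n
  proof -
    have "coprime t q" using that insert by (intro primes_coprime) auto
    then show ?thesis by (simp add: coprime_dvd_mult_right_iff)
  qed
  have "n \<in> ((*) q) ` ?S" if "n \<in> ?S" "q dvd n" for n
  proof -
    obtain k where k: "n = q * k" using \<open>q dvd n\<close> by blast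
    then have "k \<in> ?S" using that(1) dv by auto
    with k show ?thesis by blast
  qed
  then have split: "?S = ?S' \<union> ((*) q) ` ?S"
    using dv q0 by auto
  have disj: "?S' \<inter> ((*) q) ` ?S = {}" by auto
  have s: "f summable_on A" if "A \<subseteq> {0<..}" for A
    using summ that by (rule summable_on_subset_banach)
  have "infsum f ?S = infsum f ?S' + infsum f (((*) q) ` ?S)"
    using q0 by (subst split, intro infsum_Un_disjoint disj s) auto
  also have "infsum f (((*) q) ` ?S) = infsum (\<lambda>n. x q * f n) ?S"
    using q0 insert.prems(2)
    by (subst infsum_reindex) (auto intro!: inj_onI infsum_cong)
  also have "\<dots> = x q * infsum f ?S" by (rule infsum_cmult_right')
  finally have eq: "infsum f ?S = infsum f ?S' + x q * infsum f ?S" .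
  have "infsum f ?S' = (1 - x q) * infsum f ?S"
    unfolding left_diff_distrib mult_1 eq_diff_eq by (rule eq[symmetric])
  moreover have "infsum f ?S = (\<Prod>q\<in>Q. 1 - x q) * infsum f {0<..}"
    using insert by auto
  ultimately show ?case using insert.hyps by (simp add: mult.assoc)
qed

text \<open>Nonnegative terms permit the sieve to be run backwards. In a truncation \<open>U\<close>
  of the unsifted set the multiples of \<open>q\<close> lie in the image of \<open>U\<close> under
  \<open>n \<mapsto> q * n\<close>, so they carry at most the fraction \<open>y q < 1\<close> of the
  sum over \<open>U\<close>; the rest is bounded by the sifted sum. Truncating makes the sums finite
  before they are compared.\<close>

lemma summable_on_sieve:
  fixes g :: "nat \<Rightarrow> real" and y :: "nat \<Rightarrow> real"
  assumes "finite Q" and pr: "\<And>q. q \<in> Q \<Longrightarrow> prime q"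
    and y: "\<And>q. q \<in> Q \<Longrightarrow> 0 \<le> y q" "\<And>q. q \<in> Q \<Longrightarrow> y q < 1"
    and g: "\<And>n. g n \<ge> 0"
    and sc: "\<And>q n. q \<in> Q \<Longrightarrow> n > 0 \<Longrightarrow> g (q * n) = y q * g n"
    and summ: "g summable_on {n. n > 0 \<and> (\<forall>q\<in>Q. \<not> q dvd n)}"
  shows "g summable_on {0<..}"
  using assms(1) pr y sc summ
proof (induction Q rule: finite_induct)
  case empty
  then show ?case by (simp add: greaterThan_def)
next
  case (insert q Q)
  let ?S = "{n. n > 0 \<and> (\<forall>q\<in>Q. \<not> q dvd n)}"
  let ?S' = "{n. n > 0 \<and> (\<forall>q\<in>insert q Q. \<not> q dvd n)}"
  have q: "prime q" and q0: "q > 0" using insert.prems(1) by (auto simp: prime_gt_0_nat)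
  have yq: "0 \<le> y q" "y q < 1" using insert.prems by auto
  define B where "B = infsum g ?S' / (1 - y q)"
  have "g summable_on ?S"
  proof (rule nonneg_bdd_above_summable_on)
    show "bdd_above (sum g ` {F. F \<subseteq> ?S \<and> finite F})"
    proof (rule bdd_aboveI2[where M = B])
      fix F assume F: "F \<in> {F. F \<subseteq> ?S \<and> finite F}"
      define X where "X = Max F"
      define U where "U = ?S \<inter> {..X}"
      have finU: "finite U" by (simp add: U_def)
      have FU: "F \<subseteq> U" using F by (auto simp: U_def X_def)
      define W where "W = {n \<in> U. q dvd n}"
      have "sum g W \<le> sum g (((*) q) ` U)"
      proof (rule sum_mono2)
        show "W \<subseteq> ((*) q) ` U"
        proof
          fix n assume n: "n \<in> W"
          then obtain k where k: "n = q * k" by (auto simp: W_def)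
          have "k \<in> U" using n k q0 by (auto simp: W_def U_def intro: order.trans[of _ "q * k"])
          then show "n \<in> ((*) q) ` U" using k by blast
        qed
      qed (use g finU in auto)
      also have "\<dots> = sum (\<lambda>n. g (q * n)) U"
        using q0 by (subst sum.reindex) (auto intro: inj_onI simp: o_def)
      also have "\<dots> = y q * sum g U"
        unfolding sum_distrib_left using insert.prems(4) by (intro sum.cong) (auto simp: U_def)
      finally have W: "sum g W \<le> y q * sum g U" .
      have "sum g U = sum g (U - W) + sum g W"
        using finU by (intro sum.subset_diff) (auto simp: W_def)
      moreover have "sum g (U - W) \<le> infsum g ?S'"
        using finU insert.prems(5) g by (intro finite_sum_le_infsum) (auto simp: U_def W_def)
      ultimately have "(1 - y q) * sum g U \<le> infsum g ?S'"
        using W by (simp add: algebra_simps)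
      then have "sum g U \<le> B" using yq by (simp add: B_def pos_le_divide_eq mult.commute)
      moreover have "sum g F \<le> sum g U" using FU finU g by (intro sum_mono2) auto
      ultimately show "sum g F \<le> B" by simp
    qed
  qed (use g in auto)
  then show ?case using insert by auto
qed

section \<open>Zero-free exponential sums\<close>

text \<open>\<open>h = exp g\<close> with \<open>g\<close> entire, and the growth bound says that
  the real part of \<open>g\<close> grows at most linearly. Borel-Caratheodory, here derived from
  the Schwarz lemma, turns this into a linear bound for \<open>g\<close> itself, so \<open>g\<close>
  is a polynomial of degree at most one.\<close>

lemma nonvanishing_exponential_type:
  fixes h :: "complex \<Rightarrow> complex"
  assumes hol: "h holomorphic_on UNIV" and nz: "\<And>z. h z \<noteq> 0"
    and C: "C > 0" and K: "K \<ge> 0" and bd: "\<And>z. norm (h z) \<le> C * exp (K * norm z)"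
  obtains b where "\<And>z. h z = h 0 * exp (b * z)"
proof -
  obtain g where g: "g holomorphic_on UNIV" "\<And>z. h z = exp (g z)"
    using holomorphic_logarithm_exists[of UNIV h 0] hol nz by (metis UNIV_I convex_UNIV open_UNIV)
  define G where "G z = g z - g 0" for z
  have holG: "G holomorphic_on UNIV"
    unfolding G_def by (intro holomorphic_intros g(1))
  define c0 where "c0 = \<bar>ln C - Re (g 0)\<bar> + 1"
  have reG: "Re (G z) < c0 + K * norm z" for z
  proof -
    have "exp (Re (g z)) \<le> exp (ln C + K * norm z)"
      using bd[of z] C by (simp add: g(2) exp_add)
    then show ?thesis unfolding G_def c0_def by simp
  qed
  have c0: "c0 > 0" unfolding c0_def by simp
  have main: "norm (G z) \<le> (2 * c0 + 4 * K) * norm z ^ 1" if z: "1 \<le> norm z" for z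
  proof -
    \<comment> \<open>The Schwarz lemma is used on the disc of radius \<open>2 * R\<close>, in which
      \<open>z\<close> sits at half the radius.\<close>
    define R where "R = norm z"
    define M where "M = c0 + K * (2 * R)"
    have z0: "z \<noteq> 0" using z by auto
    have R: "R \<ge> 1" and M: "M > 0" using z c0 K by (auto simp: R_def M_def intro: add_pos_nonneg)
    have reM: "Re (G (2 * R * w)) < M" if "norm w < 1" for w :: complex
    proof -
      have "K * norm (2 * R * w) \<le> K * (2 * R)"
        using K R that by (intro mult_left_mono) (auto simp: norm_mult)
      with reG[of "2 * R * w"] show ?thesis unfolding M_def by linarith
    qed
    \<comment> \<open>The Moebius map \<open>w \<mapsto> w / (2 * M - w)\<close> sends the half
      plane of real part below \<open>M\<close> into the unit disc and fixes 0.\<close>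
    define f where "f w = G (2 * R * w) / (2 * M - G (2 * R * w))" for w :: complex
    have den: "2 * M - G (2 * R * w) \<noteq> 0" if "norm w < 1" for w :: complex
    proof
      assume "2 * M - G (2 * R * w) = 0"
      then have "Re (2 * M - G (2 * R * w)) = 0" by simp
      with reM[OF that] M show False by simp
    qed
    have holf: "f holomorphic_on ball 0 1"
    proof -
      have "(\<lambda>w. G (2 * R * w)) holomorphic_on ball 0 1"
        by (rule holomorphic_on_compose_gen[OF _ holG, unfolded o_def])
          (auto intro!: holomorphic_intros)
      then show ?thesis unfolding f_def using den by (intro holomorphic_intros) auto
    qed
    have f1: "norm (f w) < 1" if "norm w < 1" for w
    proof -
      let ?G = "G (2 * R * w)"
      have "(norm ?G)\<^sup>2 < (norm (2 * M - ?G))\<^sup>2"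
      proof -
        have "(norm (2 * M - ?G))\<^sup>2 = (2 * M - Re ?G)\<^sup>2 + (Im ?G)\<^sup>2"
          by (simp add: cmod_power2)
        also have "\<dots> = (norm ?G)\<^sup>2 + 4 * M * (M - Re ?G)"
          unfolding cmod_power2 by (simp add: power2_eq_square algebra_simps)
        finally show ?thesis using M reM[OF that] by simp
      qed
      then have "norm ?G < norm (2 * M - ?G)" by (rule power2_less_imp_less) simp
      then show ?thesis unfolding f_def norm_divide
        using den[OF that] by (subst divide_less_eq_1_pos) auto
    qed
    have "f 0 = 0" by (simp add: f_def G_def)
    then have "norm (f (z / (2 * R))) \<le> norm (z / (2 * R))"
      using R z0 by (intro Schwarz_Lemma(1)[OF holf _ f1]) (auto simp: norm_divide R_def)
    moreover have "norm (z / (2 * R)) = 1 / 2"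
      using R z0 by (simp add: norm_divide R_def)
    moreover have "f (z / (2 * R)) = G z / (2 * M - G z)"
      using R z0 by (simp add: f_def)
    ultimately have "norm (G z / (2 * M - G z)) \<le> 1 / 2" by simp
    moreover have "2 * M - G z \<noteq> 0"
      using den[of "z / (2 * R)"] R z0 by (simp add: norm_divide R_def)
    ultimately have "norm (G z) \<le> norm (2 * M - G z) / 2"
      by (simp add: norm_divide divide_simps mult.commute)
    also have "norm (2 * M - G z) \<le> 2 * M + norm (G z)"
      using norm_triangle_ineq4[of "2 * complex_of_real M" "G z"] M by (simp add: norm_mult)
    finally have "norm (G z) \<le> 2 * M" by simp
    also have "\<dots> \<le> (2 * c0 + 4 * K) * R"
      using R c0 unfolding M_def by (simp add: algebra_simps)
    finally show ?thesis by (simp add: R_def)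
  qed
  have "h z = h 0 * exp (deriv G 0 * z)" for z
  proof -
    have "G z = (\<Sum>k\<le>1. (deriv ^^ k) G 0 / fact k * z ^ k)"
      by (rule Liouville_polynomial[OF holG main])
    then have "g z = g 0 + deriv G 0 * z"
      by (simp add: G_def algebra_simps)
    then show ?thesis by (simp add: g(2) exp_add)
  qed
  then show ?thesis by (rule that)
qed

text \<open>The sum is \<open>h 0 * exp (b * z)\<close> for some \<open>b\<close>. Equating
  derivatives at 0 gives all moments: the sum of \<open>C j * \<eta> j ^ k\<close> is
  \<open>h 0 * b ^ k\<close>. The case \<open>k = r\<close> yields \<open>b ^ r = 1\<close>, and
  \<open>k = 1\<close> the other claim.\<close>

lemma exponential_sum_nonvanishing:
  fixes C :: "'a \<Rightarrow> complex" and \<eta> :: "'a \<Rightarrow> complex"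
  assumes fin: "finite J" and r: "\<And>j. j \<in> J \<Longrightarrow> \<eta> j ^ r = 1" "r > 0"
    and nz: "\<And>z. (\<Sum>j\<in>J. C j * exp (\<eta> j * z)) \<noteq> 0"
  obtains b where "b ^ r = 1" "(\<Sum>j\<in>J. C j * \<eta> j) = b * (\<Sum>j\<in>J. C j)"
proof -
  define h where "h z = (\<Sum>j\<in>J. C j * exp (\<eta> j * z))" for z
  have n1: "norm (\<eta> j) = 1" if "j \<in> J" for j
  proof -
    have "norm (\<eta> j) ^ r = 1" using r(1)[OF that] by (metis norm_one norm_power)
    then show ?thesis using power_eq_imp_eq_base[of "norm (\<eta> j)" r 1] r(2) by simp
  qed
  obtain b where b: "\<And>z. h z = h 0 * exp (b * z)"
  proof (rule nonvanishing_exponential_type[of h "(\<Sum>j\<in>J. norm (C j)) + 1" 1])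
    show "h holomorphic_on UNIV" unfolding h_def by (intro holomorphic_intros)
    show "h z \<noteq> 0" for z using nz by (simp add: h_def)
    show "(\<Sum>j\<in>J. norm (C j)) + 1 > 0" by (intro add_nonneg_pos sum_nonneg) auto
    show "norm (h z) \<le> ((\<Sum>j\<in>J. norm (C j)) + 1) * exp (1 * norm z)" for z
    proof -
      have "norm (h z) \<le> (\<Sum>j\<in>J. norm (C j) * exp (norm z))"
        unfolding h_def
      proof (intro sum_norm_le)
        fix j assume j: "j \<in> J"
        have "Re (\<eta> j * z) \<le> norm z"
          using complex_Re_le_cmod[of "\<eta> j * z"] n1[OF j] by (simp add: norm_mult)
        then show "norm (C j * exp (\<eta> j * z)) \<le> norm (C j) * exp (norm z)"
          by (simp add: norm_mult mult_left_mono)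
      qed
      also have "\<dots> = (\<Sum>j\<in>J. norm (C j)) * exp (norm z)" by (rule sum_distrib_right[symmetric])
      also have "\<dots> \<le> ((\<Sum>j\<in>J. norm (C j)) + 1) * exp (1 * norm z)"
        unfolding mult_1 by (intro mult_right_mono) auto
      finally show ?thesis .
    qed
  qed (simp, rule that)
  have derivs: "(deriv ^^ k) h = (\<lambda>z. \<Sum>j\<in>J. C j * \<eta> j ^ k * exp (\<eta> j * z))" for k
  proof (induction k)
    case 0
    then show ?case by (simp add: h_def fun_eq_iff)
  next
    case (Suc k)
    have "deriv (\<lambda>z. \<Sum>j\<in>J. C j * \<eta> j ^ k * exp (\<eta> j * z)) z
        = (\<Sum>j\<in>J. C j * \<eta> j ^ Suc k * exp (\<eta> j * z))" for z
      by (rule DERIV_imp_deriv) (auto intro!: derivative_eq_intros sum.cong simp: algebra_simps)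
    then show ?case by (simp add: Suc)
  qed
  have derivs': "(deriv ^^ k) h = (\<lambda>z. h 0 * b ^ k * exp (b * z))" for k
  proof (induction k)
    case 0
    have "h z = h 0 * b ^ 0 * exp (b * z)" for z
      using b[of z] by (simp only: power_0 mult_1_right)
    then show ?case unfolding funpow_0 by (rule ext)
  next
    case (Suc k)
    have "deriv (\<lambda>z. h 0 * b ^ k * exp (b * z)) z = h 0 * b ^ Suc k * exp (b * z)" for z
      by (rule DERIV_imp_deriv) (auto intro!: derivative_eq_intros simp: algebra_simps)
    then show ?case by (simp add: Suc)
  qed
  have h0: "h 0 = (\<Sum>j\<in>J. C j)" "h 0 \<noteq> 0" using nz[of 0] by (auto simp: h_def)
  have eq: "(\<Sum>j\<in>J. C j * \<eta> j ^ k) = h 0 * b ^ k" for k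
    using fun_cong[OF derivs[of k], of 0] fun_cong[OF derivs'[of k], of 0] by simp
  show ?thesis
  proof (rule that[of b])
    have "(\<Sum>j\<in>J. C j * \<eta> j ^ r) = h 0" using r(1) by (simp add: h0)
    then show "b ^ r = 1" using eq[of r] h0(2) by simp
    show "(\<Sum>j\<in>J. C j * \<eta> j) = b * (\<Sum>j\<in>J. C j)" using eq[of 1] h0(1) by simp
  qed
qed

text \<open>\<open>- Ln (1 - x) = x + e\<close> with \<open>e\<close> of size at most
  \<open>2 * (norm x)\<^sup>2\<close> when \<open>norm x \<le> 1 / 2\<close>. The errors add up to
  some \<open>E\<close> of norm at most \<open>2 * \<delta> \<le> 1 / 2\<close>, small enough for a
  linear bound on \<open>exp E - 1\<close>.\<close>

lemma norm_prod_inverse_one_minus_exp: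
  fixes x :: "'a \<Rightarrow> complex"
  assumes "finite Q" and small: "\<And>q. q \<in> Q \<Longrightarrow> norm (x q) \<le> 1 / 2"
    and \<delta>: "(\<Sum>q\<in>Q. (norm (x q))\<^sup>2) \<le> \<delta>" "\<delta> \<le> 1 / 4"
  shows "norm ((\<Prod>q\<in>Q. 1 / (1 - x q)) - exp (\<Sum>q\<in>Q. x q)) \<le> 4 * \<delta> * exp (norm (\<Sum>q\<in>Q. x q))"
proof -
  define e where "e q = - Ln (1 - x q) - x q" for q
  have ne: "1 - x q \<noteq> 0" if "q \<in> Q" for q
    using small[OF that] by auto
  have e: "norm (e q) \<le> 2 * (norm (x q))\<^sup>2" if "q \<in> Q" for q
  proof -
    have "norm (Ln (1 + (- x q)) - (- x q)) \<le> (norm (- x q))\<^sup>2 / (1 - norm (- x q))"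
      by (rule Ln_approx_linear) (use small[OF that] in auto)
    also have "\<dots> \<le> 2 * (norm (x q))\<^sup>2"
    proof -
      have "(norm (x q))\<^sup>2 * 1 \<le> (norm (x q))\<^sup>2 * (2 * (1 - norm (x q)))"
        using small[OF that] by (intro mult_left_mono) auto
      then show ?thesis using small[OF that] by (simp add: divide_simps algebra_simps)
    qed
    also have "norm (Ln (1 + (- x q)) - (- x q)) = norm (e q)"
      unfolding e_def by (subst norm_minus_cancel[symmetric]) simp
    finally show ?thesis .
  qed
  define E where "E = (\<Sum>q\<in>Q. e q)"
  have E: "norm E \<le> 2 * \<delta>"
  proof -
    have "norm E \<le> (\<Sum>q\<in>Q. 2 * (norm (x q))\<^sup>2)"
      unfolding E_def by (intro sum_norm_le e)
    then show ?thesis using \<delta>(1) by (simp add: sum_distrib_left[symmetric])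
  qed
  have "(\<Prod>q\<in>Q. 1 / (1 - x q)) = (\<Prod>q\<in>Q. exp (x q + e q))"
    by (intro prod.cong) (use ne in \<open>auto simp: e_def exp_minus field_simps\<close>)
  also have "\<dots> = exp (\<Sum>q\<in>Q. x q) * exp E"
    using assms(1) by (simp add: exp_sum exp_add prod.distrib E_def)
  finally have "(\<Prod>q\<in>Q. 1 / (1 - x q)) - exp (\<Sum>q\<in>Q. x q) = exp (\<Sum>q\<in>Q. x q) * (exp E - 1)"
    by (simp add: algebra_simps)
  moreover have "norm (exp E - 1) \<le> 4 * \<delta>"
  proof -
    have "norm (exp E - 1) \<le> 3 / 2 * norm E"
      using E \<delta>(2) by (intro norm_exp_bounds) simp
    with E norm_ge_zero[of E] show ?thesis by linarith
  qed
  moreover have "norm (exp (\<Sum>q\<in>Q. x q)) \<le> exp (norm (\<Sum>q\<in>Q. x q))"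
    by (simp only: norm_exp_eq_Re exp_le_cancel_iff complex_Re_le_cmod)
  ultimately have "norm ((\<Prod>q\<in>Q. 1 / (1 - x q)) - exp (\<Sum>q\<in>Q. x q))
      \<le> exp (norm (\<Sum>q\<in>Q. x q)) * (4 * \<delta>)"
    by (metis norm_mult mult_mono norm_ge_zero exp_ge_zero)
  then show ?thesis by (simp only: mult.commute)
qed

section \<open>Nonvanishing twists\<close>

lemma infsum_sum_swap:
  fixes f :: "'b \<Rightarrow> 'a \<Rightarrow> complex"
  assumes "finite J" "\<And>j. j \<in> J \<Longrightarrow> f j summable_on S"
  shows "infsum (\<lambda>n. \<Sum>j\<in>J. f j n) S = (\<Sum>j\<in>J. infsum (f j) S)"
proof -
  have "((\<lambda>n. \<Sum>j\<in>J. f j n) has_sum (\<Sum>j\<in>J. infsum (f j) S)) S"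
    using assms
  proof (induction J rule: finite_induct)
    case (insert j J)
    then show ?case by (simp add: has_sum_add)
  qed simp
  then show ?thesis by (rule infsumI)
qed

lemma inverse_square_summable_on: "(\<lambda>n. 1 / (real n)\<^sup>2) summable_on S"
proof -
  have "summable (\<lambda>n. 1 / (real n)\<^sup>2)"
    using inverse_power_summable[of 2, where 'a = real] by (simp add: inverse_eq_divide)
  then have "(\<lambda>n. 1 / (real n)\<^sup>2) summable_on UNIV"
    by (subst summable_on_UNIV_nonneg_real_iff) auto
  then show ?thesis by (rule summable_on_subset_banach) simp
qed

lemma bounded_dirichlet_summable_on:
  fixes f :: "nat \<Rightarrow> complex"
  assumes "\<And>n. norm (f n) \<le> B" "s \<ge> 1"
  shows "Infinite_Sum.abs_summable_on (\<lambda>n. f n / of_nat n ^ Suc s) S"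
proof (rule Infinite_Sum.abs_summable_on_comparison_test)
  have "B \<ge> 0" using assms(1)[of 0] norm_ge_zero order.trans by blast
  show "Infinite_Sum.abs_summable_on (\<lambda>n. B * (1 / (real n)\<^sup>2)) S"
    unfolding summable_on_iff_abs_summable_on_real[symmetric]
    by (intro summable_on_cmult_right inverse_square_summable_on)
  fix n
  have "norm (f n / of_nat n ^ Suc s) \<le> B / (real n)\<^sup>2"
  proof (cases "n = 0")
    case False
    have "real n ^ 2 \<le> real n ^ Suc s"
      using False assms(2) by (intro power_increasing) auto
    then show ?thesis
      unfolding norm_divide norm_power norm_of_nat
      using False assms(1) \<open>B \<ge> 0\<close> by (intro frac_le) auto
  qed simp
  then show "norm (f n / of_nat n ^ Suc s) \<le> norm (B * (1 / (real n)\<^sup>2))"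
    using \<open>B \<ge> 0\<close> by simp
qed

text \<open>The discrete Fourier transform on \<open>r\<close> points: \<open>c a j\<close> is the
  value at index 0 of the component of \<open>a\<close> on which the shift acts as multiplication by
  \<open>\<xi> j\<close>. It will be applied to \<open>k \<mapsto> A (n * g ^ k)\<close>, where the
  shift amounts to \<open>n \<mapsto> g * n\<close>.\<close>

lemma roots_of_unity_projection:
  fixes a :: "nat \<Rightarrow> complex" and r :: nat
  assumes r: "r > 0" and per: "\<And>k. a (k + r) = a k"
  defines "\<xi> \<equiv> \<lambda>j. exp (2 * of_real pi * \<i> * of_nat j / of_nat r)"
  defines "c \<equiv> \<lambda>a j. (\<Sum>k<r. a k * inverse (\<xi> j) ^ k) / of_nat r"
  shows "(\<Sum>j<r. c a j) = a 0" and "c (\<lambda>k. a (Suc k)) j = \<xi> j * c a j"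
proof -
  have \<xi>0: "\<xi> j \<noteq> 0" for j by (simp add: \<xi>_def)
  have \<xi>r: "\<xi> j ^ r = 1" for j
    unfolding \<xi>_def using r by (intro complex_root_unity) auto
  have orth: "(\<Sum>j<r. inverse (\<xi> j) ^ k) = (if k = 0 then of_nat r else 0)" if "k < r" for k
  proof (cases "k = 0")
    case False
    define w where "w = inverse (\<xi> k)"
    have "inverse (\<xi> j) ^ k = w ^ j" for j
      unfolding w_def power_inverse \<xi>_def exp_of_nat_mult[symmetric] by (simp add: mult_ac)
    moreover have "w \<noteq> 1"
      using complex_root_unity_eq_1[of r k] r False that dvd_imp_le[of r k]
      by (auto simp: w_def \<xi>_def)
    moreover have "w ^ r = 1" by (simp add: w_def power_inverse \<xi>r)
    ultimately show ?thesis using False by (simp add: sum_gp_strict)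
  qed simp
  have "(\<Sum>j<r. c a j) = (\<Sum>k<r. a k * (\<Sum>j<r. inverse (\<xi> j) ^ k)) / of_nat r"
    unfolding c_def sum_divide_distrib[symmetric] sum_distrib_left by (subst sum.swap) simp
  also have "(\<Sum>k<r. a k * (\<Sum>j<r. inverse (\<xi> j) ^ k)) = (\<Sum>k<r. if k = 0 then a 0 * of_nat r else 0)"
    by (intro sum.cong) (auto simp: orth)
  finally show "(\<Sum>j<r. c a j) = a 0" using r by simp
  define f where "f k = a k * inverse (\<xi> j) ^ k" for k
  have "(\<Sum>k<r. f (Suc k)) + f 0 = (\<Sum>k<r. f k) + f r"
    using sum.lessThan_Suc_shift[of f r] by (simp add: add.commute)
  moreover have "f r = f 0" using per[of 0] by (simp add: f_def power_inverse \<xi>r)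
  ultimately have "(\<Sum>k<r. f (Suc k)) = (\<Sum>k<r. f k)" by simp
  moreover have "a (Suc k) * inverse (\<xi> j) ^ k = \<xi> j * f (Suc k)" for k
    using \<xi>0 by (simp add: f_def)
  ultimately show "c (\<lambda>k. a (Suc k)) j = \<xi> j * c a j"
    unfolding c_def times_divide_eq_right f_def[symmetric]
    by (simp only: sum_distrib_left[symmetric])
qed

definition twists_nonvanishing :: "(nat \<Rightarrow> real) \<Rightarrow> bool" where
  "twists_nonvanishing A \<longleftrightarrow> (\<forall>\<mu>::nat \<Rightarrow> complex. \<mu> 1 = 1 \<longrightarrow> (\<forall>a b. \<mu> (a * b) = \<mu> a * \<mu> b) \<longrightarrow>
     (\<lambda>n. (norm (\<mu> n))\<^sup>2) summable_on UNIV \<longrightarrow>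
     infsum (\<lambda>n. of_real (A n) * \<mu> n / of_nat n) UNIV \<noteq> 0)"

text \<open>The twist is \<open>w\<close> at the primes of \<open>Q\<close> and
  \<open>1 / n ^ s\<close> at numbers prime to \<open>Q\<close>. On the component \<open>j\<close>
  the summand then scales by \<open>\<xi> j * w / q\<close> under \<open>n \<mapsto> q * n\<close>,
  so the full sum is the sifted one divided by the Euler factors.\<close>

lemma sieve_twist_nonzero:
  fixes A :: "nat \<Rightarrow> real" and c :: "'j \<Rightarrow> nat \<Rightarrow> complex"
  assumes nv: "twists_nonvanishing A"
    and J: "finite J" and A: "\<And>n. n > 0 \<Longrightarrow> of_real (A n) = (\<Sum>j\<in>J. c j n)"
    and B: "\<And>j n. j \<in> J \<Longrightarrow> norm (c j n) \<le> B"
    and Q: "finite Q" "\<And>q. q \<in> Q \<Longrightarrow> prime q"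
    and c: "\<And>j q n. j \<in> J \<Longrightarrow> q \<in> Q \<Longrightarrow> c j (q * n) = \<xi> j * c j n"
    and \<xi>: "\<And>j. j \<in> J \<Longrightarrow> norm (\<xi> j) = 1"
    and w: "norm w < 1" and s: "s \<ge> 1"
  shows "(\<Sum>j\<in>J. infsum (\<lambda>n. c j n / of_nat n ^ Suc s) {n. n > 0 \<and> (\<forall>q\<in>Q. \<not> q dvd n)} *
           (\<Prod>q\<in>Q. 1 / (1 - \<xi> j * w / of_nat q))) \<noteq> 0"
proof -
  let ?S = "{n. n > 0 \<and> (\<forall>q\<in>Q. \<not> q dvd n)}"
  \<comment> \<open>Start from \<open>1 / n ^ s\<close> and exchange, for each \<open>q\<close> in
    \<open>Q\<close>, every factor \<open>1 / q ^ s\<close> for \<open>w\<close>.\<close>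
  define \<mu> :: "nat \<Rightarrow> complex" where
    "\<mu> n = (\<Prod>q\<in>Q. (w * of_nat q ^ s) ^ multiplicity q n) / of_nat n ^ s" for n
  have \<mu>0: "\<mu> 0 = 0" using s by (simp add: \<mu>_def)
  have \<mu>1: "\<mu> 1 = 1" by (simp add: \<mu>_def)
  have \<mu>mult: "\<mu> (a * b) = \<mu> a * \<mu> b" for a b
  proof (cases "a = 0 \<or> b = 0")
    case True
    then show ?thesis using \<mu>0 by auto
  next
    case False
    have "(\<Prod>q\<in>Q. (w * of_nat q ^ s) ^ multiplicity q (a * b))
        = (\<Prod>q\<in>Q. (w * of_nat q ^ s) ^ multiplicity q a * (w * of_nat q ^ s) ^ multiplicity q b)"
      by (intro prod.cong refl, subst prime_elem_multiplicity_mult_distrib)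
        (use False Q(2) in \<open>auto simp: power_add prime_imp_prime_elem\<close>)
    then show ?thesis by (simp add: \<mu>_def prod.distrib power_mult_distrib)
  qed
  have \<mu>q: "\<mu> q = w" if q: "q \<in> Q" for q
  proof -
    have pq: "prime q" using Q(2) q by blast
    have "(\<Prod>t\<in>Q. (w * of_nat t ^ s) ^ multiplicity t q) = (\<Prod>t\<in>Q. if t = q then w * of_nat q ^ s else 1)"
      by (intro prod.cong refl) 
        (use Q(2) pq in \<open>auto simp: prime_multiplicity_other multiplicity_self not_prime_0\<close>)
    also have "\<dots> = w * of_nat q ^ s" using q Q(1) by simp
    finally show ?thesis using prime_gt_0_nat[OF pq] by (simp add: \<mu>_def)
  qed
  have \<mu>S: "\<mu> n = 1 / of_nat n ^ s" if "n \<in> ?S" for n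
  proof -
    have "(\<Prod>q\<in>Q. (w * of_nat q ^ s) ^ multiplicity q n) = 1"
      by (rule prod.neutral) (use that in \<open>auto simp: not_dvd_imp_multiplicity_0\<close>)
    then show ?thesis by (simp add: \<mu>_def)
  qed
  \<comment> \<open>Under \<open>n \<mapsto> q * n\<close> the squares scale by
    \<open>(norm w)\<^sup>2 < 1\<close>, so it is enough to sum them over the sifted set, where they
    are at most \<open>1 / n\<^sup>2\<close>.\<close>
  have "(\<lambda>n. (norm (\<mu> n))\<^sup>2) summable_on {0<..}"
  proof (rule summable_on_sieve[where Q = Q and y = "\<lambda>_. (norm w)\<^sup>2"])
    show "(norm w)\<^sup>2 < 1" using w by (simp add: abs_square_less_1)
    show "(norm (\<mu> (q * n)))\<^sup>2 = (norm w)\<^sup>2 * (norm (\<mu> n))\<^sup>2" if "q \<in> Q" for q n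
      using that by (simp add: \<mu>mult \<mu>q norm_mult power_mult_distrib)
    show "(\<lambda>n. (norm (\<mu> n))\<^sup>2) summable_on ?S"
    proof (rule summable_on_comparison_test[OF inverse_square_summable_on])
      fix n assume n: "n \<in> ?S"
      have "real n ^ 1 \<le> real n ^ s" using n s by (intro power_increasing) auto
      then have "norm (\<mu> n) \<le> 1 / real n"
        using n by (auto simp: \<mu>S norm_divide norm_power intro!: divide_left_mono)
      then have "(norm (\<mu> n))\<^sup>2 \<le> (1 / real n)\<^sup>2" by (intro power_mono) auto
      then show "(norm (\<mu> n))\<^sup>2 \<le> 1 / (real n)\<^sup>2" by (simp add: power_divide)
    qed auto
  qed (use Q in auto)
  then have l2: "(\<lambda>n. (norm (\<mu> n))\<^sup>2) summable_on UNIV"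
    by (subst summable_on_cong_neutral[where S = UNIV and T = "{0<..}"
        and g = "\<lambda>n. (norm (\<mu> n))\<^sup>2"]) (auto simp: \<mu>0)
  have fsum: "(\<lambda>n. c j n * \<mu> n / of_nat n) summable_on S" if j: "j \<in> J" for j S
  proof -
    \<comment> \<open>Both \<mu> and \<open>1 / n\<close> are square summable, so their product is
      summable.\<close>
    have "Infinite_Sum.abs_summable_on (\<lambda>n. \<mu> n * (1 / of_nat n)) S"
    proof (rule Infinite_Sum.abs_summable_product)
      show "Infinite_Sum.abs_summable_on (\<lambda>n. \<mu> n * \<mu> n) S"
        using summable_on_subset_banach[OF l2, of S] by (simp add: norm_mult power2_eq_square)
      show "Infinite_Sum.abs_summable_on (\<lambda>n. 1 / of_nat n * (1 / of_nat n :: complex)) S"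
        using inverse_square_summable_on[of S]
        by (simp add: norm_mult norm_divide power2_eq_square)
    qed
    then have "Infinite_Sum.abs_summable_on (\<lambda>n. of_real B * (\<mu> n * (1 / of_nat n))) S"
      using summable_on_cmult_right[of "\<lambda>n. norm (\<mu> n * (1 / of_nat n))" S "\<bar>B\<bar>"]
      by (simp only: norm_mult norm_of_real)
    then have "Infinite_Sum.abs_summable_on (\<lambda>n. c j n * \<mu> n / of_nat n) S"
    proof (rule Infinite_Sum.abs_summable_on_comparison_test)
      fix n
      have "norm (c j n) * norm (\<mu> n / of_nat n) \<le> \<bar>B\<bar> * norm (\<mu> n / of_nat n)"
        using B[OF j, of n] by (intro mult_right_mono) auto
      then show "norm (c j n * \<mu> n / of_nat n) \<le> norm (of_real B * (\<mu> n * (1 / of_nat n)))"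
        by (simp add: norm_mult norm_divide)
    qed
    then show ?thesis by (rule Infinite_Sum.abs_summable_summable)
  qed
  have "infsum (\<lambda>n. of_real (A n) * \<mu> n / of_nat n) UNIV \<noteq> 0"
    using nv \<mu>1 \<mu>mult l2 unfolding twists_nonvanishing_def by blast
  also have "infsum (\<lambda>n. of_real (A n) * \<mu> n / of_nat n) UNIV
      = infsum (\<lambda>n. \<Sum>j\<in>J. c j n * \<mu> n / of_nat n) {0<..}"
    by (rule infsum_cong_neutral) (auto simp: A sum_distrib_right sum_divide_distrib)
  also have "\<dots> = (\<Sum>j\<in>J. infsum (\<lambda>n. c j n * \<mu> n / of_nat n) {0<..})"
    by (rule infsum_sum_swap[OF J fsum])
  also have "\<dots> = (\<Sum>j\<in>J. infsum (\<lambda>n. c j n / of_nat n ^ Suc s) ?S *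
           (\<Prod>q\<in>Q. 1 / (1 - \<xi> j * w / of_nat q)))"
  proof (intro sum.cong refl)
    fix j assume j: "j \<in> J"
    let ?f = "\<lambda>n. c j n * \<mu> n / of_nat n"
    have "infsum ?f ?S = (\<Prod>q\<in>Q. 1 - \<xi> j * w / of_nat q) * infsum ?f {0<..}"
    proof (rule infsum_sieve[OF Q fsum[OF j]])
      fix q n assume "q \<in> Q" "(n::nat) > 0"
      then show "?f (q * n) = \<xi> j * w / of_nat q * ?f n"
        using j by (simp add: c \<mu>mult \<mu>q)
    qed
    moreover have "infsum ?f ?S = infsum (\<lambda>n. c j n / of_nat n ^ Suc s) ?S"
      by (intro infsum_cong) (use \<mu>S in auto)
    moreover have nz: "1 - \<xi> j * w / of_nat q \<noteq> 0" if "q \<in> Q" for q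
    proof
      assume "1 - \<xi> j * w / of_nat q = 0"
      then have "norm (\<xi> j * w / of_nat q) = 1" by simp
      then have "norm w = real q" using prime_gt_0_nat[OF Q(2)[OF that]]
        by (simp add: norm_mult norm_divide \<xi>[OF j])
      with w prime_ge_1_nat[OF Q(2)[OF that]] show False by simp
    qed
    moreover have "(\<Prod>q\<in>Q. 1 - \<xi> j * w / of_nat q) \<noteq> 0" using Q(1) nz by simp
    ultimately show "infsum ?f {0<..} = infsum (\<lambda>n. c j n / of_nat n ^ Suc s) ?S *
           (\<Prod>q\<in>Q. 1 / (1 - \<xi> j * w / of_nat q))"
      by (simp add: prod_dividef)
  qed
  finally show ?thesis .
qed

lemma infsum_tail_small:
  fixes f :: "nat \<Rightarrow> complex"
  assumes "Infinite_Sum.abs_summable_on f UNIV" "e > 0"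
  obtains K where "\<And>T. T \<subseteq> {K..} \<Longrightarrow> norm (infsum f T) \<le> e"
proof -
  have "summable (\<lambda>n. norm (f n))" by (rule summable_on_imp_summable[OF assms(1)])
  then obtain K where K: "\<And>F. finite F \<Longrightarrow> F \<subseteq> {K..} \<Longrightarrow> sum (\<lambda>n. norm (f n)) F < e"
    using summable_tail_small[of "\<lambda>n. norm (f n)" e] assms(2) by auto
  show ?thesis
  proof (rule that[of K])
    fix T assume T: "T \<subseteq> {K..}"
    have s: "Infinite_Sum.abs_summable_on f T"
      by (rule summable_on_subset_banach[OF assms(1)]) simp
    have "norm (infsum f T) \<le> infsum (\<lambda>n. norm (f n)) T"
      by (rule norm_infsum_bound[OF s])
    also have "\<dots> \<le> e"
      using K T by (intro infsum_le_finite_sums[OF s]) (auto intro: less_imp_le)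
    finally show "norm (infsum f T) \<le> e" .
  qed
qed

text \<open>A positive integer struck out by \<open>Q k\<close> is a multiple of some
  \<open>q \<ge> k\<close>, hence at least \<open>k\<close> itself; the removed part is contained in
  a tail.\<close>

lemma sifted_infsum_tendsto:
  fixes f :: "nat \<Rightarrow> complex"
  assumes f: "Infinite_Sum.abs_summable_on f UNIV" and f0: "f 0 = 0"
    and Q: "\<And>k. Q k \<subseteq> {k..}"
  shows "(\<lambda>k. infsum f {n. n > 0 \<and> (\<forall>q\<in>Q k. \<not> q dvd n)}) \<longlonglongrightarrow> infsum f UNIV"
proof (rule LIMSEQ_I)
  fix e :: real assume "e > 0"
  then obtain K where K: "\<And>T. T \<subseteq> {K..} \<Longrightarrow> norm (infsum f T) \<le> e / 2"
    using infsum_tail_small[OF f, of "e / 2"] by auto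
  have s: "f summable_on T" for T
    using Infinite_Sum.abs_summable_summable[OF f] by (rule summable_on_subset_banach) simp
  show "\<exists>k0. \<forall>k\<ge>k0. norm (infsum f {n. n > 0 \<and> (\<forall>q\<in>Q k. \<not> q dvd n)} - infsum f UNIV) < e"
  proof (intro exI allI impI)
    fix k assume k: "k \<ge> K"
    let ?S = "{n. n > 0 \<and> (\<forall>q\<in>Q k. \<not> q dvd n)}"
    let ?T = "{n. n > 0 \<and> \<not> (\<forall>q\<in>Q k. \<not> q dvd n)}"
    have "infsum f UNIV = infsum f (?S \<union> ?T)"
      by (rule infsum_cong_neutral) (auto simp: f0)
    also have "\<dots> = infsum f ?S + infsum f ?T"
      by (intro infsum_Un_disjoint s) auto
    finally have "norm (infsum f ?S - infsum f UNIV) = norm (infsum f ?T)"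
      by (simp add: norm_minus_commute)
    also have "?T \<subseteq> {K..}"
    proof
      fix n assume "n \<in> ?T"
      then obtain q where "n > 0" "q \<in> Q k" "q dvd n" by blast
      with Q[of k] k dvd_imp_le[of q n] show "n \<in> {K..}" by fastforce
    qed
    then have "norm (infsum f ?T) \<le> e / 2" by (rule K)
    finally show "norm (infsum f ?S - infsum f UNIV) < e" using \<open>e > 0\<close> by simp
  qed
qed

text \<open>Insert \<open>w = z / L k\<close>. The quantities \<open>\<xi> j * w / q\<close> then
  add up to exactly \<open>\<xi> j * z\<close>, while their squares add up to at most
  \<open>(norm z)\<^sup>2 / L k\<close>. The sieved sums \<open>F k\<close> therefore converge to
  the exponential sum uniformly on discs; they have no zeros where \<open>norm z\<close> is below
  the corresponding \<open>L\<close>, and Hurwitz passes this on to the limit.\<close>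

lemma exponential_sum_nonzero_if_sieved_nonzero:
  fixes C :: "'j \<Rightarrow> complex" and CQ :: "nat \<Rightarrow> 'j \<Rightarrow> complex" and Q :: "nat \<Rightarrow> nat set"
  assumes J: "finite J" and \<xi>: "\<And>j. j \<in> J \<Longrightarrow> norm (\<xi> j) = 1"
    and lim: "\<And>j. j \<in> J \<Longrightarrow> (\<lambda>k. CQ k j) \<longlonglongrightarrow> C j"
    and Q: "\<And>k. finite (Q k)" "\<And>k q. q \<in> Q k \<Longrightarrow> q > 0"
    and L: "\<And>k. L k = (\<Sum>q\<in>Q k. 1 / real q)" "\<And>k. L k \<ge> real k + 1"
    and nz: "\<And>k w. norm w < 1 \<Longrightarrow> (\<Sum>j\<in>J. CQ k j * (\<Prod>q\<in>Q k. 1 / (1 - \<xi> j * w / of_nat q))) \<noteq> 0"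
    and nz0: "(\<Sum>j\<in>J. C j) \<noteq> 0"
  shows "(\<Sum>j\<in>J. C j * exp (\<xi> j * z)) \<noteq> 0"
proof
  assume zero: "(\<Sum>j\<in>J. C j * exp (\<xi> j * z)) = 0"
  define \<rho> where "\<rho> = norm z + 1"
  have \<rho>: "\<rho> > 0" unfolding \<rho>_def using norm_ge_zero[of z] by linarith
  \<comment> \<open>From \<open>k0\<close> on, \<open>2 * \<rho> \<le> L k\<close> keeps every
    \<open>x j k z q\<close> at most \<open>1 / 2\<close> on the disc of radius \<rho>, and
    \<open>4 * \<rho>\<^sup>2 \<le> L k\<close> keeps the error \<open>\<epsilon>\<close> at most
    \<open>1 / 4\<close>, as the product estimate requires.\<close>
  obtain k0 :: nat where k0: "real k0 \<ge> 4 * \<rho>\<^sup>2 + 2 * \<rho>" using real_arch_simple by blast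
  have Lpos: "L k > 0" for k using L(2)[of k] by linarith
  have Lk0: "L (k + k0) \<ge> 4 * \<rho>\<^sup>2" "L (k + k0) \<ge> 2 * \<rho>" for k
  proof -
    have "L (k + k0) \<ge> real k0" using L(2)[of "k + k0"] by simp
    then show "L (k + k0) \<ge> 4 * \<rho>\<^sup>2" "L (k + k0) \<ge> 2 * \<rho>"
      using k0 \<rho> zero_le_power2[of \<rho>] by linarith+
  qed
  define x where "x j k z q = \<xi> j * (z / of_real (L k)) / of_nat q" for j k z q
  define P where "P j k z = (\<Prod>q\<in>Q k. 1 / (1 - x j k z q))" for j k z
  define F where "F k z = (\<Sum>j\<in>J. CQ (k + k0) j * P j (k + k0) z)" for k z
  define h where "h z = (\<Sum>j\<in>J. C j * exp (\<xi> j * z))" for z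
  define \<epsilon> where "\<epsilon> k = \<rho>\<^sup>2 / L (k + k0)" for k
  have norm_x: "norm (x j k z q) = norm z / L k / real q" if "j \<in> J" for j k z q
    using \<xi>[OF that] Lpos[of k] by (simp add: x_def norm_mult norm_divide)
  have small: "norm (x j (k + k0) z q) \<le> 1 / 2" if "j \<in> J" "norm z < \<rho>" "q \<in> Q (k + k0)" for j k z q
  proof -
    have "real q \<ge> 1" using Q(2)[OF that(3)] by simp
    then have "norm z / L (k + k0) / real q \<le> norm z / L (k + k0) / 1"
      using Lpos by (intro divide_left_mono) (auto simp: less_imp_le)
    also have "\<dots> \<le> 1 / 2"
      using that(2) Lk0(2)[of k] Lpos[of "k + k0"] by (simp add: divide_simps)
    finally show ?thesis by (simp add: norm_x[OF that(1)])
  qed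
  have P: "norm (P j (k + k0) z - exp (\<xi> j * z)) \<le> 4 * \<epsilon> k * exp \<rho>"
    if j: "j \<in> J" and z: "norm z < \<rho>" for j k z
  proof -
    let ?x = "x j (k + k0) z" and ?Q = "Q (k + k0)" and ?L = "L (k + k0)"
    have sum_x: "(\<Sum>q\<in>?Q. ?x q) = \<xi> j * z"
    proof -
      have "(\<Sum>q\<in>?Q. ?x q) = \<xi> j * (z / of_real ?L) * of_real (\<Sum>q\<in>?Q. 1 / real q)"
        by (simp add: x_def sum_distrib_left)
      also have "\<dots> = \<xi> j * z" using Lpos[of "k + k0"] by (simp flip: L(1))
      finally show ?thesis .
    qed
    have "(\<Sum>q\<in>?Q. (norm (?x q))\<^sup>2) \<le> (\<Sum>q\<in>?Q. (norm z / ?L)\<^sup>2 * (1 / real q))"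
    proof (rule sum_mono)
      fix q assume "q \<in> ?Q"
      then have q: "real q \<ge> 1" using Q(2)[of q "k + k0"] by simp
      have "(norm (?x q))\<^sup>2 = (norm z / ?L)\<^sup>2 * (1 / (real q)\<^sup>2)"
        by (simp add: norm_x[OF j] power_divide power_mult_distrib)
      also have "\<dots> \<le> (norm z / ?L)\<^sup>2 * (1 / real q)"
        using q by (intro mult_left_mono divide_left_mono) (auto simp: power2_eq_square)
      finally show "(norm (?x q))\<^sup>2 \<le> (norm z / ?L)\<^sup>2 * (1 / real q)" .
    qed
    also have "\<dots> = (norm z / ?L)\<^sup>2 * ?L" unfolding L(1) by (rule sum_distrib_left[symmetric])
    also have "\<dots> = (norm z)\<^sup>2 / ?L"
      using Lpos[of "k + k0"] by (simp add: power2_eq_square)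
    also have "\<dots> \<le> \<epsilon> k"
      unfolding \<epsilon>_def using z Lpos[of "k + k0"] by (intro divide_right_mono power_mono) auto
    finally have b: "(\<Sum>q\<in>?Q. (norm (?x q))\<^sup>2) \<le> \<epsilon> k" .
    have "\<epsilon> k \<le> 1 / 4"
      unfolding \<epsilon>_def using Lk0(1)[of k] Lpos[of "k + k0"] by (simp add: divide_simps)
    from norm_prod_inverse_one_minus_exp[OF Q(1) small[OF j z] b this]
    have "norm (P j (k + k0) z - exp (\<xi> j * z)) \<le> 4 * \<epsilon> k * exp (norm (\<xi> j * z))"
      by (simp add: P_def sum_x)
    also have "\<dots> \<le> 4 * \<epsilon> k * exp \<rho>"
      using z \<xi>[OF j] Lpos[of "k + k0"] by (intro mult_left_mono) (auto simp: norm_mult \<epsilon>_def)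
    finally show ?thesis .
  qed
  have \<epsilon>: "\<epsilon> \<longlonglongrightarrow> 0"
  proof (rule tendsto_sandwich[where f = "\<lambda>_. 0" and h = "\<lambda>k. \<rho>\<^sup>2 / real (Suc k)"])
    show "(\<lambda>k. \<rho>\<^sup>2 / real (Suc k)) \<longlonglongrightarrow> 0"
      by (rule LIMSEQ_Suc[of "\<lambda>k. \<rho>\<^sup>2 / real k"]) (rule lim_const_over_n)
    show "\<forall>\<^sub>F k in sequentially. \<epsilon> k \<le> \<rho>\<^sup>2 / real (Suc k)"
    proof (rule always_eventually, rule allI)
      fix k
      show "\<epsilon> k \<le> \<rho>\<^sup>2 / real (Suc k)"
        unfolding \<epsilon>_def using L(2)[of "k + k0"] Lpos[of "k + k0"] by (intro divide_left_mono) auto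
    qed
    show "\<forall>\<^sub>F k in sequentially. 0 \<le> \<epsilon> k"
      by (rule always_eventually) (use Lpos in \<open>auto simp: \<epsilon>_def less_imp_le\<close>)
  qed auto
  define b where "b k = (\<Sum>j\<in>J. norm (CQ (k + k0) j - C j) * (exp \<rho> + 4 * \<epsilon> k * exp \<rho>)
      + norm (C j) * (4 * \<epsilon> k * exp \<rho>))" for k
  have "b \<longlonglongrightarrow> (\<Sum>j\<in>J. norm (C j - C j) * (exp \<rho> + 4 * 0 * exp \<rho>) + norm (C j) * (4 * 0 * exp \<rho>))"
    unfolding b_def
    by (intro tendsto_intros \<epsilon> LIMSEQ_ignore_initial_segment[OF lim]) 
  then have b: "b \<longlonglongrightarrow> 0" by simp
  have Fh: "norm (F k z - h z) \<le> b k" if z: "norm z < \<rho>" for k z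
  proof -
    have "F k z - h z = (\<Sum>j\<in>J. (CQ (k + k0) j - C j) * P j (k + k0) z + C j * (P j (k + k0) z
        - exp (\<xi> j * z)))"
      unfolding F_def h_def sum_subtractf[symmetric] by (intro sum.cong) (auto simp: algebra_simps)
    also have "norm \<dots> \<le> b k"
      unfolding b_def
    proof (rule sum_norm_le)
      fix j assume j: "j \<in> J"
      have "norm (exp (\<xi> j * z)) \<le> exp \<rho>"
        using complex_Re_le_cmod[of "\<xi> j * z"] z \<xi>[OF j] by (simp add: norm_mult)
      then have "norm (P j (k + k0) z) \<le> exp \<rho> + 4 * \<epsilon> k * exp \<rho>"
        using P[OF j z, of k] norm_triangle_sub[of "P j (k + k0) z" "exp (\<xi> j * z)"] by linarith
      then show "norm ((CQ (k + k0) j - C j) * P j (k + k0) z + C j * (P j (k + k0) z - exp (\<xi> j * z)))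
        \<le> norm (CQ (k + k0) j - C j) * (exp \<rho> + 4 * \<epsilon> k * exp \<rho>) + norm (C j) * (4 * \<epsilon> k * exp \<rho>)"
        using P[OF j z, of k]
        by (intro order.trans[OF norm_triangle_ineq] add_mono) (auto simp: norm_mult intro!: mult_left_mono)
    qed
    finally show ?thesis .
  qed
  have "h z \<noteq> 0"
  proof (rule Hurwitz_no_zeros[of "ball 0 \<rho>" F h z])
    show "F k holomorphic_on ball 0 \<rho>" for k
    proof -
      have "1 - x j (k + k0) z q \<noteq> 0" if "j \<in> J" "z \<in> ball 0 \<rho>" "q \<in> Q (k + k0)" for j z q
      proof
        assume "1 - x j (k + k0) z q = 0"
        then have "norm (x j (k + k0) z q) = 1" by simp
        with small[of j z q k] that show False by simp
      qed
      then show ?thesis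
        unfolding F_def P_def x_def by (intro holomorphic_intros) auto
    qed
    show "h holomorphic_on ball 0 \<rho>" unfolding h_def by (intro holomorphic_intros)
    show "uniform_limit K F h sequentially" if "compact K" "K \<subseteq> ball 0 \<rho>" for K
    proof (rule uniform_limitI)
      fix e :: real assume "e > 0"
      with b have "\<forall>\<^sub>F k in sequentially. b k < e" by (rule order_tendstoD)
      then show "\<forall>\<^sub>F k in sequentially. \<forall>z\<in>K. dist (F k z) (h z) < e"
      proof eventually_elim
        case (elim k)
        then show ?case using that(2) Fh[of _ k] by (force simp: dist_norm)
      qed
    qed
    \<comment> \<open>Hurwitz excludes constant limits; a constant would have to equal the nonzero
      \<open>h 0\<close> and the assumed zero at once.\<close>
    show "\<not> h constant_on ball 0 \<rho>"
    proof
      assume "h constant_on ball 0 \<rho>"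
      then have "h z = h 0" using \<rho> unfolding constant_on_def
          by (metis \<rho>_def centre_in_ball less_add_one mem_ball_0)
      with zero nz0 show False by (simp add: h_def)
    qed
    show "F k z \<noteq> 0" if z: "z \<in> ball 0 \<rho>" for k z
    proof -
      have "norm z < L (k + k0)" using z Lk0(2)[of k] \<rho> by simp
      then have "norm (z / of_real (L (k + k0))) < 1"
        using Lpos[of "k + k0"] by (simp add: norm_divide)
      from nz[OF this, of "k + k0"] show ?thesis by (simp add: F_def P_def x_def)
    qed
    show "z \<in> ball 0 \<rho>" by (simp add: \<rho>_def)
  qed auto
  with zero show False by (simp add: h_def)
qed

section \<open>From zero-free sums to real characters of the unit classes\<close>

lemma periodic_bounded:
  fixes A :: "nat \<Rightarrow> real"
  assumes "m > 0" "\<And>a b. [a = b] (mod m) \<Longrightarrow> A a = A b"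
  obtains B where "\<And>n. \<bar>A n\<bar> \<le> B"
proof -
  have "\<bar>A n\<bar> \<le> Max ((\<lambda>n. \<bar>A n\<bar>) ` {..<m})" for n
  proof -
    have "A n = A (n mod m)" by (rule assms(2)) simp
    then show ?thesis using assms(1) by (auto intro!: Max_ge)
  qed
  then show ?thesis by (rule that)
qed

lemma bounded_dirichlet_summable_on_real:
  fixes f :: "nat \<Rightarrow> real"
  assumes "\<And>n. \<bar>f n\<bar> \<le> B" "s \<ge> 1"
  shows "(\<lambda>n. f n / real n ^ Suc s) summable_on S"
proof -
  have "Infinite_Sum.abs_summable_on (\<lambda>n. complex_of_real (f n) / of_nat n ^ Suc s) S"
    by (rule bounded_dirichlet_summable_on[where B = B]) (use assms in auto)
  then show ?thesis
    by (subst summable_on_iff_abs_summable_on_real) (simp add: norm_divide norm_power norm_mult)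
qed

text \<open>The sequence \<open>k \<mapsto> A (n * g ^ k)\<close> has period
  \<open>totient m\<close> and splits into eigencomponents of multiplication by \<open>g\<close>.
  Their Dirichlet series \<open>C j\<close> add up to \<open>D 1\<close>, and weighted with
  \<open>\<xi> j\<close> to \<open>D g\<close>. Zero-freeness of the sum of
  \<open>C j * exp (\<xi> j * z)\<close> makes \<open>D g / D 1\<close> a root of unity; being real,
  it is a sign.\<close>

lemma rich_class_sign:
  fixes A :: "nat \<Rightarrow> real" and m g s :: nat
  assumes m: "m > 0" and per: "\<And>a b. [a = b] (mod m) \<Longrightarrow> A a = A b"
    and nv: "twists_nonvanishing A" and cop: "coprime g m"
    and rich: "\<not> summable (\<lambda>k. indicator {k. prime k \<and> [k = g] (mod m)} k / real k)"
    and s: "s \<ge> 1"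
  defines "D \<equiv> \<lambda>u. infsum (\<lambda>d. A (d * u) / real d ^ Suc s) UNIV"
  shows "D g = D 1 \<or> D g = - D 1"
proof -
  obtain B where B: "\<And>n. \<bar>A n\<bar> \<le> B" using periodic_bounded[of m A] m per by blast
  have B0: "B \<ge> 0" using B[of 0] by simp
  define r where "r = totient m"
  have r: "r > 0" using m by (simp add: r_def)
  define \<xi> :: "nat \<Rightarrow> complex" where "\<xi> = (\<lambda>j. exp (2 * of_real pi * \<i> * of_nat j / of_nat r))"
  define c :: "nat \<Rightarrow> nat \<Rightarrow> complex" where
    "c j n = (\<Sum>k<r. of_real (A (n * g ^ k)) * inverse (\<xi> j) ^ k) / of_nat r" for j n
  have \<xi>r: "\<xi> j ^ r = 1" for j
    unfolding \<xi>_def using r by (intro complex_root_unity) auto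
  have \<xi>1: "norm (\<xi> j) = 1" for j by (simp add: \<xi>_def)
  have gr: "[g ^ r = 1] (mod m)" unfolding r_def by (rule euler_theorem[OF cop])
  have Aper: "A (n * g ^ (k + r)) = A (n * g ^ k)" for n k
  proof (rule per)
    have "[n * g ^ k * g ^ r = n * g ^ k * 1] (mod m)"
      by (intro cong_mult cong_refl gr)
    then show "[n * g ^ (k + r) = n * g ^ k] (mod m)" by (simp add: power_add mult_ac)
  qed
  have c1: "(\<Sum>j<r. c j n) = of_real (A n)" for n
    using roots_of_unity_projection(1)[OF r, of "\<lambda>k. of_real (A (n * g ^ k))"] Aper
    by (simp add: c_def \<xi>_def)
  have c2: "c j (q * n) = \<xi> j * c j n" if "[q = g] (mod m)" for q j n
  proof -
    have "A (q * n * g ^ k) = A (n * g ^ Suc k)" for k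
    proof (rule per)
      have "[q * (n * g ^ k) = g * (n * g ^ k)] (mod m)"
        by (intro cong_mult cong_refl that)
      then show "[q * n * g ^ k = n * g ^ Suc k] (mod m)" by (simp add: mult_ac)
    qed
    then show ?thesis
      using roots_of_unity_projection(2)[OF r, of "\<lambda>k. of_real (A (n * g ^ k))" j] Aper
      by (simp add: c_def \<xi>_def)
  qed
  have cB: "norm (c j n) \<le> B" for j n
  proof -
    have "norm (\<Sum>k<r. of_real (A (n * g ^ k)) * inverse (\<xi> j) ^ k) \<le> (\<Sum>k<r. B)"
      by (intro sum_norm_le) (simp add: norm_mult norm_power norm_inverse \<xi>1 B)
    then show ?thesis using r by (simp add: c_def norm_divide divide_simps mult.commute)
  qed
  have csum: "Infinite_Sum.abs_summable_on (\<lambda>n. c j n / of_nat n ^ Suc s) S" for j S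
    by (rule bounded_dirichlet_summable_on[OF cB s])
  define C where "C j = infsum (\<lambda>n. c j n / of_nat n ^ Suc s) UNIV" for j
  have "\<forall>k. \<exists>Q. finite Q \<and> Q \<subseteq> {q. prime q \<and> [q = g] (mod m)} \<inter> {k..} \<and> (\<Sum>q\<in>Q. 1 / real q) \<ge> real k + 1"
  proof
    fix k :: nat
    obtain Q where "finite Q" "Q \<subseteq> {q. prime q \<and> [q = g] (mod m)} \<inter> {k..}" "(\<Sum>q\<in>Q. 1 / real q) \<ge> real k + 1"
      by (rule not_summable_obtains_finite[OF rich, of k "real k + 1"])
    then show "\<exists>Q. finite Q \<and> Q \<subseteq> {q. prime q \<and> [q = g] (mod m)} \<inter> {k..} \<and> (\<Sum>q\<in>Q. 1 / real q) \<ge> real k + 1"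
      by blast
  qed
  from choice[OF this] obtain Q where QQ: "\<forall>k. finite (Q k) \<and>
      Q k \<subseteq> {q. prime q \<and> [q = g] (mod m)} \<inter> {k..} \<and> (\<Sum>q\<in>Q k. 1 / real q) \<ge> real k + 1" ..
  have Q: "finite (Q k)" "Q k \<subseteq> {q. prime q \<and> [q = g] (mod m)} \<inter> {k..}"
    "(\<Sum>q\<in>Q k. 1 / real q) \<ge> real k + 1" for k
    using QQ[rule_format, of k] by simp_all
  have Qp: "prime q" "[q = g] (mod m)" if "q \<in> Q k" for q k using that Q(2)[of k] by auto
  have sumA: "(\<Sum>j<r. infsum (\<lambda>n. c j (u * n) / of_nat n ^ Suc s) UNIV) = of_real (D u)" for u
  proof -
    have "(\<Sum>j<r. infsum (\<lambda>n. c j (u * n) / of_nat n ^ Suc s) UNIV)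
        = infsum (\<lambda>n. \<Sum>j<r. c j (u * n) / of_nat n ^ Suc s) UNIV"
      by (rule infsum_sum_swap[symmetric], simp,
        rule Infinite_Sum.abs_summable_summable[OF bounded_dirichlet_summable_on[OF cB s]])
    also have "\<dots> = infsum (\<lambda>n. of_real (A (n * u) / real n ^ Suc s)) UNIV"
      by (intro infsum_cong) (simp add: sum_divide_distrib[symmetric] c1 mult.commute)
    also have "\<dots> = of_real (D u)"
      unfolding D_def
      by (intro infsumI has_sum_bounded_linear[OF bounded_linear_of_real] has_sum_infsum
          bounded_dirichlet_summable_on_real[where B = B] B s)
    finally show ?thesis .
  qed
  have sumC: "(\<Sum>j<r. C j) = of_real (D 1)" "(\<Sum>j<r. C j * \<xi> j) = of_real (D g)"
  proof -
    show "(\<Sum>j<r. C j) = of_real (D 1)" using sumA[of 1] by (simp add: C_def)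
    have "C j * \<xi> j = infsum (\<lambda>n. c j (g * n) / of_nat n ^ Suc s) UNIV" for j
      unfolding C_def c2[OF cong_refl]
      by (subst mult.commute, subst infsum_cmult_right'[symmetric]) simp
    then show "(\<Sum>j<r. C j * \<xi> j) = of_real (D g)" using sumA[of g] by simp
  qed
  \<comment> \<open>The empty sieve with \<open>w = 0\<close> is the plain twist by
    \<open>1 / n ^ s\<close>.\<close>
  have D1: "D 1 \<noteq> 0"
  proof -
    have "(\<Sum>j<r. infsum (\<lambda>n. c j n / of_nat n ^ Suc s) {n. n > 0 \<and> (\<forall>q\<in>{}. \<not> q dvd n)} *
           (\<Prod>q\<in>{}. 1 / (1 - \<xi> j * 0 / of_nat q))) \<noteq> 0"
      by (rule sieve_twist_nonzero[OF nv]) (use c1 cB \<xi>1 s in auto)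
    moreover have "infsum (\<lambda>n. c j n / of_nat n ^ Suc s) {n. n > 0 \<and> (\<forall>q\<in>{}. \<not> q dvd n)} = C j" for j
      unfolding C_def by (rule infsum_cong_neutral) auto
    ultimately show ?thesis using sumC(1) by auto
  qed
  have "(\<Sum>j<r. C j * exp (\<xi> j * z)) \<noteq> 0" for z
  proof (rule exponential_sum_nonzero_if_sieved_nonzero[where Q = Q and
      CQ = "\<lambda>k j. infsum (\<lambda>n. c j n / of_nat n ^ Suc s) {n. n > 0 \<and> (\<forall>q\<in>Q k. \<not> q dvd n)}"])
    show "(\<lambda>k. infsum (\<lambda>n. c j n / of_nat n ^ Suc s) {n. n > 0 \<and> (\<forall>q\<in>Q k. \<not> q dvd n)}) \<longlonglongrightarrow> C j" for j
      unfolding C_def by (rule sifted_infsum_tendsto[OF csum]) (use Q(2) in auto)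
    show "(\<Sum>j<r. infsum (\<lambda>n. c j n / of_nat n ^ Suc s) {n. n > 0 \<and> (\<forall>q\<in>Q k. \<not> q dvd n)} *
           (\<Prod>q\<in>Q k. 1 / (1 - \<xi> j * w / of_nat q))) \<noteq> 0" if "norm w < 1" for k w
      by (rule sieve_twist_nonzero[OF nv]) (use c1 c2[OF Qp(2)] cB \<xi>1 s Q(1) Qp(1) that in auto)
    show "q > 0" if "q \<in> Q k" for k q using that Q(2)[of k] by (auto intro: prime_gt_0_nat)
    show "(\<Sum>j<r. C j) \<noteq> 0" using D1 sumC(1) by simp
  qed (use Q \<xi>1 in auto)
  then obtain b where b: "b ^ r = 1" "(\<Sum>j<r. C j * \<xi> j) = b * (\<Sum>j<r. C j)"
    using exponential_sum_nonvanishing[of "{..<r}" \<xi> r C] \<xi>r r by auto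
  have "b = of_real (D g / D 1)" using b(2) D1 unfolding sumC by (simp add: field_simps)
  moreover have "norm b = 1"
  proof -
    have "norm b ^ r = 1" using b(1) by (metis norm_one norm_power)
    then show ?thesis using power_eq_imp_eq_base[of "norm b" r 1] r by simp
  qed
  ultimately have "norm (complex_of_real (D g / D 1)) = 1" by simp
  then have "\<bar>D g\<bar> = \<bar>D 1\<bar>" using D1 unfolding norm_of_real abs_divide by simp
  then show ?thesis by (simp add: abs_eq_iff)
qed

text \<open>After multiplication by \<open>k ^ Suc (Suc s)\<close> all later terms carry a factor of
  at most \<open>(k / Suc k) ^ s\<close>; two powers of \<open>n\<close> are kept aside so that the
  tail converges.\<close>

lemma dirichlet_tendsto_first:
  fixes f :: "nat \<Rightarrow> real"
  assumes B: "\<And>n. \<bar>f n\<bar> \<le> B" and k: "k > 0" and z: "\<And>n. 0 < n \<Longrightarrow> n < k \<Longrightarrow> f n = 0"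
  shows "(\<lambda>s. real k ^ Suc (Suc s) * infsum (\<lambda>n. f n / real n ^ Suc (Suc s)) UNIV) \<longlonglongrightarrow> f k"
proof -
  have B0: "B \<ge> 0" using B[of 0] by simp
  have summ: "(\<lambda>n. f n / real n ^ Suc (Suc s)) summable_on S" for s S
    by (rule bounded_dirichlet_summable_on_real[where B = B]) (use B in auto)
  define G where "G = infsum (\<lambda>n. B * (1 / (real n)\<^sup>2)) {Suc k..}"
  have Gs: "(\<lambda>n. B * (1 / (real n)\<^sup>2)) summable_on {Suc k..}"
    by (intro summable_on_cmult_right inverse_square_summable_on)
  have bound: "\<bar>real k ^ Suc (Suc s) * infsum (\<lambda>n. f n / real n ^ Suc (Suc s)) UNIV - f k\<bar>
      \<le> (real k)\<^sup>2 * G * (real k / real (Suc k)) ^ s" for s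
  proof -
    let ?g = "\<lambda>n. f n / real n ^ Suc (Suc s)"
    have "infsum ?g UNIV = infsum ?g ({k} \<union> {Suc k..})"
    proof (rule infsum_cong_neutral)
      fix n assume "n \<in> UNIV - ({k} \<union> {Suc k..})"
      then have "n < k" by auto
      then show "?g n = 0" using z[of n] by (cases "n = 0") auto
    qed auto
    also have "\<dots> = infsum ?g {k} + infsum ?g {Suc k..}"
      by (rule infsum_Un_disjoint[OF summ summ]) auto
    finally have eq: "real k ^ Suc (Suc s) * infsum ?g UNIV - f k
        = real k ^ Suc (Suc s) * infsum ?g {Suc k..}"
      using k by (simp add: field_simps)
    have "\<bar>infsum ?g {Suc k..}\<bar> \<le> infsum (\<lambda>n. \<bar>?g n\<bar>) {Suc k..}"
      using norm_infsum_bound[OF summ[of s "{Suc k..}", THEN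
          summable_on_iff_abs_summable_on_real[THEN iffD1]]]
      by simp
    also have "\<dots> \<le> infsum (\<lambda>n. (1 / real (Suc k)) ^ s * (B * (1 / (real n)\<^sup>2))) {Suc k..}"
    proof (rule infsum_mono)
      show "(\<lambda>n. \<bar>?g n\<bar>) summable_on {Suc k..}"
        using summ[of s "{Suc k..}", THEN summable_on_iff_abs_summable_on_real[THEN iffD1]] by simp
      show "(\<lambda>n. (1 / real (Suc k)) ^ s * (B * (1 / (real n)\<^sup>2))) summable_on {Suc k..}"
        by (intro summable_on_cmult_right Gs)
      fix n assume n: "n \<in> {Suc k..}"
      have "\<bar>?g n\<bar> = \<bar>f n\<bar> * ((1 / real n) ^ s * (1 / (real n)\<^sup>2))"
        by (simp add: power_divide power2_eq_square abs_divide)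
      also have "\<dots> \<le> B * ((1 / real (Suc k)) ^ s * (1 / (real n)\<^sup>2))"
        using n B[of n] B0 by (intro mult_mono power_mono divide_left_mono) auto
      finally show "\<bar>?g n\<bar> \<le> (1 / real (Suc k)) ^ s * (B * (1 / (real n)\<^sup>2))" by (simp add: mult_ac)
    qed
    also have "\<dots> = (1 / real (Suc k)) ^ s * G"
      unfolding G_def by (rule infsum_cmult_right')
    finally have "real k ^ Suc (Suc s) * \<bar>infsum ?g {Suc k..}\<bar>
        \<le> real k ^ Suc (Suc s) * ((1 / real (Suc k)) ^ s * G)"
      by (rule mult_left_mono) simp
    also have "\<dots> = (real k)\<^sup>2 * G * (real k / real (Suc k)) ^ s"
      by (simp add: power_divide power2_eq_square)
    finally show ?thesis unfolding eq by (simp add: abs_mult)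
  qed
  have "(\<lambda>s. (real k)\<^sup>2 * G * (real k / real (Suc k)) ^ s) \<longlonglongrightarrow> (real k)\<^sup>2 * G * 0"
    by (intro tendsto_intros LIMSEQ_power_zero) auto
  then have "(\<lambda>s. real k ^ Suc (Suc s) * infsum (\<lambda>n. f n / real n ^ Suc (Suc s)) UNIV - f k) \<longlonglongrightarrow> 0"
    unfolding mult_zero_right
    by (rule Lim_null_comparison[rotated], intro always_eventually allI) (simp only: real_norm_def bound)
  then show ?thesis by (rule LIM_zero_cancel)
qed

text \<open>Induction on the index: once all smaller coefficients vanish, the rescaled series tend
  to \<open>f k\<close>, yet they are 0 for infinitely many \<open>s\<close>. Infinitely many
  \<open>s\<close> is what the choice between two signs will supply.\<close>

lemma dirichlet_coefficients_zero:
  fixes f :: "nat \<Rightarrow> real"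
  assumes B: "\<And>n. \<bar>f n\<bar> \<le> B"
    and ev: "\<exists>\<^sub>F s in sequentially. infsum (\<lambda>n. f n / real n ^ Suc (Suc s)) UNIV = 0"
    and n: "n > 0"
  shows "f n = 0"
  using n
proof (induction n rule: less_induct)
  case (less k)
  have "(\<lambda>s. real k ^ Suc (Suc s) * infsum (\<lambda>n. f n / real n ^ Suc (Suc s)) UNIV) \<longlonglongrightarrow> f k"
    by (rule dirichlet_tendsto_first[OF B]) (use less in auto)
  moreover have "\<exists>\<^sub>F s in sequentially. real k ^ Suc (Suc s) * infsum (\<lambda>n. f n / real n ^ Suc (Suc
      s)) UNIV = 0"
    using ev by (rule frequently_elim1) simp
  ultimately show "f k = 0"
    using tendsto_imp_eventually_ne unfolding frequently_def by fastforce
qed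

text \<open>For each exponent the two Dirichlet series agree up to a sign, which might depend on the
  exponent. One of the two signs occurs infinitely often, and uniqueness of the coefficients along
  those exponents turns it into an identity for every \<open>n\<close>.\<close>

lemma rich_class_character:
  fixes A :: "nat \<Rightarrow> real" and m g :: nat
  assumes m: "m > 0" and per: "\<And>a b. [a = b] (mod m) \<Longrightarrow> A a = A b"
    and nv: "twists_nonvanishing A" and cop: "coprime g m"
    and rich: "\<not> summable (\<lambda>k. indicator {k. prime k \<and> [k = g] (mod m)} k / real k)"
  obtains \<sigma> :: real where "\<bar>\<sigma>\<bar> = 1" "\<And>n. n > 0 \<Longrightarrow> A (g * n) = \<sigma> * A n"
proof -
  obtain B where B: "\<And>n. \<bar>A n\<bar> \<le> B" using periodic_bounded[of m A] m per by blast
  define D where "D u s = infsum (\<lambda>d. A (d * u) / real d ^ Suc (Suc s)) UNIV" for u s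
  have "D g s = D 1 s \<or> D g s = - D 1 s" for s
    unfolding D_def using rich_class_sign[of m A g "Suc s", OF m per nv cop rich] by simp
  then have "(\<exists>\<^sub>F s in sequentially. D g s = D 1 s) \<or> (\<exists>\<^sub>F s in sequentially. D g s = - D 1 s)"
    by (simp add: frequently_disj_iff[symmetric])
  then obtain \<sigma> :: real where \<sigma>: "\<bar>\<sigma>\<bar> = 1" "\<exists>\<^sub>F s in sequentially. D g s = \<sigma> * D 1 s"
  proof (elim disjE)
    assume "\<exists>\<^sub>F s in sequentially. D g s = D 1 s"
    then show ?thesis by (intro that[of 1]) auto
  next
    assume "\<exists>\<^sub>F s in sequentially. D g s = - D 1 s"
    then show ?thesis by (intro that[of "-1"]) auto
  qed
  have summ: "(\<lambda>d. A (d * u) / real d ^ Suc (Suc s)) summable_on UNIV" for u s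
    by (rule bounded_dirichlet_summable_on_real[where B = B]) (use B in auto)
  have "infsum (\<lambda>d. (A (d * g) - \<sigma> * A (d * 1)) / real d ^ Suc (Suc s)) UNIV = D g s - \<sigma> * D 1 s" for s
  proof -
    have "((\<lambda>d. A (d * g) / real d ^ Suc (Suc s) + (- \<sigma>) * (A (d * 1) / real d ^ Suc (Suc s)))
        has_sum (D g s + (- \<sigma>) * D 1 s)) UNIV"
      unfolding D_def by (intro has_sum_add has_sum_cmult_right has_sum_infsum summ)
    then show ?thesis by (intro infsumI) (simp add: diff_divide_distrib)
  qed
  then have "\<exists>\<^sub>F s in sequentially. infsum (\<lambda>d. (A (d * g) - \<sigma> * A (d * 1)) / real d ^ Suc (Suc s)) UNIV = 0"
    using \<sigma>(2) by simp
  then have "A (n * g) - \<sigma> * A (n * 1) = 0" if "n > 0" for n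
  proof (rule dirichlet_coefficients_zero[rotated])
    fix n
    have "\<bar>\<sigma> * A (n * 1)\<bar> \<le> B" using B \<sigma>(1) by (simp add: abs_mult)
    with B[of "n * g"] show "\<bar>A (n * g) - \<sigma> * A (n * 1)\<bar> \<le> 2 * B" by linarith
  qed (rule that)
  then have "A (g * n) = \<sigma> * A n" if "n > 0" for n using that by (simp add: mult.commute[of g])
  with \<sigma>(1) show ?thesis by (rule that)
qed

text \<open>The class of \<open>u\<close> has a representative built from primes of rich classes,
  and the signs of these primes multiply.\<close>

proposition unit_class_character:
  fixes A :: "nat \<Rightarrow> real" and m u :: nat
  assumes m: "m > 0" and per: "\<And>a b. [a = b] (mod m) \<Longrightarrow> A a = A b"
    and nv: "twists_nonvanishing A" and cop: "coprime u m"
  obtains \<sigma> :: real where "\<bar>\<sigma>\<bar> = 1" "\<And>n. n > 0 \<Longrightarrow> A (u * n) = \<sigma> * A n"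
proof -
  obtain v where v: "v > 0" "[v = u] (mod m)" and
    rich: "\<And>q. prime q \<Longrightarrow> q dvd v \<Longrightarrow> \<not> summable (\<lambda>k. indicator {k. prime k \<and> [k = q] (mod m)} k / real k)"
    by (rule unit_class_rich_prime_factors[OF m cop]) (rule that)
  have copv: "coprime v m" using v(2) cop by (metis cong_imp_coprime cong_sym)
  have "\<exists>\<sigma>::real. \<bar>\<sigma>\<bar> = 1 \<and> (\<forall>n>0. A (v * n) = \<sigma> * A n)"
    using v(1) rich copv
  proof (induction v rule: prime_divisors_induct)
    case (unit x)
    then show ?case by (intro exI[of _ 1]) simp
  next
    case (factor q x)
    have "x > 0" using factor.prems(1) by simp
    with factor obtain \<sigma> :: real where \<sigma>: "\<bar>\<sigma>\<bar> = 1" "\<And>n. n > 0 \<Longrightarrow> A (x * n) = \<sigma> * A n"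
      by fastforce
    obtain \<tau> :: real where \<tau>: "\<bar>\<tau>\<bar> = 1" "\<And>n. n > 0 \<Longrightarrow> A (q * n) = \<tau> * A n"
      using rich_class_character[of m A q, OF m per nv] factor by auto
    have "A (q * x * n) = \<tau> * \<sigma> * A n" if "n > 0" for n
      using \<sigma>(2)[OF that] \<tau>(2)[of "x * n"] that \<open>x > 0\<close> by (simp add: mult.assoc)
    then show ?case using \<sigma>(1) \<tau>(1) by (intro exI[of _ "\<tau> * \<sigma>"]) (auto simp: abs_mult)
  qed simp
  then obtain \<sigma> :: real where \<sigma>: "\<bar>\<sigma>\<bar> = 1" "\<And>n. n > 0 \<Longrightarrow> A (v * n) = \<sigma> * A n" by blast
  have "A (u * n) = A (v * n)" for n
    by (intro per cong_mult cong_refl cong_sym[OF v(2)])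
  then have "A (u * n) = \<sigma> * A n" if "n > 0" for n using \<sigma>(2)[OF that] by simp
  with \<sigma>(1) show ?thesis by (rule that)
qed

section \<open>Sign patterns on the grid\<close>

text \<open>A nontrivial sign makes both outermost cells empty, so the first and last jumps limit
  \<open>x'\<close> to 0 or 1 and \<open>x\<close> to 0 or -1. In each of the four combinations, the
  demand that \<open>v\<close> stay in {0, 1} from cell to cell fixes signs at small arguments,
  until they clash with multiplicativity, with \<open>r (p - s) = r s\<close>, with nontriviality or
  with the existence of a jump.\<close>

lemma sign_pattern_trivial:
  fixes v r :: "nat \<Rightarrow> real" and x x' :: real and p N :: nat
  assumes p: "prime p" "p \<ge> 7" and N: "p dvd N" "N \<ge> p" "odd N"
    and v: "\<And>i. v i = 0 \<or> v i = 1"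
    and \<delta>: "\<And>s. 0 < s \<Longrightarrow> s < N \<Longrightarrow> \<not> p dvd s \<Longrightarrow> v (Suc s) - v s = r s * (if odd s then x' else x)"
    and r: "\<And>s. \<not> p dvd s \<Longrightarrow> r s = 1 \<or> r s = -1"
    and mult: "\<And>a b. \<not> p dvd a \<Longrightarrow> \<not> p dvd b \<Longrightarrow> r (a * b) = r a * r b"
    and modp: "\<And>a b. \<not> p dvd a \<Longrightarrow> [a = b] (mod p) \<Longrightarrow> r a = r b"
    and rN: "r (N - 1) = 1"
    and ends: "\<And>t. \<not> p dvd t \<Longrightarrow> r t = -1 \<Longrightarrow> v 1 = 0 \<and> v N = 0"
    and ex: "\<exists>s. 0 < s \<and> s < N \<and> \<not> p dvd s \<and> v (Suc s) \<noteq> v s"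
    and t: "\<not> p dvd t"
  shows "r t = 1"
proof (rule ccontr)
  assume "r t \<noteq> 1"
  then have rt: "r t = -1" using r[OF t] by blast
  have ends: "v 1 = 0" "v N = 0" using ends[OF t rt] by auto
  have oddp: "odd p" using p prime_odd_nat[of p] by auto
  have nd: "\<not> p dvd s" if "0 < s" "s < p" for s using that by (auto dest: dvd_imp_le)
  have \<delta>o: "v (Suc s) = v s + r s * x'" if "0 < s" "s < p" "odd s" for s
    using \<delta>[OF that(1)] nd[OF that(1,2)] that N(2) by auto
  have \<delta>e: "v (Suc s) = v s + r s * x" if "0 < s" "s < p" "even s" for s
    using \<delta>[OF that(1)] nd[OF that(1,2)] that N(2) by auto
  have rp: "r s = 1 \<or> r s = -1" if "0 < s" "s < p" for s using r nd that by blast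
  have r1: "r 1 = 1" using mult[of 1 1] r[of 1] nd[of 1] p by auto
  have cong1: "[p - 1 = N - 1] (mod p)"
  proof -
    obtain k where k: "N = p * k" using N(1) by blast
    then have "k \<ge> 1" using N(2) p by (cases k) auto
    then have "N - 1 = (p - 1) + p * (k - 1)" using k p by (cases k) auto
    then show ?thesis by (simp add: cong_def)
  qed
  have rm1: "r (p - 1) = 1"
    using modp[OF _ cong1] nd[of "p - 1"] p rN by auto
  \<comment> \<open>The character is even: \<open>(p - 1) * s\<close> is congruent to
    \<open>p - s\<close>, and \<open>r (p - 1) = 1\<close>.\<close>
  have refl: "r (p - s) = r s" if "0 < s" "s < p" for s
  proof -
    have "(p - 1) * s = (p - s) + p * (s - 1)"
      using that by (cases s) (auto simp: algebra_simps diff_mult_distrib)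
    then have "[p - s = (p - 1) * s] (mod p)" by (simp add: cong_def)
    then have "r (p - s) = r ((p - 1) * s)" using nd[of "p - s"] that by (intro modp) auto
    also have "\<dots> = r s" using nd[of "p - 1"] nd[OF that] p rm1 by (simp add: mult)
    finally show ?thesis .
  qed
  have x': "x' = 0 \<or> x' = 1"
    using \<delta>o[of 1] ends(1) v[of "Suc 1"] r1 p by auto
  have x: "x = 0 \<or> x = -1"
  proof -
    have "\<not> p dvd N - 1"
      using cong1 nd[of "p - 1"] p cong_dvd_iff[of "p - 1" "N - 1" p] by auto
    then have "v (Suc (N - 1)) - v (N - 1) = r (N - 1) * x"
      using \<delta>[of "N - 1"] N p by auto
    then show ?thesis using ends(2) rN v[of "N - 1"] N p by auto
  qed
  have t0: "0 < t mod p" "t mod p < p" "r (t mod p) = -1"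
    using t p rt modp[OF t, of "t mod p"] by (auto simp: dvd_eq_mod_eq_0)
  consider "x' = 0" "x = 0" | "x' = 1" "x = -1" | "x' = 0" "x = -1" | "x' = 1" "x = 0"
    using x x' by blast
  then show False
  proof cases
    case 1
    then show False using ex \<delta> by fastforce
  next
    case 2
    \<comment> \<open>A sign -1 at some \<open>s\<close> would push \<open>v\<close> to -1 or 2, so
      all signs below \<open>p\<close> are 1, against \<open>t0\<close>.\<close>
    have "v (Suc s) = (if odd s then 1 else 0) \<and> (0 < s \<longrightarrow> r s = 1)" if "s < p" for s
      using that
    proof (induction s)
      case 0
      then show ?case using ends by simp
    next
      case (Suc s)
      then have IH: "v (Suc s) = (if odd s then 1 else 0)" by simp
      show ?case
        using \<delta>o[of "Suc s"] \<delta>e[of "Suc s"] IH 2 Suc.prems v[of "Suc (Suc s)"] rp[of "Suc s"]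
        by (cases "odd s") auto
    qed
    then show False using t0 by fastforce
  next
    case 3
    \<comment> \<open>Only even \<open>s\<close> can jump here, by \<open>- r s\<close>. This gives
      the signs -1, 1, -1 at 2, 4, 6. For \<open>p = 7\<close> the last one contradicts
      \<open>r (p - 1) = 1\<close>; a larger \<open>p\<close> fails at 8, where multiplicativity
      dictates the sign -1.\<close>
    have v2: "v 2 = 0" using \<delta>o[of 1] 3 ends p by (simp add: numeral_2_eq_2)
    have v3: "v 3 = - r 2" using \<delta>e[of 2] 3 v2 p by (simp add: numeral_3_eq_3)
    have r2: "r 2 = -1" using v3 v[of 3] rp[of 2] p by auto
    have v4: "v 4 = 1" using \<delta>o[of 3] 3 v3 r2 p by simp
    have r4: "r 4 = 1" using mult[of 2 2] r2 nd[of 2] p by simp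
    have v5: "v 5 = 0" using \<delta>e[of 4] 3 v4 r4 p by simp
    have v6: "v 6 = 0" using \<delta>o[of 5] 3 v5 p by simp
    have v7: "v 7 = - r 6" using \<delta>e[of 6] 3 v6 p by simp
    have r6: "r 6 = -1" using v7 v[of 7] rp[of 6] p by auto
    show False
    proof (cases "p = 7")
      case True
      then show False using r6 rm1 by simp
    next
      case False
      then have "p \<noteq> 8" "p > 7" using p oddp by auto
      then have p8: "p > 8" by simp
      have v8: "v 8 = 1" using \<delta>o[of 7] 3 v7 r6 p8 by simp
      have "r 8 = -1" using mult[of 2 4] r2 r4 nd[of 2] nd[of 4] p by simp
      then have "v 9 = 2" using \<delta>e[of 8] 3 v8 p8 by simp
      then show False using v[of 9] by simp
    qed
  next
    case 4
    \<comment> \<open>Only odd \<open>s\<close> can jump here, by \<open>r s\<close>. Starting from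
      the empty first cell, the signs at 1, 3, 5, ... have to alternate, so on odd numbers below
      \<open>p\<close> they agree with the nontrivial character modulo 4.\<close>
    have claim: "(4 * k + 1 < p \<longrightarrow> r (4 * k + 1) = 1) \<and> (4 * k + 3 < p \<longrightarrow> r (4 * k + 3) = -1) \<and>
      (4 * k + 4 < p \<longrightarrow> v (4 * k + 5) = 0)" for k
    proof (induction k)
      case 0
      have v2: "v 2 = 1" using \<delta>o[of 1] 4 ends p r1 by (simp add: numeral_2_eq_2)
      have v3: "v 3 = 1" using \<delta>e[of 2] 4 v2 p by (simp add: numeral_3_eq_3)
      have v4: "v 4 = 1 + r 3" using \<delta>o[of 3] 4 v3 p by simp
      have r3: "r 3 = -1" using v4 v[of 4] rp[of 3] p by auto
      have v5: "v 5 = 0" using \<delta>e[of 4] 4 v4 r3 p by simp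
      show ?case using r1 r3 v5 by simp
    next
      case (Suc k)
      show ?case
      proof (cases "4 * Suc k + 1 < p")
        case True
        then have a: "v (4 * Suc k + 1) = 0" using Suc by (simp add: algebra_simps)
        have b: "v (4 * Suc k + 2) = r (4 * Suc k + 1)" using \<delta>o[of "4 * Suc k + 1"] a 4 True by simp
        have c: "r (4 * Suc k + 1) = 1" using b v[of "4 * Suc k + 2"] rp[OF _ True] by auto
        have d: "v (4 * Suc k + 3) = 1" if "4 * Suc k + 2 < p"
          using \<delta>e[of "4 * Suc k + 2"] b c 4 that by (simp add: numeral_3_eq_3)
        have e: "v (4 * Suc k + 4) = 1 + r (4 * Suc k + 3)" if "4 * Suc k + 3 < p"
          using \<delta>o[of "4 * Suc k + 3"] d 4 that by simp
        have f: "r (4 * Suc k + 3) = -1" if "4 * Suc k + 3 < p"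
          using e[OF that] v[of "4 * Suc k + 4"] rp[OF _ that] by auto
        have g: "v (4 * Suc k + 5) = 0" if "4 * Suc k + 4 < p"
          using \<delta>e[of "4 * Suc k + 4"] e f 4 that by simp
        show ?thesis using c f g by blast
      next
        case False
        then show ?thesis by auto
      qed
    qed
    have r3: "r 3 = -1" using claim[of 0] p by simp
    have "p mod 4 = 1 \<or> p mod 4 = 3" using oddp by presburger
    then show False
    proof
      assume m: "p mod 4 = 1"
      \<comment> \<open>Both \<open>p - 2\<close> and \<open>p - 6\<close> are 3 modulo 4, so by
        reflection 2 and 6 get the sign -1, as does 3; this contradicts
        \<open>6 = 2 * 3\<close>.\<close>
      define k where "k = p div 4 - 2"
      have pk: "p = 4 * k + 9" unfolding k_def using m p by presburger
      have "r 2 = -1" using claim[of "k + 1"] refl[of 2] pk by (simp add: algebra_simps)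
      moreover have "r 6 = -1" using claim[of k] refl[of 6] pk by (simp add: algebra_simps)
      moreover have "r 6 = r 2 * r 3" using mult[of 2 3] nd[of 2] nd[of 3] p by simp
      ultimately show False using r3 by simp
    next
      assume m: "p mod 4 = 3"
      \<comment> \<open>Now \<open>p - 4\<close> is 3 modulo 4, so the square 4 would get the sign
        -1.\<close>
      define k where "k = p div 4 - 1"
      have pk: "p = 4 * k + 7" unfolding k_def using m p by presburger
      have "r 4 = -1" using claim[of k] refl[of 4] pk by (simp add: algebra_simps)
      moreover have "r 4 = r 2 * r 2" using mult[of 2 2] nd[of 2] p by simp
      ultimately show False using rp[of 2] p by auto
    qed
  qed
qed

text \<open>Three jumps of each parity lead from \<open>v 1\<close> to \<open>v 7\<close>, so
  \<open>3 * (x + x')\<close> is a difference of two values in {0, 1}; as \<open>x\<close> and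
  \<open>x'\<close> are integers, \<open>x' = - x\<close> and the jumps alternate. At a multiple of
  \<open>p\<close> no jump is prescribed, but those at its two neighbours are.\<close>

lemma alternating_if_parity_pattern:
  fixes v :: "nat \<Rightarrow> real" and x x' :: real and p N :: nat
  assumes p: "prime p" "p \<ge> 7" and N: "p dvd N" "N \<ge> p"
    and v: "\<And>i. v i = 0 \<or> v i = 1"
    and \<delta>: "\<And>s. 0 < s \<Longrightarrow> s < N \<Longrightarrow> \<not> p dvd s \<Longrightarrow> v (Suc s) - v s = (if odd s then x' else x)"
    and ex: "\<exists>s. 0 < s \<and> s < N \<and> \<not> p dvd s \<and> v (Suc s) \<noteq> v s"
    and s: "0 < s" "s < N"
  shows "v (Suc s) \<noteq> v s"
proof -
  have nd: "\<not> p dvd s" if "0 < s" "s < p" for s using that by (auto dest: dvd_imp_le)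
  have \<delta>p: "v (s + 1) = v s + (if odd s then x' else x)" if "0 < s" "s < p" for s
    using \<delta>[OF that(1)] nd[OF that] that N(2) by auto
  have v2: "v 2 = v 1 + x'" using \<delta>p[of 1] p by (simp add: numeral_2_eq_2)
  have v7: "v 7 = v 1 + 3 * (x + x')"
    using v2 \<delta>p[of 2] \<delta>p[of 3] \<delta>p[of 4] \<delta>p[of 5] \<delta>p[of 6] p
    by simp
  have xx: "x' = -1 \<or> x' = 0 \<or> x' = 1" "x = -1 \<or> x = 0 \<or> x = 1"
    using v2 \<delta>p[of 2] v[of 1] v[of 2] v[of 3] p by auto
  have sum0: "x' = - x" using v7 xx v[of 7] v[of 1] by auto
  have x0: "x \<noteq> 0"
  proof
    assume "x = 0"
    obtain s where s: "0 < s" "s < N" "\<not> p dvd s" "v (Suc s) \<noteq> v s" using ex by blast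
    then show False using \<delta>[OF s(1-3)] sum0 \<open>x = 0\<close> by (auto split: if_splits)
  qed
  show ?thesis
  proof (cases "p dvd s")
    case False
    then show ?thesis using \<delta>[OF s False] sum0 x0 by (auto split: if_splits)
  next
    case True
    \<comment> \<open>Both \<open>s\<close> and \<open>N\<close> are multiples of \<open>p\<close>,
      so the gap between them is at least \<open>p\<close>.\<close>
    have "s + 1 < N"
    proof -
      obtain a b where "s = p * a" "N = p * b" using True N(1) by blast
      then have "a + 1 \<le> b" using s by (metis Suc_eq_plus1 Suc_leI mult_less_cancel1)
      then have "p * (a + 1) \<le> N" unfolding \<open>N = p * b\<close> by (rule mult_le_mono2)
      then show ?thesis using \<open>s = p * a\<close> p by simp
    qed
    have sp: "s \<ge> p" using True s(1) by (simp add: dvd_imp_le)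
    have nd1: "\<not> p dvd s + 1" using True p by (metis dvd_add_right_iff not_prime_unit)
    have nd2: "\<not> p dvd s - 1"
    proof
      assume "p dvd s - 1"
      then have "p dvd s - (s - 1)" by (rule dvd_diff_nat[OF True])
      then show False using s p by simp
    qed
    have a: "v s - v (s - 1) = (if odd (s - 1) then x' else x)"
      using \<delta>[of "s - 1"] nd2 s sp p by auto
    have b: "v (Suc (s + 1)) - v (s + 1) = (if odd (s + 1) then x' else x)"
      using \<delta>[of "s + 1"] nd1 \<open>s + 1 < N\<close> by auto
    \<comment> \<open>The jumps at \<open>s - 1\<close> and \<open>s + 1\<close> are therefore equal
      and nonzero; \<open>v s\<close> is the value after such a jump and \<open>v (s + 1)\<close>
      the value before one, so they differ.\<close>
    have "odd (s + 1) = odd (s - 1)" using s by (cases s) auto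
    then show ?thesis
      using a b x0 sum0 v[of s] v[of "s - 1"] v[of "Suc (s + 1)"] v[of "s + 1"] by (auto split: if_splits)
  qed
qed

section \<open>Reduction modulo p and cosine sums on the grid\<close>

lemma cong_power_prime_power:
  fixes a b :: nat and p :: nat
  assumes "prime p" "[a = b] (mod p)"
  shows "[a ^ p ^ k = b ^ p ^ k] (mod p ^ Suc k)"
proof (induction k)
  case 0
  then show ?case using assms by simp
next
  case (Suc k)
  define x y where "x = int (a ^ p ^ k)" and "y = int (b ^ p ^ k)"
  have dv: "int (p ^ Suc k) dvd x - y"
    using Suc unfolding x_def y_def by (metis cong_iff_dvd_diff cong_int_iff)
  then have xy: "[x = y] (mod int p)"
    unfolding cong_iff_dvd_diff by (metis dvd_trans dvd_triv_left of_nat_dvd_iff power_Suc)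
  \<comment> \<open>The cofactor of \<open>x - y\<close> in \<open>x ^ p - y ^ p\<close> is
    congruent to \<open>p * y ^ (p - 1)\<close>, that is to 0, modulo \<open>p\<close>; this gains
    one more power of \<open>p\<close>.\<close>
  have "[(\<Sum>i<p. y ^ (p - Suc i) * x ^ i) = (\<Sum>i<p. y ^ (p - 1))] (mod int p)"
  proof (rule cong_sum)
    fix i assume i: "i \<in> {..<p}"
    have "[y ^ (p - Suc i) * x ^ i = y ^ (p - Suc i) * y ^ i] (mod int p)"
      by (intro cong_mult cong_refl cong_pow xy)
    also have "y ^ (p - Suc i) * y ^ i = y ^ (p - 1)" using i by (simp flip: power_add)
    finally show "[y ^ (p - Suc i) * x ^ i = y ^ (p - 1)] (mod int p)" .
  qed
  then have "int p dvd (\<Sum>i<p. y ^ (p - Suc i) * x ^ i)" by (simp add: cong_dvd_iff)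
  then have "int (p ^ Suc k) * int p dvd (x - y) * (\<Sum>i<p. y ^ (p - Suc i) * x ^ i)"
    using dv by (rule mult_dvd_mono[rotated])
  then have "int (p ^ Suc (Suc k)) dvd x ^ p - y ^ p"
    by (simp add: power_diff_sumr2 mult_ac)
  then have "[int (a ^ p ^ Suc k) = int (b ^ p ^ Suc k)] (mod int (p ^ Suc (Suc k)))"
    unfolding cong_iff_dvd_diff x_def y_def by (simp add: power_mult[symmetric] mult.commute)
  then show ?case by (simp only: cong_int_iff)
qed

lemma sum_cos_multiples:
  fixes M :: nat and t :: int
  assumes "M > 0"
  shows "(\<Sum>n<M. cos (2 * pi * real n * of_int t / real M)) = (if int M dvd t then real M else 0)"
proof (cases "int M dvd t")
  case True
  then obtain k where k: "t = int M * k" by blast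
  have "cos (2 * pi * real n * of_int t / real M) = 1" for n
  proof -
    have "2 * pi * real n * of_int t / real M = 2 * pi * of_int (int n * k)"
      using assms by (simp add: k)
    then show ?thesis by (simp only: cos_int_2pin)
  qed
  then show ?thesis using True by simp
next
  case False
  define w where "w = cis (2 * pi * of_int t / real M)"
  have "w \<noteq> 1"
  proof
    assume "w = 1"
    then have "cos (2 * pi * of_int t / real M) = 1" by (simp add: w_def complex_eq_iff)
    then obtain k :: int where "2 * pi * of_int t / real M = of_int k * 2 * pi"
      using cos_one_2pi_int by auto
    then have "real_of_int t = real_of_int (int M * k)"
      using assms by (simp add: field_simps)
    then have "t = int M * k" by (simp only: of_int_eq_iff)
    with False show False by simp
  qed
  moreover have "w ^ M = 1"
  proof -
    have "real M * (2 * pi * of_int t / real M) = 2 * pi * of_int t" using assms by simp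
    then have "w ^ M = cis (2 * pi * of_int t)" unfolding w_def Complex.DeMoivre by (simp only:)
    also have "\<dots> = 1" by (simp add: complex_eq_iff cos_int_2pin sin_int_2pin)
    finally show ?thesis .
  qed
  ultimately have "(\<Sum>n<M. w ^ n) = 0" by (simp add: sum_gp_strict)
  moreover have "(\<Sum>n<M. cos (2 * pi * real n * of_int t / real M)) = Re (\<Sum>n<M. w ^ n)"
    unfolding w_def Complex.DeMoivre by (simp add: mult_ac)
  ultimately show ?thesis using False by simp
qed

lemma sum_residues_dilate:
  fixes f :: "nat \<Rightarrow> real"
  assumes "M > 0" "coprime u M" "\<And>a b. [a = b] (mod M) \<Longrightarrow> f a = f b"
  shows "(\<Sum>n<M. f (u * n)) = (\<Sum>n<M. f n)"
proof -
  have inj: "inj_on (\<lambda>n. u * n mod M) {..<M}"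
  proof (rule inj_onI)
    fix a b assume ab: "a \<in> {..<M}" "b \<in> {..<M}" "u * a mod M = u * b mod M"
    then have "[u * a = u * b] (mod M)" by (simp add: cong_def)
    then have "[a = b] (mod M)" using assms(2) cong_mult_lcancel_nat by blast
    then show "a = b" using ab by (simp add: cong_def)
  qed
  moreover have "(\<lambda>n. u * n mod M) ` {..<M} = {..<M}"
    using inj assms(1) by (intro card_subset_eq) (auto simp: card_image)
  ultimately have "bij_betw (\<lambda>n. u * n mod M) {..<M} {..<M}" by (simp add: bij_betw_def)
  then have "(\<Sum>n<M. f n) = (\<Sum>n<M. f (u * n mod M))"
    by (rule sum.reindex_bij_betw[symmetric])
  also have "\<dots> = (\<Sum>n<M. f (u * n))" by (intro sum.cong refl assms(3)) (simp add: cong_def)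
  finally show ?thesis by simp
qed

text \<open>This is \<open>pi * n\<close> times the sine coefficient of the step function with value
  \<open>v (Suc i)\<close> on the cell from \<open>i / N\<close> to \<open>(i + 1) / N\<close>.
  Numbering the values from 1 makes \<open>v (Suc s) - v s\<close> the jump at the grid point
  \<open>s / N\<close>.\<close>

definition grid_coeff :: "nat \<Rightarrow> (nat \<Rightarrow> real) \<Rightarrow> nat \<Rightarrow> real" where
  "grid_coeff N v n = (\<Sum>i<N. v (Suc i) * (cos (pi * real n * real i / real N)
      - cos (pi * real n * real (Suc i) / real N)))"

lemma cos_grid_cong:
  assumes "N > 0" "[a = b] (mod 2 * N)"
  shows "cos (pi * real a * real i / real N) = cos (pi * real b * real i / real N)"
proof -
  obtain k :: int where k: "int a - int b = int (2 * N) * k"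
    using assms(2) by (metis cong_iff_dvd_diff cong_int_iff dvdE)
  have "int a = int b + int (2 * N) * k" using k by simp
  then have "real_of_int (int a) = real_of_int (int b + int (2 * N) * k)" by (rule arg_cong)
  then have "real a = real b + 2 * real N * real_of_int k" by simp
  then have "pi * real a * real i / real N = pi * real b * real i / real N + 2 * pi * of_int (k * int i)"
    using assms(1) by (simp add: field_simps)
  then show ?thesis by (simp only: cos_add cos_int_2pin sin_int_2pin mult_1_right mult_zero_right diff_zero)
qed

lemma grid_coeff_cong:
  assumes "N > 0" "[a = b] (mod 2 * N)"
  shows "grid_coeff N v a = grid_coeff N v b"
  unfolding grid_coeff_def using cos_grid_cong[OF assms] by (simp del: of_nat_Suc)

text \<open>The product is the mean of two cosines with frequencies \<open>i - s\<close> and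
  \<open>i + s\<close>, each summing to 0 or \<open>2 * N\<close>. The second contributes only when
  \<open>i = s\<close> is an end of the grid, which is why the ends count twice.\<close>

lemma cos_grid_orthogonality:
  fixes N i s :: nat
  assumes N: "N > 0" "i \<le> N" "s \<le> N"
  shows "(\<Sum>n<2 * N. cos (pi * real n * real i / real N) * cos (pi * real n * real s / real N))
    = (if i = s then (if s = 0 \<or> s = N then 2 * real N else real N) else 0)"
proof -
  have "(\<Sum>n<2 * N. cos (pi * real n * real i / real N) * cos (pi * real n * real s / real N))
    = ((\<Sum>n<2 * N. cos (2 * pi * real n * of_int (int i - int s) / real (2 * N))) +
       (\<Sum>n<2 * N. cos (2 * pi * real n * of_int (int i + int s) / real (2 * N)))) / 2"
  proof -
    have "2 * pi * real n * of_int (int i - int s) / real (2 * N)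
        = pi * real n * real i / real N - pi * real n * real s / real N"
      "2 * pi * real n * of_int (int i + int s) / real (2 * N)
          = pi * real n * real i / real N + pi * real n * real s / real N" for n
      using N(1) by (simp_all add: field_simps)
    then show ?thesis
      unfolding sum.distrib[symmetric] sum_divide_distrib cos_times_cos by (simp only:)
  qed
  also have "\<dots> = ((if int (2 * N) dvd int i - int s then real (2 * N) else 0) +
     (if int (2 * N) dvd int i + int s then real (2 * N) else 0)) / 2"
    using N(1) by (subst (1 2) sum_cos_multiples) auto
  also have "int (2 * N) dvd int i - int s \<longleftrightarrow> i = s"
  proof
    assume "int (2 * N) dvd int i - int s"
    moreover have "\<bar>int i - int s\<bar> < int (2 * N)" using N by auto
    ultimately have "int i - int s = 0" by (meson dvd_imp_le_int not_le abs_of_nat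
        order.strict_trans2 abs_ge_self)
    then show "i = s" by simp
  qed simp
  also have "int (2 * N) dvd int i + int s \<longleftrightarrow> i = s \<and> (s = 0 \<or> s = N)"
  proof
    assume "int (2 * N) dvd int i + int s"
    then have "int (2 * N) dvd int (i + s)" by simp
    then have "2 * N dvd i + s" by (simp only: of_nat_dvd_iff)
    then have "i + s = 0 \<or> 2 * N \<le> i + s" by (metis dvd_imp_le gr0I)
    then show "i = s \<and> (s = 0 \<or> s = N)" using N by auto
  qed auto
  also have "((if i = s then real (2 * N) else 0) + (if i = s \<and> (s = 0 \<or> s = N) then real (2 * N) else 0)) / 2
      = (if i = s then (if s = 0 \<or> s = N then 2 * real N else real N) else 0)" by simp
  finally show ?thesis .
qed

text \<open>After summation by parts \<open>grid_coeff\<close> is a cosine sum whose coefficients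
  are the jumps of \<open>v\<close>, and orthogonality extracts them. The two end formulas are the
  doubled jumps from and to the value 0 outside the grid.\<close>

lemma grid_coeff_inversion:
  fixes N s :: nat and v :: "nat \<Rightarrow> real"
  assumes N: "N > 0" "s \<le> N"
  defines "D \<equiv> \<lambda>s. \<Sum>n<2 * N. grid_coeff N v n * cos (pi * real n * real s / real N)"
  shows "0 < s \<Longrightarrow> s < N \<Longrightarrow> D s = real N * (v (Suc s) - v s)"
    and "D 0 = 2 * real N * v 1"
    and "D N = - 2 * real N * v N"
proof -
  let ?c = "\<lambda>n i. cos (pi * real n * real i / real N)"
  define K where "K i s = (if i = s then (if s = 0 \<or> s = N then 2 * real N else real N) else 0)" for i s
  have D: "D s = (\<Sum>i<N. v (Suc i) * (K i s - K (Suc i) s))" if "s \<le> N" for s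
  proof -
    have "D s = (\<Sum>i<N. v (Suc i) * ((\<Sum>n<2 * N. ?c n i * ?c n s) - (\<Sum>n<2 * N. ?c n (Suc i) * ?c n s)))"
      unfolding D_def grid_coeff_def sum_distrib_right
      by (subst sum.swap, intro sum.cong refl)
        (simp add: sum_distrib_left sum_subtractf[symmetric] algebra_simps del: of_nat_Suc)
    also have "\<dots> = (\<Sum>i<N. v (Suc i) * (K i s - K (Suc i) s))"
      unfolding K_def using that N(1)
      by (intro sum.cong refl) (subst (1 2) cos_grid_orthogonality, auto)
    finally show ?thesis .
  qed
  have split: "D s = (\<Sum>i<N. if i = s then v (Suc i) * K s s else 0) - (\<Sum>i<N.
      if Suc i = s then v (Suc i) * K s s else 0)"
    if "s \<le> N" for s
    unfolding D[OF that] sum_subtractf[symmetric] by (intro sum.cong refl) (auto simp: K_def)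
  show "D s = real N * (v (Suc s) - v s)" if s: "0 < s" "s < N"
  proof -
    obtain t where t: "s = Suc t" using s by (cases s) auto
    have "(\<Sum>i<N. if Suc i = s then v (Suc i) * K s s else 0) = v s * K s s"
      using s by (simp add: t)
    then show ?thesis using split[of s] s by (simp add: K_def algebra_simps)
  qed
  show "D 0 = 2 * real N * v 1" using split[of 0] N(1) by (simp add: K_def)
  obtain t where t: "N = Suc t" using N(1) by (cases N) auto
  have "(\<Sum>i<N. if Suc i = N then v (Suc i) * K N N else 0) = v N * K N N" by (simp add: t)
  then show "D N = - 2 * real N * v N" using split[of N] N(1) by (simp add: K_def)
qed

text \<open>The rule for \<open>A (u * n)\<close> is its own dual: replacing \<open>n\<close> by
  \<open>u * n\<close> in the cosine transform gives \<open>D (u * s) = sg u * D s\<close>. So jumps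
  at grid points prime to \<open>p\<close> differ only by signs from a reference jump, one for odd
  points and one for even points, because units modulo \<open>2 * N\<close> are odd.\<close>

proposition character_forces_alternation:
  fixes p l N :: nat and v :: "nat \<Rightarrow> real"
  assumes p: "prime p" "p \<ge> 7" and l: "l \<ge> 1" and Ndef: "N = p ^ l"
    and v: "\<And>i. v i = 0 \<or> v i = 1"
    and A1: "grid_coeff N v 1 \<noteq> 0"
    and char: "\<And>u. coprime u (2 * N) \<Longrightarrow>
      \<exists>\<sigma>::real. \<bar>\<sigma>\<bar> = 1 \<and> (\<forall>n>0. grid_coeff N v (u * n) = \<sigma> * grid_coeff N v n)"
    and ex: "\<exists>s. 0 < s \<and> s < N \<and> \<not> p dvd s \<and> v (Suc s) \<noteq> v s"
    and s: "0 < s" "s < N"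
  shows "v (Suc s) \<noteq> v s"
proof -
  define A where "A = grid_coeff N v"
  have N0: "N > 0" using p by (simp add: Ndef prime_gt_0_nat)
  have pN: "p dvd N" using l by (simp add: Ndef dvd_power)
  have Nge: "N \<ge> p" using pN N0 by (rule dvd_imp_le)
  have oddp: "odd p" using p prime_odd_nat[of p] by auto
  have oddN: "odd N" using oddp by (simp add: Ndef)
  have cop: "coprime u (2 * N) \<longleftrightarrow> odd u \<and> \<not> p dvd u" for u
    using p l unfolding Ndef
    by (auto simp: coprime_power_right_iff coprime_commute[of u p] prime_imp_coprime_nat
        coprime_absorb_left coprime_absorb_right dest: coprime_common_divisor)
  define sg where "sg u = A u / A 1" for u
  have A1: "A 1 \<noteq> 0" using A1 by (simp add: A_def)
  have A0: "A 0 = 0" by (simp add: A_def grid_coeff_def)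
  have Acong: "A a = A b" if "[a = b] (mod 2 * N)" for a b
    unfolding A_def by (rule grid_coeff_cong[OF N0 that])
  have sg: "(sg u = 1 \<or> sg u = -1) \<and> A (u * n) = sg u * A n" if u: "coprime u (2 * N)" for u n
  proof -
    obtain \<sigma> :: real where \<sigma>: "\<bar>\<sigma>\<bar> = 1" "\<And>n. n > 0 \<Longrightarrow> A (u * n) = \<sigma> * A n"
      using char[OF u] unfolding A_def by blast
    have "A u = \<sigma> * A 1" using \<sigma>(2)[of 1] by simp
    then have "sg u = \<sigma>" using A1 by (simp add: sg_def)
    then show ?thesis using \<sigma> A0 by (cases "n = 0") auto
  qed
  have sgc: "sg a = sg b" if "odd a" "odd b" "[a = b] (mod N)" for a b
  proof -
    have "[a = b] (mod 2)" using that by (simp add: cong_def odd_iff_mod_2_eq_one)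
    then have "[a = b] (mod 2 * N)"
      using that(3) oddN by (intro coprime_cong_mult_nat) auto
    then show ?thesis unfolding sg_def using Acong by simp
  qed
  \<comment> \<open>Adding the odd \<open>N\<close> makes an even number odd without changing its
    residue modulo \<open>N\<close>, so that \<open>r\<close> is defined at even arguments as
    well.\<close>
  define od where "od s = (if odd s then s else s + N)" for s
  have od: "odd (od s)" "[od s = s] (mod N)" "p dvd od s \<longleftrightarrow> p dvd s" for s
    using oddN pN by (auto simp: od_def cong_def dvd_add_left_iff)
  define r where "r s = sg (od s)" for s
  have codd: "coprime (od s) (2 * N)" if "\<not> p dvd s" for s unfolding cop using od that by simp
  have r: "r s = 1 \<or> r s = -1" if "\<not> p dvd s" for s
    unfolding r_def using sg[OF codd[OF that]] by blast
  have rcong: "r a = r b" if "[a = b] (mod N)" for a b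
    unfolding r_def by (intro sgc od(1)) (meson od(2) that cong_sym cong_trans)
  have rmult: "r (a * b) = r a * r b" if "\<not> p dvd a" "\<not> p dvd b" for a b
  proof -
    have "r (a * b) = sg (od a * od b)"
      unfolding r_def
    proof (intro sgc)
      show "odd (od (a * b))" "odd (od a * od b)" using od(1) by auto
      show "[od (a * b) = od a * od b] (mod N)"
        using od(2)[of "a * b"] cong_mult[OF od(2)[of a] od(2)[of b]] by (meson cong_sym cong_trans)
    qed
    also have "\<dots> = sg (od a) * sg (od b)"
      using sg[OF codd[OF that(1)], of "od b"] by (simp add: sg_def)
    finally show ?thesis by (simp add: r_def)
  qed
  have rpow: "r (a ^ k) = r a ^ k" if "\<not> p dvd a" for a k
  proof (induction k)
    case 0
    have "\<not> p dvd 1" using p by (simp add: not_prime_unit)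
    then show ?case using rmult[of 1 1] r[of 1] by auto
  next
    case (Suc k)
    have "\<not> p dvd a ^ k" using that p by (meson prime_dvd_power_nat)
    then show ?case using rmult[OF that, of "a ^ k"] Suc by simp
  qed
  \<comment> \<open>Raising to the odd power \<open>p ^ (l - 1)\<close> leaves a sign unchanged and
    turns congruence modulo \<open>p\<close> into congruence modulo \<open>p ^ l\<close>.\<close>
  have rmod: "r a = r b" if a: "\<not> p dvd a" and ab: "[a = b] (mod p)" for a b
  proof -
    have b: "\<not> p dvd b" using a ab by (metis cong_dvd_iff)
    define M where "M = p ^ (l - 1)"
    have oddM: "odd M" using oddp by (simp add: M_def)
    have id: "r c = r (c ^ M)" if "\<not> p dvd c" for c
      using r[OF that] oddM unfolding rpow[OF that] by auto
    have "p ^ Suc (l - 1) = N" using l by (simp add: Ndef)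
    then have "[a ^ M = b ^ M] (mod N)"
      using cong_power_prime_power[OF p(1) ab, of "l - 1"] by (simp add: M_def)
    then show ?thesis using id[OF a] id[OF b] rcong by metis
  qed
  \<comment> \<open>\<open>A\<close> is even, being a combination of cosines, so the class of -1 has
    the sign 1.\<close>
  have rN: "r (N - 1) = 1"
  proof -
    have "A (2 * N - 1) = A 1"
      unfolding A_def grid_coeff_def
    proof (intro sum.cong refl arg_cong2[where f = "(*)"] arg_cong2[where f = "(-)"])
      have *: "cos (pi * real (2 * N - 1) * real i / real N) = cos (pi * real 1 * real i / real N)" for i
      proof -
        have "pi * real (2 * N - 1) * real i / real N = - (pi * real i / real N) + 2 * pi * of_int (int i)"
          using N0 by (simp add: field_simps of_nat_diff)
        then show ?thesis by (simp only: cos_add cos_int_2pin sin_int_2pin) simp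
      qed
      show "cos (pi * real (2 * N - 1) * real i / real N) = cos (pi * real 1 * real i / real N)"
        "cos (pi * real (2 * N - 1) * real (Suc i) / real N)
            = cos (pi * real 1 * real (Suc i) / real N)" for i
        by (rule *)+
    qed
    then have "sg (2 * N - 1) = 1" using A1 by (simp add: sg_def)
    moreover have "od (N - 1) = 2 * N - 1" using oddN N0 by (auto simp: od_def)
    ultimately show ?thesis by (simp add: r_def)
  qed
  define D where "D s = (\<Sum>n<2 * N. A n * cos (pi * real n * real s / real N))" for s
  have Du: "D (u * s) = sg u * D s" if u: "coprime u (2 * N)" for u s
  proof -
    have "sg u * sg u = 1" using sg[OF u, of 0] by auto
    then have Au: "A n = sg u * A (u * n)" for n using sg[OF u, of n] by (simp flip: mult.assoc)
    have "D (u * s) = (\<Sum>n<2 * N. sg u * (A (u * n) * cos (pi * real (u * n) * real s / real N)))"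
      unfolding D_def
    proof (intro sum.cong refl)
      fix n
      show "A n * cos (pi * real n * real (u * s) / real N)
          = sg u * (A (u * n) * cos (pi * real (u * n) * real s / real N))"
        by (subst Au) (simp add: mult_ac)
    qed
    also have "\<dots> = sg u * (\<Sum>n<2 * N. A (u * n) * cos (pi * real (u * n) * real s / real N))"
      by (rule sum_distrib_left[symmetric])
    also have "(\<Sum>n<2 * N. A (u * n) * cos (pi * real (u * n) * real s / real N)) = D s"
      unfolding D_def
    proof (rule sum_residues_dilate[OF _ u, of "\<lambda>n. A n * cos (pi * real n * real s / real N)"])
      fix a b assume "[a = b] (mod 2 * N)"
      then show "A a * cos (pi * real a * real s / real N) = A b * cos (pi * real b * real s / real N)"
        using Acong cos_grid_cong[OF N0] by metis
    qed (use N0 in simp)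
    finally show ?thesis .
  qed
  have Dcong: "D a = D b" if "[a = b] (mod 2 * N)" for a b
    unfolding D_def using cos_grid_cong[OF N0 that] by (intro sum.cong refl) (simp add: mult_ac)
  have D: "D s = real N * (v (Suc s) - v s)" if "0 < s" "s < N" for s
    unfolding D_def A_def using grid_coeff_inversion(1)[OF N0, of s] that by simp
  have D0: "D 0 = 2 * real N * v 1" "D N = - 2 * real N * v N"
    unfolding D_def A_def using grid_coeff_inversion(2,3)[OF N0, of 0] by simp_all
  \<comment> \<open>The factor \<open>r 2\<close> makes even points \<open>s = 2 * k\<close> obey a
    formula in \<open>r s\<close> instead of \<open>r k\<close>.\<close>
  define x' x where "x' = D 1 / real N" and "x = r 2 * D 2 / real N"
  have np2: "\<not> p dvd 2" using p by (auto dest: dvd_imp_le)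
  have \<delta>: "v (Suc s) - v s = r s * (if odd s then x' else x)" if s: "0 < s" "s < N" "\<not> p dvd s" for s
  proof (cases "odd s")
    case True
    then have "od s = s" by (simp add: od_def)
    then have "D s = r s * D 1" using Du[OF codd[OF s(3)], of 1] by (simp add: r_def)
    then show ?thesis using D[OF s(1,2)] True N0 by (simp add: x'_def field_simps)
  next
    case False
    then obtain k where k: "s = 2 * k" by blast
    then have npk: "\<not> p dvd k" using s(3) by auto
    have "[od k * 2 = s] (mod 2 * N)"
      by (auto simp: k od_def cong_def)
    then have "D s = D (od k * 2)" using Dcong by metis
    also have "\<dots> = r k * D 2" using Du[OF codd[OF npk], of 2] by (simp add: r_def)
    finally have "D s = r k * D 2" .
    moreover have "r s = r 2 * r k" unfolding k by (rule rmult[OF np2 npk])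
    moreover have "r 2 * r 2 = 1" using r[OF np2] by auto
    ultimately have "D s = r s * (r 2 * D 2)" by (metis mult.assoc mult.commute mult_1)
    then show ?thesis using D[OF s(1,2)] False N0 by (simp add: x_def field_simps)
  qed
  \<comment> \<open>Every unit fixes the transform's argument 0, and also \<open>N\<close> because
    units are odd; a unit of sign -1 thus makes the transform vanish at both.\<close>
  have ends: "v 1 = 0 \<and> v N = 0" if t: "\<not> p dvd t" "r t = -1" for t
  proof -
    have "D 0 = - D 0" using Du[OF codd[OF t(1)], of 0] t(2) by (simp add: r_def)
    moreover have "D N = - D N"
    proof -
      obtain k where "od t = Suc (2 * k)" using od(1)[of t] by (elim oddE) auto
      then have "od t * N = N + k * (2 * N)" by simp
      then have "[od t * N = N] (mod 2 * N)" by (simp only: cong_def mod_mult_self1)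
      then have "D N = D (od t * N)" using Dcong by metis
      then show ?thesis using Du[OF codd[OF t(1)], of N] t(2) by (simp add: r_def)
    qed
    ultimately show ?thesis using D0 N0 by simp
  qed
  have r1: "r t = 1" if "\<not> p dvd t" for t
    by (rule sign_pattern_trivial[OF p pN Nge oddN v \<delta> r rmult rmod rN ends ex that])
  show ?thesis
  proof (rule alternating_if_parity_pattern[OF p pN Nge v _ ex s])
    fix s assume "0 < s" "s < N" "\<not> p dvd s"
    then show "v (Suc s) - v s = (if odd s then x' else x)" using \<delta>[of s] r1[of s] by simp
  qed
qed

section \<open>The sine system\<close>

lemma space_unitI: "space unitI = {0<..<1}"
  by (simp add: unitI_def space_restrict_space)

lemma finite_measure_unitI: "finite_measure unitI"
  by (rule finite_measureI) (simp add: unitI_def emeasure_restrict_space space_restrict_space)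

lemma borel_measurable_unitI: "f \<in> borel_measurable borel \<Longrightarrow> f \<in> borel_measurable unitI"
  unfolding unitI_def by (intro measurable_restrict_space1) simp

lemma integral_unitI: "integral\<^sup>L unitI f = (\<integral>x. indicator {0<..<1} x * f x \<partial>lborel)" for f :: "real \<Rightarrow> real"
  unfolding unitI_def by (subst integral_restrict_space) auto

lemma integrable_unitI_bounded:
  fixes f :: "real \<Rightarrow> real"
  assumes "f \<in> borel_measurable unitI" "\<And>x. 0 < x \<Longrightarrow> x < 1 \<Longrightarrow> \<bar>f x\<bar> \<le> B"
  shows "integrable unitI f"
  by (rule finite_measure.integrable_const_bound[OF finite_measure_unitI, of _ B])
    (use assms in \<open>auto simp: space_unitI intro!: AE_I2\<close>)

lemma L2_bounded:
  fixes f :: "real \<Rightarrow> real"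
  assumes "f \<in> borel_measurable unitI" "\<And>x. 0 < x \<Longrightarrow> x < 1 \<Longrightarrow> \<bar>f x\<bar> \<le> B"
  shows "L2 f"
  unfolding L2_def
proof
  show "integrable unitI (\<lambda>x. (f x)\<^sup>2)"
  proof (rule integrable_unitI_bounded)
    fix x :: real assume "0 < x" "x < 1"
    then have "\<bar>f x\<bar> \<le> B" by (rule assms(2))
    then show "\<bar>(f x)\<^sup>2\<bar> \<le> B\<^sup>2" by (simp add: abs_le_square_iff[symmetric])
  qed (use assms(1) in measurable)
qed (rule assms(1))

lemma L2_mult_integrable:
  assumes "L2 f" "L2 g"
  shows "integrable unitI (\<lambda>x. f x * g x)"
proof (rule Bochner_Integration.integrable_bound)
  show "integrable unitI (\<lambda>x. (f x)\<^sup>2 + (g x)\<^sup>2)" using assms by (auto simp: L2_def)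
  show "(\<lambda>x. f x * g x) \<in> borel_measurable unitI" using assms by (auto simp: L2_def)
  have "\<bar>a * b\<bar> \<le> a\<^sup>2 + b\<^sup>2" for a b :: real
    using sum_squares_bound[of "\<bar>a\<bar>" "\<bar>b\<bar>"] mult_nonneg_nonneg[of "\<bar>a\<bar>" "\<bar>b\<bar>"]
    unfolding abs_mult power2_abs by linarith
  then show "AE x in unitI. norm (f x * g x) \<le> norm ((f x)\<^sup>2 + (g x)\<^sup>2)" by (auto intro!: AE_I2)
qed

lemma L2_add: "L2 f \<Longrightarrow> L2 g \<Longrightarrow> L2 (\<lambda>x. f x + g x)"
  using L2_mult_integrable[of f g] unfolding L2_def by (auto simp: power2_sum mult.assoc)

lemma L2_cmult: "L2 f \<Longrightarrow> L2 (\<lambda>x. c * f x)"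
  unfolding L2_def by (auto simp: power_mult_distrib)

lemma L2_diff: "L2 f \<Longrightarrow> L2 g \<Longrightarrow> L2 (\<lambda>x. f x - g x)"
  using L2_add[of f "\<lambda>x. (-1) * g x"] L2_cmult[of g "-1"] by simp

lemma L2_sum: "(\<And>i. i \<in> A \<Longrightarrow> L2 (f i)) \<Longrightarrow> L2 (\<lambda>x. \<Sum>i\<in>A. f i x)"
  by (induction A rule: infinite_finite_induct)
    (auto intro!: L2_add L2_bounded[of "\<lambda>x. 0" 0])

text \<open>The square of the norm; its triangle inequality has factors 2, whence the recurring
  \<open>e / 4\<close>.\<close>

definition norm2 :: "(real \<Rightarrow> real) \<Rightarrow> real" where
  "norm2 f = integral\<^sup>L unitI (\<lambda>x. (f x)\<^sup>2)"

lemma norm2_nonneg: "norm2 f \<ge> 0"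
  unfolding norm2_def by (rule integral_nonneg_AE) auto

lemma norm2_cmult: "norm2 (\<lambda>x. c * f x) = c\<^sup>2 * norm2 f"
  by (simp add: norm2_def power_mult_distrib)

lemma norm2_add_le:
  assumes "L2 f" "L2 g"
  shows "norm2 (\<lambda>x. f x + g x) \<le> 2 * norm2 f + 2 * norm2 g"
proof -
  have "norm2 (\<lambda>x. f x + g x) \<le> integral\<^sup>L unitI (\<lambda>x. 2 * (f x)\<^sup>2 + 2 * (g x)\<^sup>2)"
    unfolding norm2_def
  proof (rule integral_mono)
    show "integrable unitI (\<lambda>x. (f x + g x)\<^sup>2)" using L2_add[OF assms] by (simp add: L2_def)
    show "integrable unitI (\<lambda>x. 2 * (f x)\<^sup>2 + 2 * (g x)\<^sup>2)" using assms by (auto simp: L2_def)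
    show "(f x + g x)\<^sup>2 \<le> 2 * (f x)\<^sup>2 + 2 * (g x)\<^sup>2" for x
      using sum_squares_bound[of "f x" "g x"] by (simp add: power2_sum)
  qed
  also have "\<dots> = 2 * norm2 f + 2 * norm2 g"
    unfolding norm2_def using assms by (subst Bochner_Integration.integral_add) (auto simp: L2_def)
  finally show ?thesis .
qed

lemma norm2_triangle:
  assumes "L2 f" "L2 g" "L2 h" "norm2 (\<lambda>x. f x - g x) < e / 4" "norm2 (\<lambda>x. g x - h x) < e / 4"
  shows "norm2 (\<lambda>x. f x - h x) < e"
  using norm2_add_le[of "\<lambda>x. f x - g x" "\<lambda>x. g x - h x"] assms by (simp add: L2_diff)

lemma integral_unitI_FTC:
  fixes f F :: "real \<Rightarrow> real"
  assumes ab: "0 \<le> a" "a \<le> b" "b \<le> 1" and F: "\<And>x. (F has_real_derivative f x) (at x)"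
    and f: "\<And>x. isCont f x"
  shows "integral\<^sup>L unitI (\<lambda>x. indicator {a<..<b} x * f x) = F b - F a"
proof -
  have "integral\<^sup>L unitI (\<lambda>x. indicator {a<..<b} x * f x) = (\<integral>x. f x * indicator {a..b} x \<partial>lborel)"
    unfolding integral_unitI
  proof (rule integral_cong_AE)
    have fm: "f \<in> borel_measurable borel"
      using f by (intro borel_measurable_continuous_onI) (simp add: continuous_on_eq_continuous_at)
    show "(\<lambda>x. indicator {0<..<1} x * (indicator {a<..<b} x * f x)) \<in> borel_measurable lborel"
      "(\<lambda>x. f x * indicator {a..b} x) \<in> borel_measurable lborel"
      using fm by measurable
    have "AE x in lborel. x \<noteq> a" "AE x in lborel. x \<noteq> b"
      by (auto intro!: AE_lborel_singleton)
    then show "AE x in lborel. indicator {0<..<1} x * (indicator {a<..<b} x * f x) = f x * indicator {a..b} x"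
      by eventually_elim (use ab in \<open>auto simp: indicator_def\<close>)
  qed
  also have "\<dots> = F b - F a"
    by (rule integral_FTC_Icc_real) (use ab F f in auto)
  finally show ?thesis .
qed

lemma integral_unitI_FTC':
  fixes f F :: "real \<Rightarrow> real"
  assumes "\<And>x. (F has_real_derivative f x) (at x)" "\<And>x. isCont f x"
  shows "integral\<^sup>L unitI f = F 1 - F 0"
proof -
  have "integral\<^sup>L unitI f = integral\<^sup>L unitI (\<lambda>x. indicator {0<..<1} x * f x)"
    by (intro Bochner_Integration.integral_cong) (auto simp: space_unitI)
  also have "\<dots> = F 1 - F 0" by (rule integral_unitI_FTC) (use assms in auto)
  finally show ?thesis .
qed

definition sine :: "nat \<Rightarrow> real \<Rightarrow> real" where
  "sine n x = sin (pi * real n * x)"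

definition sine_coeff :: "(real \<Rightarrow> real) \<Rightarrow> nat \<Rightarrow> real" where
  "sine_coeff f n = integral\<^sup>L unitI (\<lambda>x. f x * sine n x)"

lemma L2_sine: "L2 (sine n)"
  unfolding sine_def[abs_def] by (rule L2_bounded[of _ 1]) (auto intro!: borel_measurable_unitI)

lemma integral_cos_multiple:
  fixes k :: int
  shows "integral\<^sup>L unitI (\<lambda>x. cos (pi * of_int k * x)) = (if k = 0 then 1 else 0)"
proof (cases "k = 0")
  case True
  have "integral\<^sup>L unitI (\<lambda>x. 1::real) = 1 - 0"
    by (rule integral_unitI_FTC') (auto intro!: derivative_eq_intros)
  then show ?thesis using True by simp
next
  case False
  have "integral\<^sup>L unitI (\<lambda>x. cos (pi * of_int k * x))
      = (\<lambda>x. sin (pi * of_int k * x) / (pi * of_int k)) 1 - (\<lambda>x. sin (pi * of_int k * x) / (pi * of_int k)) 0"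
    by (rule integral_unitI_FTC') (use False in \<open>auto intro!: derivative_eq_intros
        continuous_intros simp: field_simps\<close>)
  also have "\<dots> = 0" using sin_npi_int[of k] False by (simp add: mult.commute)
  finally show ?thesis using False by simp
qed

lemma sine_orthogonal:
  assumes "n > 0" "m > 0"
  shows "sine_coeff (sine n) m = (if n = m then 1 / 2 else 0)"
proof -
  have int: "integrable unitI (\<lambda>x. cos (pi * of_int k * x))" for k :: int
    by (rule integrable_unitI_bounded[of _ 1]) (auto intro!: borel_measurable_unitI)
  have "sine_coeff (sine n) m = integral\<^sup>L unitI (\<lambda>x. (cos (pi * of_int (int n - int m) * x)
      - cos (pi * of_int (int n + int m) * x)) / 2)"
    unfolding sine_coeff_def sine_def sin_times_sin by (simp add: algebra_simps)
  also have "\<dots> = ((if int n - int m = 0 then 1 else 0) - (if int n + int m = 0 then 1 else 0)) / 2"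
    unfolding integral_cos_multiple[symmetric]
    by (subst Bochner_Integration.integral_diff[symmetric, OF int int]) simp
  also have "\<dots> = (if n = m then 1 / 2 else 0)" using assms by simp
  finally show ?thesis .
qed

lemma sine_coeff_add: "L2 f \<Longrightarrow> L2 g \<Longrightarrow> sine_coeff (\<lambda>x. f x + g x) n = sine_coeff f n + sine_coeff g n"
  unfolding sine_coeff_def distrib_right
  by (rule Bochner_Integration.integral_add) (auto intro: L2_mult_integrable L2_sine)

lemma sine_coeff_cmult: "sine_coeff (\<lambda>x. c * f x) n = c * sine_coeff f n"
  by (simp add: sine_coeff_def mult.assoc)

lemma sine_coeff_diff: "L2 f \<Longrightarrow> L2 g \<Longrightarrow> sine_coeff (\<lambda>x. f x - g x) n = sine_coeff f n - sine_coeff g n"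
  unfolding sine_coeff_def left_diff_distrib
  by (rule Bochner_Integration.integral_diff) (auto intro: L2_mult_integrable L2_sine)

lemma sine_coeff_sum:
  assumes "\<And>i. i \<in> A \<Longrightarrow> L2 (f i)"
  shows "sine_coeff (\<lambda>x. \<Sum>i\<in>A. f i x) n = (\<Sum>i\<in>A. sine_coeff (f i) n)"
  unfolding sine_coeff_def sum_distrib_right
  by (rule Bochner_Integration.integral_sum) (auto intro: L2_mult_integrable L2_sine assms)

definition sine_poly :: "nat \<Rightarrow> (nat \<Rightarrow> real) \<Rightarrow> real \<Rightarrow> real" where
  "sine_poly K c x = (\<Sum>n=1..K. c n * sine n x)"

lemma L2_sine_poly: "L2 (sine_poly K c)"
  unfolding sine_poly_def by (intro L2_sum L2_cmult L2_sine)

lemma sine_coeff_sine_poly: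
  assumes "n > 0"
  shows "sine_coeff (sine_poly K c) n = (if n \<le> K then c n / 2 else 0)"
proof -
  have "sine_coeff (sine_poly K c) n = (\<Sum>i=1..K. c i * sine_coeff (sine i) n)"
    unfolding sine_poly_def by (subst sine_coeff_sum) (auto intro!: L2_cmult L2_sine simp: sine_coeff_cmult)
  also have "\<dots> = (\<Sum>i=1..K. if i = n then c n / 2 else 0)"
    using assms by (intro sum.cong) (auto simp: sine_orthogonal)
  finally show ?thesis using assms by simp
qed

text \<open>Completing the square; each sine has squared norm \<open>1 / 2\<close>, which produces
  the factors 2. Taking \<open>c n\<close> as twice the coefficient gives Bessel's inequality;
  solving for \<open>norm2 f\<close> gives the converse estimate once \<open>f\<close> is
  approximated.\<close>

lemma norm2_diff_sine_poly:
  assumes "L2 f"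
  shows "norm2 (\<lambda>x. f x - sine_poly K c x)
     = norm2 f - (\<Sum>n=1..K. 2 * (sine_coeff f n)\<^sup>2) + (\<Sum>n=1..K. 2 * (sine_coeff f n - c n / 2)\<^sup>2)"
proof -
  let ?P = "sine_poly K c"
  have P: "L2 ?P" by (rule L2_sine_poly)
  have int1: "integral\<^sup>L unitI (\<lambda>x. g x * ?P x) = (\<Sum>n=1..K. c n * sine_coeff g n)" if "L2 g" for g
  proof -
    have "integral\<^sup>L unitI (\<lambda>x. g x * ?P x) = integral\<^sup>L unitI (\<lambda>x. \<Sum>n=1..K. c n * (g x * sine n x))"
      by (simp add: sine_poly_def sum_distrib_left mult_ac)
    also have "\<dots> = (\<Sum>n=1..K. c n * sine_coeff g n)"
      unfolding sine_coeff_def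
      by (subst Bochner_Integration.integral_sum) (auto intro!: L2_mult_integrable that L2_sine)
    finally show ?thesis .
  qed
  have "norm2 (\<lambda>x. f x - ?P x) = integral\<^sup>L unitI (\<lambda>x. (f x)\<^sup>2 - 2 * (f x * ?P x) + ?P x * ?P x)"
    unfolding norm2_def by (simp add: power2_diff power2_eq_square algebra_simps)
  also have "\<dots> = norm2 f - 2 * integral\<^sup>L unitI (\<lambda>x. f x * ?P x) + integral\<^sup>L unitI (\<lambda>x. ?P x * ?P x)"
    using L2_mult_integrable[OF assms P] L2_mult_integrable[OF P P] assms
    by (simp add: norm2_def L2_def)
  also have "\<dots> = norm2 f - 2 * (\<Sum>n=1..K. c n * sine_coeff f n) + (\<Sum>n=1..K. c n * (c n / 2))"
    unfolding int1[OF assms] int1[OF P] by (simp add: sine_coeff_sine_poly)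
  also have "\<dots> = norm2 f - (\<Sum>n=1..K. 2 * (sine_coeff f n)\<^sup>2) + (\<Sum>n=1..K. 2 * (sine_coeff f n - c n / 2)\<^sup>2)"
    unfolding sum_distrib_left add_diff_eq[symmetric] diff_add_eq diff_diff_eq2[symmetric]
    by (simp add: sum_distrib_left sum_subtractf[symmetric] sum.distrib[symmetric]
        power2_eq_square algebra_simps)
  finally show ?thesis .
qed

lemma bessel:
  assumes "L2 f"
  shows "(\<Sum>n=1..K. 2 * (sine_coeff f n)\<^sup>2) \<le> norm2 f"
  using norm2_diff_sine_poly[OF assms, of K "\<lambda>n. 2 * sine_coeff f n"]
    norm2_nonneg[of "\<lambda>x. f x - sine_poly K (\<lambda>n. 2 * sine_coeff f n) x"] by simp

lemma sine_coeff_square_le: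
  assumes "L2 f" "n > 0"
  shows "2 * (sine_coeff f n)\<^sup>2 \<le> norm2 f"
proof -
  have "2 * (sine_coeff f n)\<^sup>2 \<le> (\<Sum>n=1..n. 2 * (sine_coeff f n)\<^sup>2)"
    using assms(2) by (intro member_le_sum) auto
  also have "\<dots> \<le> norm2 f" by (rule bessel[OF assms(1)])
  finally show ?thesis .
qed

section \<open>Dilations\<close>

lemma odd_ext_eq: "0 < x \<Longrightarrow> x < 1 \<Longrightarrow> odd_ext \<phi> x = \<phi> x"
proof -
  assume x: "0 < x" "x < 1"
  then have "\<lfloor>x / 2\<rfloor> = 0" by (simp add: floor_eq_iff)
  with x show ?thesis by (simp add: odd_ext_def Let_def)
qed

lemma odd_ext_periodic: "odd_ext \<phi> (x + 2) = odd_ext \<phi> x"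
proof -
  have "\<lfloor>(x + 2) / 2\<rfloor> = \<lfloor>x / 2\<rfloor> + 1" by (simp add: add_divide_distrib)
  then have "x + 2 - 2 * of_int \<lfloor>(x + 2) / 2\<rfloor> = x - 2 * of_int \<lfloor>x / 2\<rfloor>" by simp
  then show ?thesis unfolding odd_ext_def by (simp only:)
qed

text \<open>The value 0 at integers makes oddness hold at every real point, so no exceptional null
  set has to be carried along when arguments are multiplied by \<open>k\<close>.\<close>

lemma odd_ext_odd: "odd_ext \<phi> (- x) = - odd_ext \<phi> x"
proof -
  define y where "y = x - 2 * of_int \<lfloor>x / 2\<rfloor>"
  define y' where "y' = - x - 2 * of_int \<lfloor>- x / 2\<rfloor>"
  have y: "0 \<le> y" "y < 2" unfolding y_def by linarith+
  have e: "odd_ext \<phi> x = (if 0 < y \<and> y < 1 then \<phi> y else if 1 < y \<and> y < 2 then - \<phi> (2 - y) else 0)"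
    "odd_ext \<phi> (- x) = (if 0 < y' \<and> y' < 1 then \<phi> y' else if 1 < y' \<and> y' < 2 then - \<phi> (2 - y') else 0)"
    unfolding odd_ext_def y_def y'_def Let_def by simp_all
  show ?thesis
  proof (cases "y = 0")
    case True
    then have "x / 2 = of_int \<lfloor>x / 2\<rfloor>" by (simp add: y_def)
    then have "- x / 2 = of_int (- \<lfloor>x / 2\<rfloor>)" by simp
    then have "\<lfloor>- x / 2\<rfloor> = - \<lfloor>x / 2\<rfloor>" by (metis floor_of_int)
    then have "y' = 0" using True by (simp add: y_def y'_def)
    with True show ?thesis unfolding e by simp
  next
    case False
    have "\<lfloor>- x / 2\<rfloor> = - \<lfloor>x / 2\<rfloor> - 1"
      using y False by (intro floor_unique) (auto simp: y_def)
    then have y': "y' = 2 - y" by (simp add: y_def y'_def)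
    show ?thesis unfolding e y' using y False by auto
  qed
qed

lemma odd_ext_measurable:
  assumes "\<phi> \<in> borel_measurable unitI"
  shows "odd_ext \<phi> \<in> borel_measurable borel"
proof -
  define \<psi> where "\<psi> x = indicator {0<..<1} x * \<phi> x" for x :: real
  have [measurable]: "\<psi> \<in> borel_measurable borel"
    using assms unfolding unitI_def \<psi>_def[abs_def] by (subst (asm) borel_measurable_restrict_space_iff) auto
  have "odd_ext \<phi> = (\<lambda>x. \<psi> (x - 2 * of_int \<lfloor>x / 2\<rfloor>) - \<psi> (2 - (x - 2 * of_int \<lfloor>x / 2\<rfloor>)))"
    by (rule ext) (auto simp: odd_ext_def \<psi>_def Let_def indicator_def)
  then show ?thesis by simp
qed

definition odd_periodic :: "(real \<Rightarrow> real) \<Rightarrow> bool" where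
  "odd_periodic \<Phi> \<longleftrightarrow> \<Phi> \<in> borel_measurable borel \<and> (\<forall>x. \<Phi> (- x) = - \<Phi> x) \<and> (\<forall>x. \<Phi> (x + 2) = \<Phi> x)"

lemma odd_periodic_odd_ext: "\<phi> \<in> borel_measurable unitI \<Longrightarrow> odd_periodic (odd_ext \<phi>)"
  by (simp add: odd_periodic_def odd_ext_measurable odd_ext_odd odd_ext_periodic)

lemma odd_periodic_add: "odd_periodic f \<Longrightarrow> odd_periodic g \<Longrightarrow> odd_periodic (\<lambda>x. f x + g x)"
  by (auto simp: odd_periodic_def)

lemma odd_periodic_cmult: "odd_periodic f \<Longrightarrow> odd_periodic (\<lambda>x. c * f x)"
  by (auto simp: odd_periodic_def)

lemma odd_periodic_diff: "odd_periodic f \<Longrightarrow> odd_periodic g \<Longrightarrow> odd_periodic (\<lambda>x. f x - g x)"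
  by (auto simp: odd_periodic_def)

lemma odd_periodic_sum: "(\<And>i. i \<in> A \<Longrightarrow> odd_periodic (f i)) \<Longrightarrow> odd_periodic (\<lambda>x. \<Sum>i\<in>A. f i x)"
  by (auto simp: odd_periodic_def sum_negf intro!: borel_measurable_sum)

lemma periodic_multiple:
  fixes \<Phi> :: "real \<Rightarrow> 'a"
  assumes "\<And>x. \<Phi> (x + 2) = \<Phi> x"
  shows "\<Phi> (x + 2 * real k) = \<Phi> x"
proof (induction k)
  case (Suc k)
  have "x + 2 * real (Suc k) = (x + 2 * real k) + 2" by simp
  then show ?case using assms[of "x + 2 * real k"] Suc by (simp only:)
qed simp

lemma odd_periodic_dilate: "odd_periodic \<Phi> \<Longrightarrow> odd_periodic (\<lambda>x. \<Phi> (real k * x))"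
  using periodic_multiple[of \<Phi> _ k] by (auto simp: odd_periodic_def distrib_left mult.commute)

lemma odd_periodic_sine: "odd_periodic (sine n)"
proof -
  have "sine n (x + 2) = sine n x" for x
  proof -
    have "pi * real n * (x + 2) = pi * real n * x + 2 * pi * of_int (int n)" by (simp add: algebra_simps)
    then show ?thesis unfolding sine_def
      by (simp only: sin_add cos_int_2pin sin_int_2pin mult_1_right mult_zero_right add_0_right)
  qed
  moreover have "sine n \<in> borel_measurable borel" unfolding sine_def[abs_def] by simp
  ultimately show ?thesis by (simp add: odd_periodic_def sine_def)
qed

text \<open>An even function of period 2 has the same integral between any two consecutive integers:
  translate if the left end is even, reflect if it is odd. Stretching by \<open>k\<close> spreads
  the unit interval over \<open>k\<close> such pieces. For nonnegative integrals one identity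
  transports both integrability and the norm.\<close>

lemma nn_integral_unitI_dilate:
  fixes G :: "real \<Rightarrow> ennreal"
  assumes G[measurable]: "G \<in> borel_measurable borel" and ev: "\<And>x. G (- x) = G x"
      and per: "\<And>x. G (x + 2) = G x"
    and k: "k > 0"
  shows "(\<integral>\<^sup>+x. G (real k * x) \<partial>unitI) = (\<integral>\<^sup>+x. G x \<partial>unitI)"
proof -
  define I where "I a b = (\<integral>\<^sup>+x. G x * indicator {real a<..<real b} x \<partial>lborel)" for a b
  have cell: "I j (Suc j) = I 0 1" for j
  proof (cases "even j")
    case True
    then obtain i where i: "j = 2 * i" by blast
    have "I j (Suc j) = (\<integral>\<^sup>+x. G (real j + 1 * x) * indicator {real j<..<real (Suc j)} (real j
        + 1 * x) \<partial>lborel)"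
      unfolding I_def by (subst nn_integral_real_affine[where c = 1 and t = "real j"]) auto
    also have "\<dots> = I 0 1"
      unfolding I_def using periodic_multiple[of G _ i, OF per]
      by (intro nn_integral_cong arg_cong2[where f = "(*)"]) (auto simp: i indicator_def add.commute)
    finally show ?thesis .
  next
    case False
    then obtain i where i: "j = 2 * i + 1" by (elim oddE)
    have "I j (Suc j) = (\<integral>\<^sup>+x. G (real (Suc j)
        + (-1) * x) * indicator {real j<..<real (Suc j)} (real (Suc j) + (-1) * x) \<partial>lborel)"
      unfolding I_def by (subst nn_integral_real_affine[where c = "-1" and t = "real (Suc j)"]) auto
    also have "\<dots> = I 0 1"
    proof -
      have "G (real (Suc j) + (-1) * x) = G x" for x
        using periodic_multiple[of G "- x" "Suc i", OF per] ev[of x] by (simp add: i algebra_simps)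
      then show ?thesis unfolding I_def
        by (intro nn_integral_cong arg_cong2[where f = "(*)"]) (auto simp: indicator_def)
    qed
    finally show ?thesis .
  qed
  have "I 0 k = (\<integral>\<^sup>+x. (\<Sum>j<k. G x * indicator {real j<..<real (Suc j)} x) \<partial>lborel)"
    unfolding I_def
  proof (rule nn_integral_cong_AE)
    have "AE x in lborel. x \<notin> (\<int> :: real set)"
      by (intro AE_not_in countable_imp_null_set_lborel countable_int)
    then show "AE x in lborel. G x * indicator {real 0<..<real k} x
        = (\<Sum>j<k. G x * indicator {real j<..<real (Suc j)} x)"
    proof eventually_elim
      case (elim x)
      have "(\<Sum>j<k. indicator {real j<..<real (Suc j)} x) = (indicator {real 0<..<real k} x :: ennreal)"
      proof (cases "0 < x \<and> x < real k")
        case True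
        have "x \<in> {real j<..<real (Suc j)} \<longleftrightarrow> j = nat \<lfloor>x\<rfloor>" for j
        proof -
          have "x \<in> {real j<..<real (Suc j)} \<longleftrightarrow> \<lfloor>x\<rfloor> = int j"
          proof -
            have "x \<noteq> real j" using elim by (metis Ints_of_nat)
            then show ?thesis unfolding floor_eq_iff by auto
          qed
          then show ?thesis using True by (auto simp: nat_eq_iff)
        qed
        then have "(\<Sum>j<k. indicator {real j<..<real (Suc j)} x) = (\<Sum>j<k.
            if j = nat \<lfloor>x\<rfloor> then 1 else (0::ennreal))"
          by (intro sum.cong refl) (simp add: indicator_def)
        also have "\<dots> = 1"
        proof -
          have "nat \<lfloor>x\<rfloor> < k" using True by (simp add: floor_less_iff nat_less_iff)
          then show ?thesis by simp
        qed
        finally show ?thesis using True by simp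
      next
        case False
        have "x \<notin> {real j<..<real (Suc j)}" if "j < k" for j
        proof
          assume x: "x \<in> {real j<..<real (Suc j)}"
          have "real (Suc j) \<le> real k" using that by (intro of_nat_mono) simp
          then have "0 < x \<and> x < real k" using x by auto
          with False show False by simp
        qed
        then have "(\<Sum>j<k. indicator {real j<..<real (Suc j)} x) = (0::ennreal)"
          by (intro sum.neutral) (auto simp: indicator_def)
        then show ?thesis using False by (auto simp: indicator_def)
      qed
      then show ?case by (simp add: sum_distrib_left[symmetric])
    qed
  qed
  also have "\<dots> = (\<Sum>j<k. I j (Suc j))"
    unfolding I_def by (rule nn_integral_sum) measurable
  also have "\<dots> = of_nat k * I 0 1" by (simp only: cell) simp
  finally have "I 0 k = of_nat k * I 0 1" .
  moreover have "I 0 k = of_nat k * (\<integral>\<^sup>+x. G (real k * x) * indicator {0<..<1} x \<partial>lborel)"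
  proof -
    have "I 0 k = ennreal \<bar>real k\<bar> * (\<integral>\<^sup>+x. G (0 + real k * x) * indicator {real 0<..<real k} (0
        + real k * x) \<partial>lborel)"
      unfolding I_def by (rule nn_integral_real_affine) (use k in auto)
    also have "(\<lambda>x. G (0 + real k * x) * indicator {real 0<..<real k} (0 + real k * x))
        = (\<lambda>x. G (real k * x) * indicator {0<..<1} x)"
      using k by (auto simp: fun_eq_iff indicator_def zero_less_mult_iff)
    finally show ?thesis by (simp add: ennreal_of_nat_eq_real_of_nat)
  qed
  ultimately have "(\<integral>\<^sup>+x. G (real k * x) * indicator {0<..<1} x \<partial>lborel) = I 0 1"
    using k by (simp add: ennreal_mult_cancel_left ennreal_of_nat_neq_top)
  then show ?thesis
    unfolding unitI_def I_def by (simp add: nn_integral_restrict_space)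
qed

lemma norm2_dilate:
  assumes \<Phi>: "odd_periodic \<Phi>" and k: "k > 0"
  shows "norm2 (\<lambda>x. \<Phi> (real k * x)) = norm2 \<Phi>"
    and "L2 \<Phi> \<Longrightarrow> L2 (\<lambda>x. \<Phi> (real k * x))"
proof -
  have [measurable]: "\<Phi> \<in> borel_measurable borel" using \<Phi> by (simp add: odd_periodic_def)
  have m: "\<Phi> \<in> borel_measurable unitI" "(\<lambda>x. \<Phi> (real k * x)) \<in> borel_measurable unitI"
    by (auto intro!: borel_measurable_unitI)
  have eq: "(\<integral>\<^sup>+x. ennreal ((\<Phi> (real k * x))\<^sup>2) \<partial>unitI) = (\<integral>\<^sup>+x. ennreal ((\<Phi> x)\<^sup>2) \<partial>unitI)"
    by (rule nn_integral_unitI_dilate[of "\<lambda>x. ennreal ((\<Phi> x)\<^sup>2)"]) (use \<Phi> k in \<open>auto simp: odd_periodic_def\<close>)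
  show "norm2 (\<lambda>x. \<Phi> (real k * x)) = norm2 \<Phi>"
    unfolding norm2_def using m eq by (simp add: integral_eq_nn_integral)
  show "L2 (\<lambda>x. \<Phi> (real k * x))" if "L2 \<Phi>"
    using that m eq unfolding L2_def by (simp add: integrable_iff_bounded)
qed

section \<open>Density of sine polynomials\<close>

definition is_sine_poly :: "(real \<Rightarrow> real) \<Rightarrow> bool" where
  "is_sine_poly f \<longleftrightarrow> (\<exists>K c. \<forall>x. f x = sine_poly K c x)"

lemma sine_poly_extend:
  assumes "K \<le> L"
  shows "sine_poly K c x = sine_poly L (\<lambda>n. if n \<le> K then c n else 0) x"
  unfolding sine_poly_def using assms by (intro sum.mono_neutral_cong_left) auto

lemma is_sine_poly_add:
  assumes "is_sine_poly f" "is_sine_poly g"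
  shows "is_sine_poly (\<lambda>x. f x + g x)"
proof -
  obtain K c L d where f: "\<And>x. f x = sine_poly K c x" and g: "\<And>x. g x = sine_poly L d x"
    using assms unfolding is_sine_poly_def by metis
  let ?c = "\<lambda>n. (if n \<le> K then c n else 0) + (if n \<le> L then d n else 0)"
  have "f x + g x = sine_poly (max K L) ?c x" for x
    unfolding f g sine_poly_extend[OF max.cobounded1[of K L]] sine_poly_extend[OF max.cobounded2[of L K]]
    by (simp only: sine_poly_def sum.distrib distrib_right)
  then show ?thesis unfolding is_sine_poly_def by blast
qed

lemma is_sine_poly_cmult:
  assumes "is_sine_poly f"
  shows "is_sine_poly (\<lambda>x. a * f x)"
proof -
  obtain K c where f: "\<And>x. f x = sine_poly K c x"
    using assms unfolding is_sine_poly_def by metis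
  have "a * f x = sine_poly K (\<lambda>n. a * c n) x" for x
    unfolding f by (simp add: sine_poly_def sum_distrib_left mult.assoc)
  then show ?thesis unfolding is_sine_poly_def by blast
qed

lemma is_sine_poly_sine: "is_sine_poly (sine n)"
proof -
  have "sine n x = sine_poly n (\<lambda>k. if k = n then 1 else 0) x" for x
    by (cases "n = 0") (auto simp: sine_poly_def sine_def if_distrib[of "\<lambda>a. a * _"] cong: if_cong)
  then show ?thesis unfolding is_sine_poly_def by blast
qed

lemma is_sine_poly_sum:
  assumes "\<And>i. i \<in> A \<Longrightarrow> is_sine_poly (f i)"
  shows "is_sine_poly (\<lambda>x. \<Sum>i\<in>A. f i x)"
  using assms
proof (induction A rule: infinite_finite_induct)
  case (insert a A)
  then show ?case by (auto intro!: is_sine_poly_add)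
qed (use is_sine_poly_sine[of 0] in \<open>simp_all add: sine_def[abs_def]\<close>)

lemma is_sine_poly_cos_power: "is_sine_poly (\<lambda>x. cos (pi * x) ^ i * sin (pi * x))"
proof (induction i)
  case 0
  show ?case using is_sine_poly_sine[of 1] by (simp add: sine_def[abs_def])
next
  case (Suc i)
  have cs: "is_sine_poly (\<lambda>x. cos (pi * x) * sine n x)" for n
  proof -
    have 1: "is_sine_poly (\<lambda>x. (1 / 2) * (sine (n + 1) x + sine (n - 1) x))"
      by (intro is_sine_poly_cmult is_sine_poly_add is_sine_poly_sine)
    have 2: "cos (pi * x) * sine n x = (1 / 2) * (sine (n + 1) x + sine (n - 1) x)"
      if n0: "n > 0" for x
    proof -
      obtain m where m: "n = Suc m" using n0 by (cases n) auto
      have "pi * real n * x + pi * x = pi * real (n + 1) * x" "pi * real n * x - pi * x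
          = pi * real (n - 1) * x"
        by (simp_all add: m algebra_simps)
      then show ?thesis
        using sin_times_cos[of "pi * real n * x" "pi * x"] by (simp add: sine_def mult.commute)
    qed
    show ?thesis
    proof (cases "n = 0")
      case True
      then show ?thesis using is_sine_poly_sine[of 0] by (simp add: sine_def[abs_def])
    next
      case False
      then show ?thesis using 1 by (simp only: 2)
    qed
  qed
  obtain K c where f: "\<And>x. cos (pi * x) ^ i * sin (pi * x) = sine_poly K c x"
    using Suc unfolding is_sine_poly_def by metis
  have "is_sine_poly (\<lambda>x. \<Sum>n=1..K. c n * (cos (pi * x) * sine n x))"
    by (intro is_sine_poly_sum is_sine_poly_cmult cs)
  moreover have "(\<Sum>n=1..K. c n * (cos (pi * x) * sine n x)) = cos (pi * x) ^ Suc i * sin (pi * x)" for x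
    using f[of x] by (simp add: sine_poly_def sum_distrib_left mult_ac)
  ultimately show ?case by simp
qed

text \<open>Since \<open>cos (pi * x)\<close> is injective on the closed unit interval, polynomials
  in it are uniformly dense by Stone-Weierstrass. Multiplication by \<open>sin (pi * x)\<close>
  turns such a polynomial into a sine polynomial and does not enlarge the error.\<close>

lemma sine_poly_approx_continuous:
  assumes q: "continuous_on {0..1} q" and e: "e > 0"
  obtains g where "is_sine_poly g" "\<And>x. 0 \<le> x \<Longrightarrow> x \<le> 1 \<Longrightarrow> \<bar>q x * sin (pi * x) - g x\<bar> < e"
proof -
  let ?P = "\<lambda>f. \<exists>r. real_polynomial_function r \<and> f = (\<lambda>x. r (cos (pi * x)))"
  have "\<exists>g. ?P g \<and> (\<forall>x\<in>{0..1}. \<bar>q x - g x\<bar> < e)"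
  proof (rule Stone_Weierstrass_HOL[of "{0..1}" ?P])
    show "?P (\<lambda>x. c)" for c by (intro exI[of _ "\<lambda>x. c"]) auto
    show "continuous_on {0..1} f" if "?P f" for f
    proof -
      obtain r where r: "real_polynomial_function r" "f = (\<lambda>x. r (cos (pi * x)))" using \<open>?P f\<close> by blast
      have "continuous_on UNIV r"
        using r(1) by (simp add: continuous_on_eq_continuous_at continuous_real_polymonial_function)
      then show ?thesis unfolding r(2)
        by (rule continuous_on_compose2) (auto intro!: continuous_intros)
    qed
    show "?P (\<lambda>x. f x + g x)" if "?P f \<and> ?P g" for f g
    proof -
      obtain r t where rt: "real_polynomial_function r" "f = (\<lambda>x. r (cos (pi * x)))"
        "real_polynomial_function t" "g = (\<lambda>x. t (cos (pi * x)))" using \<open>?P f \<and> ?P g\<close> by blast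
      show ?thesis
        unfolding rt(2,4)
        by (rule exI[of _ "\<lambda>x. r x + t x"], rule conjI[OF real_polynomial_function.intros(3)[OF
            rt(1,3)] refl])
    qed
    show "?P (\<lambda>x. f x * g x)" if "?P f \<and> ?P g" for f g
    proof -
      obtain r t where rt: "real_polynomial_function r" "f = (\<lambda>x. r (cos (pi * x)))"
        "real_polynomial_function t" "g = (\<lambda>x. t (cos (pi * x)))" using \<open>?P f \<and> ?P g\<close> by blast
      show ?thesis
        unfolding rt(2,4)
        by (rule exI[of _ "\<lambda>x. r x * t x"], rule conjI[OF real_polynomial_function.intros(4)[OF
            rt(1,3)] refl])
    qed
    show "\<exists>f. ?P f \<and> f x \<noteq> f y" if "x \<in> {0..1} \<and> y \<in> {0..1} \<and> x \<noteq> y" for x y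
    proof -
      have ne: "cos (pi * x) \<noteq> cos (pi * y)"
      proof
        assume eq: "cos (pi * x) = cos (pi * y)"
        have "pi * x = pi * y" by (rule cos_inj_pi) (use that eq in auto)
        with that show False by simp
      qed
      have cosP: "?P (\<lambda>x. cos (pi * x))"
        by (rule exI[of _ "\<lambda>x. x"], rule conjI[OF real_polynomial_function.intros(1)[OF
            bounded_linear_ident] refl])
      show ?thesis by (rule exI[of _ "\<lambda>x. cos (pi * x)"], rule conjI[OF cosP ne])
    qed
  qed (use q e in auto)
  then obtain r where r: "real_polynomial_function r" "\<And>x. x \<in> {0..1} \<Longrightarrow> \<bar>q x - r (cos (pi * x))\<bar> < e"
    by blast
  obtain a n where an: "r = (\<lambda>x. \<Sum>i\<le>n. a i * x ^ i)"
    using r(1) real_polynomial_function_iff_sum by blast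
  have "is_sine_poly (\<lambda>x. \<Sum>i\<le>n. a i * (cos (pi * x) ^ i * sin (pi * x)))"
    by (intro is_sine_poly_sum is_sine_poly_cmult is_sine_poly_cos_power)
  then have sp: "is_sine_poly (\<lambda>x. r (cos (pi * x)) * sin (pi * x))"
    by (simp add: an sum_distrib_right mult.assoc)
  show ?thesis
  proof (rule that[OF sp])
    fix x :: real assume x: "0 \<le> x" "x \<le> 1"
    have "\<bar>q x * sin (pi * x) - r (cos (pi * x)) * sin (pi * x)\<bar> = \<bar>q x - r (cos (pi * x))\<bar> * \<bar>sin (pi * x)\<bar>"
      by (simp add: left_diff_distrib[symmetric] abs_mult)
    also have "\<dots> \<le> \<bar>q x - r (cos (pi * x))\<bar> * 1"
      by (intro mult_left_mono) auto
    also have "\<dots> < e" using r(2)[of x] x by simp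
    finally show "\<bar>q x * sin (pi * x) - r (cos (pi * x)) * sin (pi * x)\<bar> < e" .
  qed
qed

lemma AE_unitI_tendsto_continuous:
  fixes f :: "real \<Rightarrow> real"
  assumes "f \<in> borel_measurable unitI"
  obtains g where "\<And>n. continuous_on UNIV (g n)" "AE x in unitI. (\<lambda>n. g n x) \<longlonglongrightarrow> f x"
proof -
  define F where "F x = indicator {0<..<1} x * f x" for x :: real
  have "F \<in> borel_measurable borel"
    using assms unfolding unitI_def F_def[abs_def] by (subst (asm) borel_measurable_restrict_space_iff) auto
  then have "F measurable_on UNIV"
    by (intro lebesgue_measurable_imp_measurable_on) (auto intro: measurable_completion)
  then obtain N g where N: "negligible N" "\<And>n. continuous_on UNIV (g n)"
    "\<And>x. x \<notin> N \<Longrightarrow> (\<lambda>n. g n x) \<longlonglongrightarrow> F x"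
    unfolding measurable_on_def by auto
  have "AE x in lebesgue. x \<notin> N" using N(1) by (intro AE_not_in) (simp add: negligible_iff_null_sets)
  then have "AE x in lborel. x \<notin> N" by (simp add: AE_completion_iff)
  then have "AE x in unitI. (\<lambda>n. g n x) \<longlonglongrightarrow> f x"
    unfolding unitI_def by (subst AE_restrict_space_iff) (auto elim!: eventually_mono dest!: N(3) simp: F_def)
  with N(2) show ?thesis by (rule that)
qed

lemma norm2_tendsto_zero:
  assumes m: "\<And>n. h n \<in> borel_measurable unitI" "f \<in> borel_measurable unitI"
    and lim: "AE x in unitI. (\<lambda>n. h n x) \<longlonglongrightarrow> f x"
    and w: "integrable unitI w" "\<And>n x. (f x - h n x)\<^sup>2 \<le> w x"
  shows "(\<lambda>n. norm2 (\<lambda>x. f x - h n x)) \<longlonglongrightarrow> 0"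
proof -
  have "(\<lambda>n. integral\<^sup>L unitI (\<lambda>x. (f x - h n x)\<^sup>2)) \<longlonglongrightarrow> integral\<^sup>L unitI (\<lambda>x. 0)"
  proof (rule integral_dominated_convergence[where w = w])
    show "AE x in unitI. (\<lambda>n. (f x - h n x)\<^sup>2) \<longlonglongrightarrow> 0"
      using lim
    proof eventually_elim
      case (elim x)
      have "(\<lambda>n. (f x - h n x)\<^sup>2) \<longlonglongrightarrow> (f x - f x)\<^sup>2" by (intro tendsto_intros elim)
      then show ?case by simp
    qed
  qed (use m w in auto)
  then show ?thesis by (simp add: norm2_def)
qed

text \<open>Uniform approximation is available for functions \<open>q x * sin (pi * x)\<close> with
  \<open>q\<close> continuous, which vanish at 0 and 1. So \<open>f\<close> is truncated, replaced
  by a continuous approximant and damped near both ends; dominated convergence controls these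
  replacements in the mean.\<close>

lemma is_sine_poly_dense:
  assumes f: "L2 f" and e: "e > 0"
  obtains g where "is_sine_poly g" "L2 g" "norm2 (\<lambda>x. f x - g x) < e"
proof -
  have fm: "f \<in> borel_measurable unitI" and fi: "integrable unitI (\<lambda>x. (f x)\<^sup>2)" using f
      by (auto simp: L2_def)
  define tr where "tr B y = max (- B) (min B y)" for B y :: real
  have tr_bd: "\<bar>tr B y\<bar> \<le> B" if "B \<ge> 0" for B y using that by (auto simp: tr_def)
  have "(\<lambda>n. norm2 (\<lambda>x. f x - tr (real n) (f x))) \<longlonglongrightarrow> 0"
  proof (rule norm2_tendsto_zero[where w = "\<lambda>x. (f x)\<^sup>2"])
    show "(f x - tr (real n) (f x))\<^sup>2 \<le> (f x)\<^sup>2" for n x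
      by (simp add: abs_le_square_iff[symmetric] tr_def) 
    show "AE x in unitI. (\<lambda>n. tr (real n) (f x)) \<longlonglongrightarrow> f x"
    proof (rule AE_I2)
      fix x
      obtain n0 :: nat where "\<bar>f x\<bar> \<le> real n0" using real_arch_simple by blast
      then have "\<forall>\<^sub>F n in sequentially. tr (real n) (f x) = f x"
        by (intro eventually_sequentiallyI[of n0]) (auto simp: tr_def)
      then show "(\<lambda>n. tr (real n) (f x)) \<longlonglongrightarrow> f x" by (rule tendsto_eventually)
    qed
  qed (use fm fi in \<open>auto simp: tr_def\<close>)
  then have "\<forall>\<^sub>F n in sequentially. norm2 (\<lambda>x. f x - tr (real n) (f x)) < e / 4"
    by (rule order_tendstoD(2)) (use e in simp)
  then obtain N :: nat where N: "norm2 (\<lambda>x. f x - tr (real N) (f x)) < e / 4"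
    using eventually_happens'[OF sequentially_bot] by blast
  define B where "B = real N"
  define F where "F x = tr B (f x)" for x
  have Fm: "F \<in> borel_measurable unitI" unfolding F_def tr_def using fm by measurable
  have FL2: "L2 F" by (rule L2_bounded[OF Fm]) (auto simp: F_def B_def intro!: tr_bd)
  obtain g where g: "\<And>n. continuous_on UNIV (g n)" "AE x in unitI. (\<lambda>n. g n x) \<longlonglongrightarrow> F x"
    using AE_unitI_tendsto_continuous[OF Fm] by blast
  \<comment> \<open>On the open interval \<open>q n x * sin (pi * x)\<close> is the truncated
    \<open>g n x\<close> times the minimum of 1 and \<open>n * sin (pi * x)\<close>: division by
    zero is avoided at the ends, and at each fixed \<open>x\<close> the damping disappears for large
    \<open>n\<close>.\<close>
  define q where "q n x = tr B (g n x) * (real n / max 1 (real n * sin (pi * x)))" for n x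
  have qc: "continuous_on S (q n)" for n S
    unfolding q_def tr_def
    by (intro continuous_intros continuous_on_subset[OF g(1)]) auto
  define h where "h n x = q n x * sin (pi * x)" for n x
  have hm: "h n \<in> borel_measurable unitI" for n
    unfolding h_def by (intro borel_measurable_unitI borel_measurable_continuous_onI continuous_intros qc)
  have h_bd: "\<bar>h n x\<bar> \<le> B" if "0 < x" "x < 1" for n x
  proof -
    have s: "sin (pi * x) > 0" using that by (intro sin_gt_zero) auto
    have "\<bar>real n / max 1 (real n * sin (pi * x)) * sin (pi * x)\<bar> \<le> 1"
      using s by (auto simp: abs_mult divide_le_eq_1 max_def)
    then have "\<bar>tr B (g n x)\<bar> * \<bar>real n / max 1 (real n * sin (pi * x)) * sin (pi * x)\<bar> \<le> B * 1"
      by (intro mult_mono tr_bd) (auto simp: B_def)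
    then show ?thesis by (simp add: h_def q_def abs_mult)
  qed
  have "(\<lambda>n. norm2 (\<lambda>x. F x - indicator {0<..<1} x * h n x)) \<longlonglongrightarrow> 0"
  proof (rule norm2_tendsto_zero[where w = "\<lambda>x. (2 * B)\<^sup>2"])
    show "(\<lambda>x. indicator {0<..<1} x * h n x) \<in> borel_measurable unitI" for n
      by (rule borel_measurable_times[OF borel_measurable_unitI hm]) auto
    show "(F x - indicator {0<..<1} x * h n x)\<^sup>2 \<le> (2 * B)\<^sup>2" for n x
    proof -
      have "\<bar>indicator {0<..<1} x * h n x\<bar> \<le> B" using h_bd[of x n] by (auto simp: indicator_def B_def)
      moreover have "\<bar>F x\<bar> \<le> B" unfolding F_def by (rule tr_bd) (simp add: B_def)
      ultimately have "\<bar>F x - indicator {0<..<1} x * h n x\<bar> \<le> \<bar>2 * B\<bar>" by linarith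
      then show ?thesis by (simp only: abs_le_square_iff)
    qed
    show "integrable unitI (\<lambda>x. (2 * B)\<^sup>2)" by (rule integrable_unitI_bounded[of _ "(2 * B)\<^sup>2"]) auto
    show "AE x in unitI. (\<lambda>n. indicator {0<..<1} x * h n x) \<longlonglongrightarrow> F x"
      using g(2) AE_space
    proof eventually_elim
      case (elim x)
      then have x: "0 < x" "x < 1" by (auto simp: space_unitI)
      have s: "sin (pi * x) > 0" using x by (intro sin_gt_zero) auto
      have "(\<lambda>n. tr B (g n x)) \<longlonglongrightarrow> tr B (F x)"
        unfolding tr_def by (intro tendsto_intros elim)
      moreover have "tr B (F x) = F x" by (auto simp: F_def tr_def B_def)
      moreover have "\<forall>\<^sub>F n in sequentially. h n x = tr B (g n x)"
      proof -
        obtain n0 :: nat where n0: "1 / sin (pi * x) \<le> real n0" using real_arch_simple by blast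
        show ?thesis
        proof (rule eventually_sequentiallyI[of n0])
          fix n assume "n \<ge> n0"
          then have "1 / sin (pi * x) \<le> real n" using n0 by (meson of_nat_mono order.trans)
          then have "1 \<le> real n * sin (pi * x)" using s by (simp add: divide_le_eq)
          then show "h n x = tr B (g n x)" using s by (auto simp: h_def q_def max_def)
        qed
      qed
      ultimately have "(\<lambda>n. h n x) \<longlonglongrightarrow> F x" by (simp add: tendsto_cong)
      then show ?case using x by simp
    qed
  qed (rule Fm)
  then have "\<forall>\<^sub>F n in sequentially. norm2 (\<lambda>x. F x - indicator {0<..<1} x * h n x) < e / 64"
    by (rule order_tendstoD(2)) (use e in simp)
  then obtain n :: nat where n: "norm2 (\<lambda>x. F x - indicator {0<..<1} x * h n x) < e / 64"
    using eventually_happens'[OF sequentially_bot] by blast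
  have n': "norm2 (\<lambda>x. F x - h n x) < e / 16 / 4"
  proof -
    have "norm2 (\<lambda>x. F x - h n x) = norm2 (\<lambda>x. F x - indicator {0<..<1} x * h n x)"
      unfolding norm2_def by (intro Bochner_Integration.integral_cong) (auto simp: space_unitI)
    with n show ?thesis by simp
  qed
  have hL2: "L2 (h n)" by (rule L2_bounded[OF hm h_bd])
  \<comment> \<open>Makes the constant bound \<open>d\<^sup>2\<close> smaller than
    \<open>e / 64\<close>, the share left after two triangle steps.\<close>
  define d where "d = sqrt (e / 128)"
  have d: "d > 0" using e by (simp add: d_def)
  obtain t where t: "is_sine_poly t" "\<And>x. 0 \<le> x \<Longrightarrow> x \<le> 1 \<Longrightarrow> \<bar>q n x * sin (pi * x) - t x\<bar> < d"
    using sine_poly_approx_continuous[OF qc d] by blast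
  have tL2: "L2 t"
  proof -
    obtain K c where "\<And>x. t x = sine_poly K c x" using t(1) by (auto simp: is_sine_poly_def)
    then have "t = sine_poly K c" by (simp add: fun_eq_iff)
    then show ?thesis using L2_sine_poly by simp
  qed
  have "norm2 (\<lambda>x. h n x - t x) \<le> integral\<^sup>L unitI (\<lambda>x. d\<^sup>2)"
    unfolding norm2_def
  proof (rule integral_mono)
    show "integrable unitI (\<lambda>x. (h n x - t x)\<^sup>2)" using L2_diff[OF hL2 tL2] by (simp add: L2_def)
    show "integrable unitI (\<lambda>x. d\<^sup>2)" by (rule integrable_unitI_bounded[of _ "d\<^sup>2"]) auto
    fix x assume "x \<in> space unitI"
    then have "\<bar>h n x - t x\<bar> \<le> \<bar>d\<bar>" using t(2)[of x] d by (auto simp: space_unitI h_def)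
    then show "(h n x - t x)\<^sup>2 \<le> d\<^sup>2" by (simp only: abs_le_square_iff)
  qed
  also have "\<dots> = d\<^sup>2"
    using integral_unitI_FTC'[of "\<lambda>x. d\<^sup>2 * x" "\<lambda>x. d\<^sup>2"] by (auto intro!: derivative_eq_intros)
  also have "\<dots> < e / 16 / 4" using e by (simp add: d_def)
  finally have ht: "norm2 (\<lambda>x. h n x - t x) < e / 16 / 4" .
  have "norm2 (\<lambda>x. F x - t x) < e / 16" by (rule norm2_triangle[OF FL2 hL2 tL2 n' ht])
  then have "norm2 (\<lambda>x. F x - t x) < e / 4" using e by simp
  moreover have "norm2 (\<lambda>x. f x - F x) < e / 4" using N by (simp add: F_def B_def)
  ultimately have "norm2 (\<lambda>x. f x - t x) < e" by (intro norm2_triangle[OF f FL2 tL2])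
  then show ?thesis by (rule that[OF t(1) tL2])
qed

section \<open>Evaluation functionals\<close>

lemma sine_0: "sine 0 = (\<lambda>x. 0)" by (simp add: sine_def[abs_def])

lemma sine_coeff_0: "sine_coeff f 0 = 0" by (simp add: sine_coeff_def sine_0)

lemma sine_dilate: "sine n (real k * x) = sine (k * n) x"
  by (simp add: sine_def mult_ac)

lemma odd_periodic_sine_poly: "odd_periodic (sine_poly K c)"
  unfolding sine_poly_def by (intro odd_periodic_sum odd_periodic_cmult odd_periodic_sine)

lemma sine_poly_dense:
  assumes "L2 f" "e > 0"
  obtains K c where "norm2 (\<lambda>x. f x - sine_poly K c x) < e"
proof -
  obtain g where g: "is_sine_poly g" "L2 g" "norm2 (\<lambda>x. f x - g x) < e"
    by (rule is_sine_poly_dense[OF assms])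
  then obtain K c where "\<And>x. g x = sine_poly K c x" by (auto simp: is_sine_poly_def)
  with g(3) show ?thesis by (intro that[of K c]) simp
qed

text \<open>The half of Parseval's identity that rests on completeness of the sines: a close sine
  polynomial leaves an error below \<open>e\<close>, and by the exact formula \<open>norm2 f\<close>
  exceeds this error by at most \<open>B\<close>.\<close>

lemma norm2_le_if_sine_coeffs_le:
  assumes f: "L2 f" and B: "\<And>K. (\<Sum>n=1..K. 2 * (sine_coeff f n)\<^sup>2) \<le> B"
  shows "norm2 f \<le> B"
proof (rule field_le_epsilon)
  fix e :: real assume "e > 0"
  then obtain K c where "norm2 (\<lambda>x. f x - sine_poly K c x) < e" by (rule sine_poly_dense[OF f])
  moreover have "(\<Sum>n=1..K. 2 * (sine_coeff f n - c n / 2)\<^sup>2) \<ge> 0" by (intro sum_nonneg) simp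
  ultimately show "norm2 f \<le> B + e"
    using B[of K] norm2_diff_sine_poly[OF f, of K c] by linarith
qed

text \<open>For sine polynomials this is orthogonality. The defect \<open>D\<close> is additive and
  its square is at most \<open>2 * norm2 f\<close>, because dilation preserves the norm, so density
  carries the rule over to \<open>L2\<close>.\<close>

lemma sine_coeff_dilate:
  assumes op: "odd_periodic \<Phi>" and L: "L2 \<Phi>" and k: "k > 0" and n: "n > 0"
  shows "sine_coeff (\<lambda>x. \<Phi> (real k * x)) n = (if k dvd n then sine_coeff \<Phi> (n div k) else 0)"
proof -
  define D where "D f = sine_coeff (\<lambda>x. f (real k * x)) n
      - (if k dvd n then sine_coeff f (n div k) else 0)" for f
  have nk: "n div k > 0" if "k dvd n" using that n by (auto elim!: dvdE)
  have poly: "D (sine_poly K c) = 0" for K c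
  proof -
    have "sine_coeff (\<lambda>x. sine_poly K c (real k * x)) n = (\<Sum>m=1..K. c m * sine_coeff (sine (k * m)) n)"
      unfolding sine_poly_def sine_dilate
      by (subst sine_coeff_sum) (auto intro!: L2_cmult L2_sine simp: sine_coeff_cmult)
    also have "\<dots> = (\<Sum>m=1..K. if k dvd n \<and> m = n div k then c (n div k) / 2 else 0)"
      using k n by (intro sum.cong) (auto simp: sine_orthogonal)
    also have "\<dots> = (if k dvd n then sine_coeff (sine_poly K c) (n div k) else 0)"
      using nk by (auto simp: sine_coeff_sine_poly Suc_le_eq)
    finally show ?thesis by (simp add: D_def)
  qed
  have bound: "(D f)\<^sup>2 \<le> 2 * norm2 f" if f: "odd_periodic f" "L2 f" for f
  proof -
    let ?a = "sine_coeff (\<lambda>x. f (real k * x)) n" and ?b = "if k dvd n then sine_coeff f (n div k) else 0"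
    have a: "2 * ?a\<^sup>2 \<le> norm2 f"
      using sine_coeff_square_le[OF norm2_dilate(2)[OF f(1) k f(2)] n] norm2_dilate(1)[OF f(1) k] by simp
    have b: "2 * ?b\<^sup>2 \<le> norm2 f"
      using sine_coeff_square_le[OF f(2) nk] norm2_nonneg[of f] by simp
    have "(?a - ?b)\<^sup>2 \<le> 2 * ?a\<^sup>2 + 2 * ?b\<^sup>2"
      using sum_squares_bound[of ?a "- ?b"] by (simp add: power2_diff)
    with a b show ?thesis unfolding D_def by linarith
  qed
  have "(D \<Phi>)\<^sup>2 \<le> 0 + e" if e: "e > 0" for e
  proof -
    obtain K c where Kc: "norm2 (\<lambda>x. \<Phi> x - sine_poly K c x) < e / 2"
      using sine_poly_dense[OF L, of "e / 2"] e by auto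
    have sp: "L2 (\<lambda>x. sine_poly K c (real k * x))"
      by (rule norm2_dilate(2)[OF odd_periodic_sine_poly k L2_sine_poly])
    have "D (\<lambda>x. \<Phi> x - sine_poly K c x) = D \<Phi> - D (sine_poly K c)"
      unfolding D_def using sine_coeff_diff[OF norm2_dilate(2)[OF op k L] sp] sine_coeff_diff[OF L
          L2_sine_poly]
      by simp
    then have "(D \<Phi>)\<^sup>2 = (D (\<lambda>x. \<Phi> x - sine_poly K c x))\<^sup>2" using poly by simp
    also have "\<dots> \<le> 2 * norm2 (\<lambda>x. \<Phi> x - sine_poly K c x)"
      by (intro bound odd_periodic_diff L2_diff op L odd_periodic_sine_poly L2_sine_poly)
    also have "\<dots> \<le> 0 + e" using Kc by simp
    finally show ?thesis .
  qed
  then have "(D \<Phi>)\<^sup>2 \<le> 0" by (rule field_le_epsilon)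
  then have "D \<Phi> = 0" by simp
  then show ?thesis by (simp add: D_def)
qed

lemma sine_coeff_square_summable:
  assumes "L2 f"
  shows "(\<lambda>n. (sine_coeff f n)\<^sup>2) summable_on UNIV" "finite F \<Longrightarrow> (\<Sum>n\<in>F. (sine_coeff f n)\<^sup>2) \<le> norm2 f / 2"
proof -
  have bd: "(\<Sum>n\<in>F. (sine_coeff f n)\<^sup>2) \<le> norm2 f / 2" if "finite F" for F
  proof -
    have "(\<Sum>n\<in>F. (sine_coeff f n)\<^sup>2) = (\<Sum>n\<in>F - {0}. (sine_coeff f n)\<^sup>2)"
      using that by (intro sum.mono_neutral_right) (auto simp: sine_coeff_0)
    also have "\<dots> \<le> (\<Sum>n=1..Max F. (sine_coeff f n)\<^sup>2)"
      using that by (intro sum_mono2) (auto simp: Suc_le_eq)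
    also have "\<dots> \<le> norm2 f / 2"
      using bessel[OF assms, of "Max F"] by (simp add: sum_distrib_left[symmetric])
    finally show ?thesis .
  qed
  then show "finite F \<Longrightarrow> (\<Sum>n\<in>F. (sine_coeff f n)\<^sup>2) \<le> norm2 f / 2" .
  show "(\<lambda>n. (sine_coeff f n)\<^sup>2) summable_on UNIV"
    by (rule nonneg_bdd_above_summable_on) (auto intro!: bdd_aboveI2[where M = "norm2 f / 2"] bd)
qed

text \<open>For square summable \<open>\<mu>\<close> the functional below is bounded on \<open>L\<^sup>2\<close>; if \<open>\<mu>\<close> is completely
  multiplicative, dilation by \<open>k\<close> multiplies it by \<open>\<mu> k\<close>.\<close>

definition eval_functional :: "(nat \<Rightarrow> complex) \<Rightarrow> (real \<Rightarrow> real) \<Rightarrow> complex" where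
  "eval_functional \<mu> f = infsum (\<lambda>n. of_real (sine_coeff f n) * \<mu> n) UNIV"

context
  fixes \<mu> :: "nat \<Rightarrow> complex"
  assumes l2: "(\<lambda>n. (norm (\<mu> n))\<^sup>2) summable_on UNIV"
begin

lemma eval_functional_summable:
  assumes "L2 f"
  shows "Infinite_Sum.abs_summable_on (\<lambda>n. of_real (sine_coeff f n) * \<mu> n) UNIV"
proof (rule Infinite_Sum.abs_summable_product)
  show "Infinite_Sum.abs_summable_on (\<lambda>n. complex_of_real (sine_coeff f n) * of_real (sine_coeff f n)) UNIV"
    using sine_coeff_square_summable(1)[OF assms] by (simp add: norm_mult power2_eq_square)
  show "Infinite_Sum.abs_summable_on (\<lambda>n. \<mu> n * \<mu> n) UNIV"
    using l2 by (simp add: norm_mult power2_eq_square)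
qed

lemma eval_functional_has_sum:
  "L2 f \<Longrightarrow> ((\<lambda>n. of_real (sine_coeff f n) * \<mu> n) has_sum eval_functional \<mu> f) UNIV"
  unfolding eval_functional_def
  by (rule has_sum_infsum[OF Infinite_Sum.abs_summable_summable[OF eval_functional_summable]])

lemma eval_functional_add:
  assumes "L2 f" "L2 g"
  shows "eval_functional \<mu> (\<lambda>x. f x + g x) = eval_functional \<mu> f + eval_functional \<mu> g"
  unfolding eval_functional_def[of _ "\<lambda>x. f x + g x"] sine_coeff_add[OF assms] of_real_add distrib_right
  by (intro infsumI has_sum_add eval_functional_has_sum assms)

lemma eval_functional_cmult:
  assumes "L2 f"
  shows "eval_functional \<mu> (\<lambda>x. c * f x) = of_real c * eval_functional \<mu> f"
  unfolding eval_functional_def[of _ "\<lambda>x. c * f x"] sine_coeff_cmult of_real_mult mult.assoc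
  by (intro infsumI has_sum_cmult_right eval_functional_has_sum assms)

lemma eval_functional_bound:
  assumes "L2 f"
  shows "norm (eval_functional \<mu> f) \<le> sqrt (norm2 f / 2 * infsum (\<lambda>n. (norm (\<mu> n))\<^sup>2) UNIV)"
proof -
  let ?S = "infsum (\<lambda>n. (norm (\<mu> n))\<^sup>2) UNIV"
  have "norm (eval_functional \<mu> f) \<le> infsum (\<lambda>n. norm (of_real (sine_coeff f n) * \<mu> n)) UNIV"
    unfolding eval_functional_def by (rule norm_infsum_bound[OF eval_functional_summable[OF assms]])
  also have "\<dots> \<le> sqrt (norm2 f / 2 * ?S)"
  proof (rule infsum_le_finite_sums[OF eval_functional_summable[OF assms]])
    fix F :: "nat set" assume F: "finite F"
    have "(\<Sum>n\<in>F. norm (of_real (sine_coeff f n) * \<mu> n)) = (\<Sum>n\<in>F. \<bar>sine_coeff f n\<bar> * \<bar>norm (\<mu> n)\<bar>)"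
      by (simp add: norm_mult)
    also have "\<dots> \<le> L2_set (sine_coeff f) F * L2_set (\<lambda>n. norm (\<mu> n)) F"
      by (rule L2_set_mult_ineq)
    also have "\<dots> = sqrt ((\<Sum>n\<in>F. (sine_coeff f n)\<^sup>2) * (\<Sum>n\<in>F. (norm (\<mu> n))\<^sup>2))"
      by (simp add: L2_set_def real_sqrt_mult)
    also have "\<dots> \<le> sqrt (norm2 f / 2 * ?S)"
      using sine_coeff_square_summable(2)[OF assms F] finite_sum_le_infsum[OF l2 F] norm2_nonneg[of f]
      by (intro real_sqrt_le_mono mult_mono) (auto intro!: sum_nonneg)
    finally show "(\<Sum>n\<in>F. norm (of_real (sine_coeff f n) * \<mu> n)) \<le> sqrt (norm2 f / 2 * ?S)" .
  qed
  finally show ?thesis .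
qed

lemma eval_functional_dilate:
  assumes op: "odd_periodic \<Phi>" and L: "L2 \<Phi>" and k: "k > 0"
    and mult: "\<And>a b. \<mu> (a * b) = \<mu> a * \<mu> b"
  shows "eval_functional \<mu> (\<lambda>x. \<Phi> (real k * x)) = \<mu> k * eval_functional \<mu> \<Phi>"
proof -
  let ?g = "\<lambda>n. of_real (sine_coeff (\<lambda>x. \<Phi> (real k * x)) n) * \<mu> n"
  have "eval_functional \<mu> (\<lambda>x. \<Phi> (real k * x)) = infsum ?g (range ((*) k))"
    unfolding eval_functional_def
  proof (rule infsum_cong_neutral)
    fix n assume n: "n \<in> UNIV - range ((*) k)"
    then have "\<not> k dvd n" by (auto simp: dvd_def)
    then show "?g n = 0"
      using sine_coeff_dilate[OF op L k, of n] by (cases "n = 0") (auto simp: sine_coeff_0)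
  qed auto
  also have "\<dots> = infsum (?g \<circ> (*) k) UNIV"
    using k by (intro infsum_reindex) (auto intro!: inj_onI)
  also have "?g \<circ> (*) k = (\<lambda>n. \<mu> k * (of_real (sine_coeff \<Phi> n) * \<mu> n))"
  proof
    fix n
    show "(?g \<circ> (*) k) n = \<mu> k * (of_real (sine_coeff \<Phi> n) * \<mu> n)"
      using sine_coeff_dilate[OF op L k, of "k * n"] k
      by (cases "n = 0") (auto simp: sine_coeff_0 mult)
  qed
  also have "infsum \<dots> UNIV = \<mu> k * eval_functional \<mu> \<Phi>"
    unfolding eval_functional_def by (rule infsum_cmult_right')
  finally show ?thesis .
qed

text \<open>If the functional vanished at \<phi>, it would vanish on all dilates and, being bounded,
  on everything they approximate; but \<open>sine 1\<close> is approximated and has the value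
  \<open>1 / 2\<close>.\<close>

lemma eval_functional_nonzero_if_complete:
  assumes mult: "\<And>a b. \<mu> (a * b) = \<mu> a * \<mu> b" and \<mu>1: "\<mu> 1 = 1"
    and cd: "complete_dilates \<phi>"
  shows "eval_functional \<mu> \<phi> \<noteq> 0"
proof
  assume zero: "eval_functional \<mu> \<phi> = 0"
  define \<Phi> where "\<Phi> = odd_ext \<phi>"
  have L\<phi>: "L2 \<phi>" using cd by (simp add: complete_dilates_def)
  have op: "odd_periodic \<Phi>" using L\<phi> by (simp add: \<Phi>_def L2_def odd_periodic_odd_ext)
  have eqI: "\<Phi> x = \<phi> x" if "x \<in> space unitI" for x
    using that by (simp add: \<Phi>_def space_unitI odd_ext_eq)
  have L: "L2 \<Phi>"
    using L\<phi> eqI unfolding L2_def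
    by (simp cong: measurable_cong Bochner_Integration.integrable_cong)
  have "sine_coeff \<Phi> = sine_coeff \<phi>"
    unfolding sine_coeff_def using eqI by (auto intro!: ext Bochner_Integration.integral_cong)
  then have zero': "eval_functional \<mu> \<Phi> = 0" using zero by (simp add: eval_functional_def)
  define P where "P A c x = (\<Sum>k\<in>A. c k * \<Phi> (real k * x))" for A and c :: "nat \<Rightarrow> real" and x
  have P: "L2 (P A c) \<and> eval_functional \<mu> (P A c) = 0" if "finite A" "A \<subseteq> {0<..}" for A c
    using that
  proof (induction A rule: finite_induct)
    case empty
    have "L2 (\<lambda>x. 0)" by (rule L2_bounded[of _ 0]) auto
    then show ?case
      using eval_functional_cmult[of "\<lambda>x. 0" 0] by (simp add: P_def[abs_def])
  next
    case (insert k A)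
    have Lk: "L2 (\<lambda>x. c k * \<Phi> (real k * x))"
      using insert.prems by (intro L2_cmult norm2_dilate(2)[OF op _ L]) auto
    have Pk: "P (insert k A) c = (\<lambda>x. c k * \<Phi> (real k * x) + P A c x)"
      using insert.hyps by (simp add: P_def fun_eq_iff)
    have "eval_functional \<mu> (\<lambda>x. c k * \<Phi> (real k * x)) = 0"
      using insert.prems eval_functional_dilate[OF op L _ mult, of k] zero'
      by (subst eval_functional_cmult) (auto intro!: norm2_dilate(2)[OF op _ L])
    then show ?case unfolding Pk using insert Lk by (simp add: L2_add eval_functional_add)
  qed
  define S where "S = infsum (\<lambda>n. (norm (\<mu> n))\<^sup>2) UNIV"
  have S0: "S \<ge> 0" unfolding S_def by (intro infsum_nonneg) simp
  \<comment> \<open>Small enough to keep \<open>sqrt (\<epsilon> / 2 * S)\<close> below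
    \<open>1 / 2\<close>; the added 1 keeps the denominator positive.\<close>
  define \<epsilon> where "\<epsilon> = 1 / (4 * (S + 1))"
  have \<epsilon>: "\<epsilon> > 0" using S0 by (simp add: \<epsilon>_def)
  obtain n c where nc: "norm2 (\<lambda>x. sine 1 x - P {1..n} c x) < \<epsilon>"
  proof -
    have "\<forall>\<epsilon>>0. \<exists>n::nat. \<exists>c::nat \<Rightarrow> real.
        integral\<^sup>L unitI (\<lambda>x. (sine 1 x - (\<Sum>k=1..n. c k * odd_ext \<phi> (real k * x)))\<^sup>2) < \<epsilon>"
      using cd L2_sine[of 1] unfolding complete_dilates_def by blast
    with \<epsilon> that show ?thesis unfolding norm2_def P_def \<Phi>_def by blast
  qed
  have "{1..n} \<subseteq> {0<..}" by auto
  then have Pn: "L2 (P {1..n} c)" "eval_functional \<mu> (P {1..n} c) = 0" using P[of "{1..n}" c] by blast+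
  have "eval_functional \<mu> (sine 1) = 1 / 2"
  proof -
    have "eval_functional \<mu> (sine 1) = infsum (\<lambda>n. of_real (sine_coeff (sine 1) n) * \<mu> n) {1}"
      unfolding eval_functional_def
    proof (rule infsum_cong_neutral)
      fix n :: nat assume "n \<in> UNIV - {1}"
      then show "of_real (sine_coeff (sine 1) n) * \<mu> n = 0"
        by (cases "n = 0") (auto simp: sine_coeff_0 sine_orthogonal)
    qed auto
    then show ?thesis using \<mu>1 by (simp add: sine_orthogonal)
  qed
  moreover have "eval_functional \<mu> (sine 1)
      = eval_functional \<mu> (\<lambda>x. sine 1 x - P {1..n} c x) + eval_functional \<mu> (P {1..n} c)"
    using eval_functional_add[OF L2_diff[OF L2_sine Pn(1)] Pn(1), of 1] by simp
  ultimately have half: "eval_functional \<mu> (\<lambda>x. sine 1 x - P {1..n} c x) = 1 / 2" using Pn(2) by simp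
  have "norm (1 / 2 :: complex) \<le> sqrt (norm2 (\<lambda>x. sine 1 x - P {1..n} c x) / 2 * S)"
    using eval_functional_bound[OF L2_diff[OF L2_sine Pn(1)], of 1] unfolding half S_def .
  then have "1 / 2 \<le> sqrt (norm2 (\<lambda>x. sine 1 x - P {1..n} c x) / 2 * S)"
    unfolding norm_divide norm_one norm_numeral .
  also have "\<dots> \<le> sqrt (\<epsilon> / 2 * S)"
    using nc S0 by (intro real_sqrt_le_mono mult_right_mono divide_right_mono) auto
  also have "\<dots> < sqrt (1 / 4)"
  proof (rule real_sqrt_less_mono)
    have "S < 2 * (S + 1)" using S0 by simp
    then show "\<epsilon> / 2 * S < 1 / 4" using S0 by (simp add: \<epsilon>_def field_simps)
  qed
  also have "sqrt (1 / 4) = (1 / 2 :: real)" by (simp add: real_sqrt_divide)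
  finally show False by simp
qed

end

proposition twists_nonvanishing_if_complete:
  assumes cd: "complete_dilates \<phi>" and A: "\<And>n. n > 0 \<Longrightarrow> sine_coeff \<phi> n = A n / (pi * real n)"
  shows "twists_nonvanishing A"
  unfolding twists_nonvanishing_def
proof (intro allI impI)
  fix \<mu> :: "nat \<Rightarrow> complex"
  assume \<mu>: "\<mu> 1 = 1" "\<forall>a b. \<mu> (a * b) = \<mu> a * \<mu> b" "(\<lambda>n. (norm (\<mu> n))\<^sup>2) summable_on UNIV"
  have "of_real (A n) * \<mu> n / of_nat n = of_real pi * (of_real (sine_coeff \<phi> n) * \<mu> n)" for n
    by (cases "n = 0") (simp_all add: sine_coeff_0 A)
  then have "infsum (\<lambda>n. of_real (A n) * \<mu> n / of_nat n) UNIV = of_real pi * eval_functional \<mu> \<phi>"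
    by (simp add: eval_functional_def infsum_cmult_right')
  moreover have "eval_functional \<mu> \<phi> \<noteq> 0"
    by (rule eval_functional_nonzero_if_complete[OF \<mu>(3) _ \<mu>(1) cd]) (use \<mu>(2) in simp)
  ultimately show "infsum (\<lambda>n. of_real (A n) * \<mu> n / of_nat n) UNIV \<noteq> 0"
    by (simp only: mult_eq_0_iff of_real_eq_0_iff pi_neq_zero not_False_eq_True simp_thms)
qed

section \<open>The closed span of dilates\<close>

definition dilation_span :: "(real \<Rightarrow> real) \<Rightarrow> (real \<Rightarrow> real) set" where
  "dilation_span \<Psi> = {g. \<exists>n c. g = (\<lambda>x. \<Sum>k=1..n. c k * \<Psi> (real k * x))}"

definition dilation_closure :: "(real \<Rightarrow> real) \<Rightarrow> (real \<Rightarrow> real) set" where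
  "dilation_closure \<Psi> = {f. L2 f \<and> (\<forall>e>0. \<exists>g\<in>dilation_span \<Psi>. norm2 (\<lambda>x. f x - g x) < e)}"

lemma dilation_span_base: "\<Psi> \<in> dilation_span \<Psi>"
  unfolding dilation_span_def by (intro CollectI exI[of _ 1] exI[of _ "\<lambda>_. 1"]) simp

lemma dilation_span_extend:
  fixes c :: "nat \<Rightarrow> real"
  assumes "n \<le> m"
  shows "(\<Sum>k=1..n. c k * \<Psi> (real k * x)) = (\<Sum>k=1..m. (if k \<le> n then c k else 0) * \<Psi> (real k * x))"
  using assms by (intro sum.mono_neutral_cong_left) auto

lemma dilation_span_add:
  assumes "f \<in> dilation_span \<Psi>" "g \<in> dilation_span \<Psi>"
  shows "(\<lambda>x. f x + g x) \<in> dilation_span \<Psi>"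
proof -
  obtain n c m d where f: "f = (\<lambda>x. \<Sum>k=1..n. c k * \<Psi> (real k * x))"
    and g: "g = (\<lambda>x. \<Sum>k=1..m. d k * \<Psi> (real k * x))"
    using assms unfolding dilation_span_def by blast
  have "(\<lambda>x. f x + g x) = (\<lambda>x. \<Sum>k=1..max n m. ((if k \<le> n then c k else 0) + (if k
      \<le> m then d k else 0)) * \<Psi> (real k * x))"
    unfolding f g dilation_span_extend[OF max.cobounded1[of n m]] dilation_span_extend[OF
        max.cobounded2[of m n]]
    by (simp only: sum.distrib distrib_right)
  then show ?thesis unfolding dilation_span_def by (intro CollectI exI)
qed

lemma dilation_span_cmult:
  assumes "f \<in> dilation_span \<Psi>"
  shows "(\<lambda>x. a * f x) \<in> dilation_span \<Psi>"
proof -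
  obtain n c where f: "f = (\<lambda>x. \<Sum>k=1..n. c k * \<Psi> (real k * x))"
    using assms unfolding dilation_span_def by blast
  have "(\<lambda>x. a * f x) = (\<lambda>x. \<Sum>k=1..n. (a * c k) * \<Psi> (real k * x))"
    unfolding f by (simp add: sum_distrib_left mult.assoc)
  then show ?thesis unfolding dilation_span_def by (intro CollectI exI)
qed

lemma dilation_span_dilate:
  assumes "f \<in> dilation_span \<Psi>" "m > 0"
  shows "(\<lambda>x. f (real m * x)) \<in> dilation_span \<Psi>"
proof -
  obtain n c where f: "f = (\<lambda>x. \<Sum>k=1..n. c k * \<Psi> (real k * x))"
    using assms unfolding dilation_span_def by blast
  let ?c = "\<lambda>k. if m dvd k then c (k div m) else 0"
  have "(\<Sum>k=1..n. c k * \<Psi> (real k * (real m * x))) = (\<Sum>k=1..m * n. ?c k * \<Psi> (real k * x))" for x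
  proof -
    have "(\<Sum>k=1..n. c k * \<Psi> (real k * (real m * x))) = (\<Sum>k\<in>((*) m) ` {1..n}. ?c k * \<Psi> (real k * x))"
      using assms(2) by (subst sum.reindex) (auto intro!: inj_onI simp: mult_ac)
    also have "\<dots> = (\<Sum>k=1..m * n. ?c k * \<Psi> (real k * x))"
    proof (rule sum.mono_neutral_left)
      show "((*) m) ` {1..n} \<subseteq> {1..m * n}" using assms(2) by (auto simp: Suc_le_eq)
      show "\<forall>k\<in>{1..m * n} - ((*) m) ` {1..n}. ?c k * \<Psi> (real k * x) = 0"
      proof
        fix k assume k: "k \<in> {1..m * n} - ((*) m) ` {1..n}"
        have "\<not> m dvd k"
        proof
          assume "m dvd k"
          then obtain j where j: "k = m * j" by blast
          then have "j \<in> {1..n}" using k assms(2) by (auto simp: Suc_le_eq)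
          with j k show False by blast
        qed
        then show "?c k * \<Psi> (real k * x) = 0" by simp
      qed
    qed simp
    finally show ?thesis .
  qed
  then have "(\<lambda>x. f (real m * x)) = (\<lambda>x. \<Sum>k=1..m * n. ?c k * \<Psi> (real k * x))" by (simp add: f)
  then show ?thesis unfolding dilation_span_def by (intro CollectI exI)
qed

context
  fixes \<Psi> :: "real \<Rightarrow> real"
  assumes op: "odd_periodic \<Psi>" and L: "L2 \<Psi>"
begin

lemma L2_dilation_span: "g \<in> dilation_span \<Psi> \<Longrightarrow> L2 g"
  unfolding dilation_span_def by (auto intro!: L2_sum L2_cmult norm2_dilate(2)[OF op _ L])

lemma odd_periodic_dilation_span: "g \<in> dilation_span \<Psi> \<Longrightarrow> odd_periodic g"
  unfolding dilation_span_def by (auto intro!: odd_periodic_sum odd_periodic_cmult odd_periodic_dilate[OF op])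

lemma dilation_closureI_span:
  assumes "g \<in> dilation_span \<Psi>"
  shows "g \<in> dilation_closure \<Psi>"
proof -
  have "norm2 (\<lambda>x. g x - g x) = 0" by (simp add: norm2_def)
  then have "\<exists>h\<in>dilation_span \<Psi>. norm2 (\<lambda>x. g x - h x) < e" if "e > 0" for e
    using that by (intro bexI[OF _ assms]) simp
  then show ?thesis using L2_dilation_span[OF assms] unfolding dilation_closure_def by blast
qed

lemma dilation_closure_add:
  assumes "f \<in> dilation_closure \<Psi>" "g \<in> dilation_closure \<Psi>"
  shows "(\<lambda>x. f x + g x) \<in> dilation_closure \<Psi>"
  unfolding dilation_closure_def
proof (intro CollectI conjI allI impI)
  show "L2 (\<lambda>x. f x + g x)" using assms by (auto simp: dilation_closure_def intro: L2_add)
  fix e :: real assume "e > 0"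
  then have "e / 4 > 0" by simp
  then obtain a b where a: "a \<in> dilation_span \<Psi>" "norm2 (\<lambda>x. f x - a x) < e / 4"
    and b: "b \<in> dilation_span \<Psi>" "norm2 (\<lambda>x. g x - b x) < e / 4"
    using assms unfolding dilation_closure_def by blast
  have L2fg: "L2 f" "L2 g" using assms by (auto simp: dilation_closure_def)
  have "norm2 (\<lambda>x. (f x - a x) + (g x - b x)) \<le> 2 * norm2 (\<lambda>x. f x - a x) + 2 * norm2 (\<lambda>x. g x - b x)"
    by (rule norm2_add_le[OF L2_diff[OF L2fg(1) L2_dilation_span[OF a(1)]] L2_diff[OF L2fg(2)
        L2_dilation_span[OF b(1)]]])
  then have "norm2 (\<lambda>x. (f x + g x) - (a x + b x)) < e" using a(2) b(2) by (simp add: algebra_simps)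
  then show "\<exists>h\<in>dilation_span \<Psi>. norm2 (\<lambda>x. (f x + g x) - h x) < e"
    by (rule bexI[OF _ dilation_span_add[OF a(1) b(1)]])
qed

lemma dilation_closure_cmult:
  assumes "f \<in> dilation_closure \<Psi>"
  shows "(\<lambda>x. r * f x) \<in> dilation_closure \<Psi>"
  unfolding dilation_closure_def
proof (intro CollectI conjI allI impI)
  show "L2 (\<lambda>x. r * f x)" using assms by (auto simp: dilation_closure_def intro: L2_cmult)
  fix e :: real assume "e > 0"
  then have "e / (r\<^sup>2 + 1) > 0" by (simp add: add_nonneg_pos)
  then obtain a where a: "a \<in> dilation_span \<Psi>" "norm2 (\<lambda>x. f x - a x) < e / (r\<^sup>2 + 1)"
    using assms unfolding dilation_closure_def by blast
  have "norm2 (\<lambda>x. r * f x - r * a x) = r\<^sup>2 * norm2 (\<lambda>x. f x - a x)"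
    using norm2_cmult[of r "\<lambda>x. f x - a x"] by (simp add: right_diff_distrib)
  also have "\<dots> \<le> (r\<^sup>2 + 1) * norm2 (\<lambda>x. f x - a x)"
    using norm2_nonneg[of "\<lambda>x. f x - a x"] by (intro mult_right_mono) auto
  also have "\<dots> < e" using a(2) by (simp add: pos_less_divide_eq add_nonneg_pos mult.commute)
  finally show "\<exists>h\<in>dilation_span \<Psi>. norm2 (\<lambda>x. r * f x - h x) < e"
    by (rule bexI[OF _ dilation_span_cmult[OF a(1), of r]])
qed

lemma dilation_closure_sum:
  assumes "finite A" "\<And>i. i \<in> A \<Longrightarrow> f i \<in> dilation_closure \<Psi>"
  shows "(\<lambda>x. \<Sum>i\<in>A. f i x) \<in> dilation_closure \<Psi>"
  using assms
proof (induction A rule: finite_induct)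
  case empty
  then show ?case
    using dilation_closureI_span[OF dilation_span_cmult[OF dilation_span_base, of 0]] by simp
qed (simp add: dilation_closure_add)

text \<open>Values of \<open>f\<close> outside the unit interval enter after dilation, so
  \<open>f\<close> itself has to be odd and periodic for the error to keep its norm.\<close>

lemma dilation_closure_dilate:
  assumes f: "f \<in> dilation_closure \<Psi>" "odd_periodic f" and k: "k > 0"
  shows "(\<lambda>x. f (real k * x)) \<in> dilation_closure \<Psi>"
  unfolding dilation_closure_def
proof (intro CollectI conjI allI impI)
  have "L2 f" using f(1) by (simp add: dilation_closure_def)
  then show "L2 (\<lambda>x. f (real k * x))" by (rule norm2_dilate(2)[OF f(2) k])
  fix e :: real assume "e > 0"
  then obtain a where a: "a \<in> dilation_span \<Psi>" "norm2 (\<lambda>x. f x - a x) < e"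
    using f(1) unfolding dilation_closure_def by blast
  then have "norm2 (\<lambda>x. f (real k * x) - a (real k * x)) < e"
    using norm2_dilate(1)[OF odd_periodic_diff[OF f(2) odd_periodic_dilation_span[OF a(1)]] k] by simp
  then show "\<exists>h\<in>dilation_span \<Psi>. norm2 (\<lambda>x. f (real k * x) - h x) < e"
    by (rule bexI[OF _ dilation_span_dilate[OF a(1) k]])
qed

lemma dilation_closure_limit:
  assumes f: "L2 f" and ex: "\<And>e. e > 0 \<Longrightarrow> \<exists>g\<in>dilation_closure \<Psi>. norm2 (\<lambda>x. f x - g x) < e"
  shows "f \<in> dilation_closure \<Psi>"
  unfolding dilation_closure_def
proof (intro CollectI conjI allI impI)
  fix e :: real assume "e > 0"
  then have e4: "e / 4 > 0" by simp
  obtain g where g: "g \<in> dilation_closure \<Psi>" "norm2 (\<lambda>x. f x - g x) < e / 4" using ex[OF e4] by blast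
  obtain a where a: "a \<in> dilation_span \<Psi>" "norm2 (\<lambda>x. g x - a x) < e / 4"
    using g(1) e4 unfolding dilation_closure_def by blast
  have "norm2 (\<lambda>x. f x - a x) < e"
    by (rule norm2_triangle[OF f _ L2_dilation_span[OF a(1)] g(2) a(2)]) (use g(1) in \<open>simp add:
        dilation_closure_def\<close>)
  with a(1) show "\<exists>h\<in>dilation_span \<Psi>. norm2 (\<lambda>x. f x - h x) < e" by blast
qed (rule f)

text \<open>The dilates of \<open>sine 1\<close> are all the sines, and sine polynomials are
  dense.\<close>

lemma dilation_closure_UNIV:
  assumes s1: "sine 1 \<in> dilation_closure \<Psi>" and f: "L2 f"
  shows "f \<in> dilation_closure \<Psi>"
proof (rule dilation_closure_limit[OF f])
  fix e :: real assume "e > 0"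
  then obtain K c where Kc: "norm2 (\<lambda>x. f x - sine_poly K c x) < e" by (rule sine_poly_dense[OF f])
  have "sine k \<in> dilation_closure \<Psi>" if "k \<in> {1..K}" for k
    using dilation_closure_dilate[OF s1 odd_periodic_sine, of k] that by (simp add: sine_dilate)
  then have "sine_poly K c \<in> dilation_closure \<Psi>"
    unfolding sine_poly_def[abs_def] by (intro dilation_closure_sum dilation_closure_cmult) auto
  with Kc show "\<exists>g\<in>dilation_closure \<Psi>. norm2 (\<lambda>x. f x - g x) < e" by blast
qed

end

section \<open>Square waves at two scales\<close>

definition square_wave :: "real \<Rightarrow> real" where
  "square_wave = odd_ext (\<lambda>_. 1)"

lemma odd_periodic_square_wave: "odd_periodic square_wave"
  unfolding square_wave_def by (rule odd_periodic_odd_ext) simp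

lemma L2_square_wave: "L2 square_wave"
proof (rule L2_bounded[of _ 1])
  show "square_wave \<in> borel_measurable unitI"
    using odd_periodic_square_wave by (intro borel_measurable_unitI) (simp add: odd_periodic_def)
qed (simp add: square_wave_def odd_ext_eq)

lemma sine_coeff_square_wave:
  assumes "n > 0"
  shows "sine_coeff square_wave n = (if odd n then 2 / (pi * real n) else 0)"
proof -
  have "sine_coeff square_wave n = integral\<^sup>L unitI (\<lambda>x. sin (pi * real n * x))"
    unfolding sine_coeff_def sine_def
    by (intro Bochner_Integration.integral_cong) (auto simp: space_unitI square_wave_def odd_ext_eq)
  also have "\<dots> = (\<lambda>x. - cos (pi * real n * x) / (pi * real n)) 1 - (\<lambda>x.
      - cos (pi * real n * x) / (pi * real n)) 0"
    by (rule integral_unitI_FTC') (use assms in \<open>auto intro!: derivative_eq_intros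
        continuous_intros simp: field_simps\<close>)
  also have "\<dots> = (1 - cos (real n * pi)) / (pi * real n)" by (simp add: diff_divide_distrib mult.commute)
  also have "\<dots> = (if odd n then 2 / (pi * real n) else 0)" by (simp add: cos_npi)
  finally show ?thesis .
qed

lemma norm2_sum_sine_powers:
  fixes b :: "nat \<Rightarrow> real"
  assumes "N > 1"
  shows "norm2 (\<lambda>x. \<Sum>m=1..M. b m * sine (N ^ m) x) = (\<Sum>m=1..M. (b m)\<^sup>2 / 2)"
proof -
  let ?f = "\<lambda>x. \<Sum>m=1..M. b m * sine (N ^ m) x"
  have L: "L2 ?f" by (intro L2_sum L2_cmult L2_sine)
  have "norm2 ?f = integral\<^sup>L unitI (\<lambda>x. \<Sum>m=1..M. b m * (?f x * sine (N ^ m) x))"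
    unfolding norm2_def by (simp add: power2_eq_square sum_distrib_left mult_ac)
  also have "\<dots> = (\<Sum>m=1..M. b m * sine_coeff ?f (N ^ m))"
    unfolding sine_coeff_def
    by (subst Bochner_Integration.integral_sum, intro integrable_mult_right L2_mult_integrable L
        L2_sine, simp)
  also have "\<dots> = (\<Sum>m=1..M. (b m)\<^sup>2 / 2)"
  proof (intro sum.cong refl)
    fix m assume m: "m \<in> {1..M}"
    have "sine_coeff ?f (N ^ m) = (\<Sum>i=1..M. b i * sine_coeff (sine (N ^ i)) (N ^ m))"
      by (subst sine_coeff_sum) (auto intro!: L2_cmult L2_sine simp: sine_coeff_cmult)
    also have "\<dots> = (\<Sum>i=1..M. if i = m then b m / 2 else 0)"
      using assms by (intro sum.cong refl) (auto simp: sine_orthogonal)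
    also have "\<dots> = b m / 2" using m by simp
    finally show "b m * sine_coeff ?f (N ^ m) = (b m)\<^sup>2 / 2" by (simp add: power2_eq_square)
  qed
  finally show ?thesis .
qed

text \<open>The operators \<open>1 - T\<^sub>q / q\<close> for odd primes \<open>q\<close> remove from the square wave all frequencies
  divisible by \<open>q\<close>, so that applying many of them leaves almost only \<open>sin (\<pi> x)\<close>.\<close>

lemma square_wave_sieve:
  fixes \<sigma> :: real and N :: nat
  assumes "finite Q" "\<And>q. q \<in> Q \<Longrightarrow> prime q \<and> odd q" and N: "N > 0"
  defines "\<Psi> \<equiv> \<lambda>x. square_wave x + \<sigma> * square_wave (real N * x)"
  shows "\<exists>h. odd_periodic h \<and> L2 h \<and>
    (\<forall>n>0. sine_coeff h n = (if odd n \<and> (\<forall>q\<in>Q. \<not> q dvd n) then 2 / (pi * real n) else 0)) \<and>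
    (\<lambda>x. h x + \<sigma> * h (real N * x)) \<in> dilation_span \<Psi>"
  using assms(1,2)
proof (induction Q rule: finite_induct)
  case empty
  then show ?case
    using dilation_span_base[of \<Psi>] unfolding \<Psi>_def
    by (intro exI[of _ square_wave])
      (simp add: odd_periodic_square_wave L2_square_wave sine_coeff_square_wave)
next
  case (insert q Q)
  then obtain h where h: "odd_periodic h" "L2 h"
    and hc: "\<And>n. n > 0 \<Longrightarrow> sine_coeff h n = (if odd n \<and> (\<forall>q\<in>Q. \<not> q dvd n) then 2 / (pi * real n) else 0)"
    and hs: "(\<lambda>x. h x + \<sigma> * h (real N * x)) \<in> dilation_span \<Psi>"
    by auto
  have q: "prime q" "odd q" using insert.prems by auto
  have q0: "q > 0" using q(1) by (rule prime_gt_0_nat)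
  have Lq: "L2 (\<lambda>x. h (real q * x))" by (rule norm2_dilate(2)[OF h(1) q0 h(2)])
  define h' where "h' x = h x + (- 1 / real q) * h (real q * x)" for x
  have "odd_periodic h'" unfolding h'_def by (intro odd_periodic_add odd_periodic_cmult odd_periodic_dilate h)
  moreover have "L2 h'" unfolding h'_def by (intro L2_add L2_cmult Lq h)
  moreover have "sine_coeff h' n = (if odd n \<and> (\<forall>q\<in>insert q Q. \<not> q dvd n) then 2 / (pi * real n) else 0)"
    if n: "n > 0" for n
  proof -
    have eq: "sine_coeff h' n = sine_coeff h n - (if q dvd n then sine_coeff h (n div q) else 0) / real q"
      unfolding h'_def sine_coeff_add[OF h(2) L2_cmult[OF Lq]] sine_coeff_cmult
        sine_coeff_dilate[OF h(1,2) q0 n] by simp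
    show ?thesis
    proof (cases "q dvd n")
      case True
      then obtain m where m: "n = q * m" by blast
      then have m0: "m > 0" using n by simp
      have "t dvd n \<longleftrightarrow> t dvd m" if "t \<in> Q" for t
      proof -
        have "coprime t q" using that insert by (intro primes_coprime) auto
        then show ?thesis by (simp add: m coprime_dvd_mult_right_iff)
      qed
      then have "sine_coeff h n = sine_coeff h m / real q"
        using hc[OF n] hc[OF m0] q m q0 by (auto simp: field_simps)
      then show ?thesis unfolding eq using True m q0 by simp
    next
      case False
      then show ?thesis using hc[OF n] by (simp add: eq)
    qed
  qed
  \<comment> \<open>Dilations commute, so sifting by \<open>q\<close> acts on \<open>h\<close> and
    on its copy at scale \<open>N\<close> simultaneously and stays inside the span.\<close>
  moreover have "(\<lambda>x. h' x + \<sigma> * h' (real N * x)) \<in> dilation_span \<Psi>"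
  proof -
    let ?g = "\<lambda>x. h x + \<sigma> * h (real N * x)"
    have "(\<lambda>x. ?g x + (- 1 / real q) * ?g (real q * x)) \<in> dilation_span \<Psi>"
      by (rule dilation_span_add[OF hs dilation_span_cmult[OF dilation_span_dilate[OF hs q0]]])
    moreover have "h' x + \<sigma> * h' (real N * x) = ?g x + (- 1 / real q) * ?g (real q * x)" for x
      by (simp add: h'_def algebra_simps)
    ultimately show ?thesis by simp
  qed
  ultimately show ?case by blast
qed

text \<open>The sum over \<open>j < m\<close> of \<open>(- \<sigma>) ^ j * u (N ^ j * x)\<close>
  telescopes to \<open>sine 1\<close> minus \<open>(- \<sigma>) ^ m * sine (N ^ m)\<close>, a
  remainder whose norm does not decay because \<sigma> has modulus 1. For different \<open>m\<close>
  the remainders are orthogonal, so averaging \<open>M\<close> of them brings the squared norm down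
  to \<open>1 / (2 * M)\<close>.\<close>

lemma alternating_cesaro:
  fixes \<sigma> :: real and N :: nat
  assumes \<sigma>: "\<sigma>\<^sup>2 = 1" and N: "N > 1" and op: "odd_periodic \<Psi>" and L: "L2 \<Psi>"
    and u: "(\<lambda>x. sine 1 x + \<sigma> * sine N x) \<in> dilation_closure \<Psi>"
  shows "sine 1 \<in> dilation_closure \<Psi>"
proof (rule dilation_closure_limit[OF op L L2_sine])
  fix e :: real assume e: "e > 0"
  obtain M :: nat where M: "1 / (2 * e) < real M" using reals_Archimedean2 by blast
  have M0: "real M > 0" using M e by (smt (verit) divide_pos_pos)
  define u where "u x = sine 1 x + \<sigma> * sine N x" for x
  have opu: "odd_periodic u" unfolding u_def by (intro odd_periodic_add odd_periodic_cmult odd_periodic_sine)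
  define v where "v x = (\<Sum>m=1..M. (1 / real M) * (\<Sum>j<m. (- \<sigma>) ^ j * u (real (N ^ j) * x)))" for x
  have "v \<in> dilation_closure \<Psi>"
    unfolding v_def using N assms(5)
    by (intro dilation_closure_sum[OF op L] dilation_closure_cmult[OF op L]
        dilation_closure_dilate[OF op L] opu)
      (auto simp: u_def)
  moreover have "norm2 (\<lambda>x. sine 1 x - v x) < e"
  proof -
    have uj: "u (real (N ^ j) * x) = sine (N ^ j) x + \<sigma> * sine (N ^ Suc j) x" for j x
      unfolding u_def sine_dilate by (simp add: mult.commute)
    have tel: "(\<Sum>j<m. (- \<sigma>) ^ j * u (real (N ^ j) * x)) = sine 1 x - (- \<sigma>) ^ m * sine (N ^ m) x" for m x
    proof (induction m)
      case (Suc m)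
      then show ?case unfolding sum.lessThan_Suc Suc uj by (simp add: algebra_simps)
    qed simp
    have "sine 1 x - v x = (\<Sum>m=1..M. ((- \<sigma>) ^ m / real M) * sine (N ^ m) x)" for x
    proof -
      have "v x = (\<Sum>m=1..M. (1 / real M) * sine 1 x - ((- \<sigma>) ^ m / real M) * sine (N ^ m) x)"
        unfolding v_def tel by (simp add: right_diff_distrib)
      also have "\<dots> = sine 1 x - (\<Sum>m=1..M. ((- \<sigma>) ^ m / real M) * sine (N ^ m) x)"
        using M0 by (simp add: sum_subtractf)
      finally show ?thesis by simp
    qed
    then have "norm2 (\<lambda>x. sine 1 x - v x) = (\<Sum>m=1..M. ((- \<sigma>) ^ m / real M)\<^sup>2 / 2)"
      using norm2_sum_sine_powers[OF N, where M = M and b = "\<lambda>m. (- \<sigma>) ^ m / real M"] by simp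
    also have "\<dots> = (\<Sum>m=1..M. 1 / (real M)\<^sup>2 / 2)"
    proof (intro sum.cong refl)
      fix m
      have "((- \<sigma>) ^ m)\<^sup>2 = ((- \<sigma>)\<^sup>2) ^ m" by (simp only: power_mult[symmetric] mult.commute)
      then show "((- \<sigma>) ^ m / real M)\<^sup>2 / 2 = 1 / (real M)\<^sup>2 / 2" using \<sigma> by (simp add: power_divide)
    qed
    also have "\<dots> = 1 / (2 * real M)" using M0 by (simp add: power2_eq_square)
    also have "\<dots> < e" using M M0 e by (simp add: field_simps)
    finally show ?thesis .
  qed
  ultimately show "\<exists>g\<in>dilation_closure \<Psi>. norm2 (\<lambda>x. sine 1 x - g x) < e" by blast
qed

text \<open>An odd \<open>n\<close> with \<open>1 < n < K\<close> has an odd prime factor below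
  \<open>K\<close>, so sifting has removed all frequencies strictly between 1 and \<open>K\<close>;
  frequency 1 cancels exactly, and the rest belongs to a convergent tail.\<close>

lemma sieved_square_wave_close:
  assumes h: "L2 h" and K: "K \<ge> 2"
    and hc: "\<And>n. n > 0 \<Longrightarrow> sine_coeff h n
      = (if odd n \<and> (\<forall>q. prime q \<and> odd q \<and> q < K \<longrightarrow> \<not> q dvd n) then 2 / (pi * real n) else 0)"
    and tail: "\<And>F. finite F \<Longrightarrow> F \<subseteq> {K..} \<Longrightarrow> (\<Sum>n\<in>F. 2 * (2 / (pi * real n))\<^sup>2) \<le> B"
  shows "norm2 (\<lambda>x. h x - 4 / pi * sine 1 x) \<le> B"
proof (rule norm2_le_if_sine_coeffs_le)
  let ?d = "\<lambda>x. h x - 4 / pi * sine 1 x"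
  show "L2 ?d" by (intro L2_diff L2_cmult L2_sine h)
  have dc: "sine_coeff ?d n = sine_coeff h n - (if n = 1 then 2 / pi else 0)" if "n > 0" for n
    unfolding sine_coeff_diff[OF h L2_cmult[OF L2_sine]] sine_coeff_cmult using that
        by (simp add: sine_orthogonal)
  fix M
  have "(\<Sum>n=1..M. 2 * (sine_coeff ?d n)\<^sup>2) \<le> (\<Sum>n\<in>{1..M}. if K \<le> n then 2 * (2 / (pi * real n))\<^sup>2 else 0)"
  proof (rule sum_mono)
    fix n assume "n \<in> {1..M}"
    then have n: "n > 0" by simp
    consider "n = 1" | "1 < n" "n < K" | "K \<le> n" using n by linarith
    then show "2 * (sine_coeff ?d n)\<^sup>2 \<le> (if K \<le> n then 2 * (2 / (pi * real n))\<^sup>2 else 0)"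
    proof cases
      case 1
      have "q dvd 1 \<Longrightarrow> \<not> prime q" for q :: nat by (auto simp: not_prime_unit)
      then have "sine_coeff h 1 = 2 / pi" using hc[of 1] by auto
      then show ?thesis using 1 K dc[OF n] by simp
    next
      case 2
      have "sine_coeff h n = 0"
      proof (cases "odd n")
        case True
        obtain q where q: "prime q" "q dvd n" using 2 prime_factor_nat[of n] by auto
        have "q \<le> n" using q(2) n by (rule dvd_imp_le)
        moreover have "odd q" using True q(2) by (meson dvd_trans)
        ultimately show ?thesis using hc[OF n] q 2 by auto
      qed (use hc[OF n] in simp)
      then show ?thesis using 2 dc[OF n] by simp
    next
      case 3
      have "\<bar>sine_coeff ?d n\<bar> \<le> \<bar>2 / (pi * real n)\<bar>" using 3 K dc[OF n] hc[OF n] by simp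
      then have "(sine_coeff ?d n)\<^sup>2 \<le> (2 / (pi * real n))\<^sup>2" by (simp only: abs_le_square_iff)
      then show ?thesis using 3 by simp
    qed
  qed
  also have "\<dots> = (\<Sum>n\<in>{1..M} \<inter> {K..}. 2 * (2 / (pi * real n))\<^sup>2)"
    by (subst sum.inter_restrict) auto
  also have "\<dots> \<le> B" by (rule tail) auto
  finally show "(\<Sum>n=1..M. 2 * (sine_coeff ?d n)\<^sup>2) \<le> B" .
qed

lemma two_scale_closure:
  fixes \<sigma> :: real and N :: nat
  assumes \<sigma>: "\<sigma>\<^sup>2 = 1" and N: "N > 1"
  defines "\<Psi> \<equiv> \<lambda>x. square_wave x + \<sigma> * square_wave (real N * x)"
  shows "odd_periodic \<Psi>" "L2 \<Psi>" "sine 1 \<in> dilation_closure \<Psi>"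
proof -
  have N0: "N > 0" using N by simp
  show op: "odd_periodic \<Psi>" unfolding \<Psi>_def
    by (intro odd_periodic_add odd_periodic_cmult odd_periodic_dilate odd_periodic_square_wave)
  show L: "L2 \<Psi>" unfolding \<Psi>_def
    by (intro L2_add L2_cmult norm2_dilate(2)[OF odd_periodic_square_wave N0] L2_square_wave)
  let ?w = "\<lambda>x. 4 / pi * (sine 1 x + \<sigma> * sine N x)"
  have "?w \<in> dilation_closure \<Psi>"
    unfolding dilation_closure_def
  proof (intro CollectI conjI allI impI)
    show "L2 ?w" by (intro L2_add L2_cmult L2_sine)
    fix e :: real assume e: "e > 0"
    have "summable (\<lambda>n. (8 / pi\<^sup>2) * inverse ((real n) ^ 2))"
      by (intro summable_mult inverse_power_summable) simp
    then have summ: "summable (\<lambda>n. 2 * (2 / (pi * real n))\<^sup>2)"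
      by (simp add: power_divide power_mult_distrib field_simps)
    \<comment> \<open>The two scales together cost a factor 4 in the final estimate, which leaves
      \<open>e / 2\<close>.\<close>
    have "e / 8 > 0" using e by simp
    with summable_tail_small[OF summ, of "e / 8"] obtain K0 where
      K0: "\<And>F. finite F \<Longrightarrow> F \<subseteq> {K0..} \<Longrightarrow> (\<Sum>n\<in>F. 2 * (2 / (pi * real n))\<^sup>2) < e / 8" by auto
    define K where "K = max 2 K0"
    define Q where "Q = {q. prime q \<and> odd q \<and> q < K}"
    have "finite Q" "\<And>q. q \<in> Q \<Longrightarrow> prime q \<and> odd q" by (auto simp: Q_def)
    from square_wave_sieve[OF this N0, of \<sigma>] obtain h where h: "odd_periodic h" "L2 h"
      and hc: "\<And>n. n > 0 \<Longrightarrow> sine_coeff h n = (if odd n \<and> (\<forall>q\<in>Q. \<not> q dvd n) then 2 / (pi * real n) else 0)"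
      and hs: "(\<lambda>x. h x + \<sigma> * h (real N * x)) \<in> dilation_span \<Psi>"
      unfolding \<Psi>_def by blast
    define d where "d x = h x - 4 / pi * sine 1 x" for x
    have nd: "norm2 d \<le> e / 8"
      unfolding d_def
    proof (rule sieved_square_wave_close[OF h(2), of K])
      show "(\<Sum>n\<in>F. 2 * (2 / (pi * real n))\<^sup>2) \<le> e / 8" if "finite F" "F \<subseteq> {K..}" for F
      proof -
        have "F \<subseteq> {K0..}" using that(2) by (auto simp: K_def)
        then show ?thesis using K0[OF that(1)] by (simp add: less_imp_le)
      qed
      show "sine_coeff h n = (if odd n \<and> (\<forall>q. prime q \<and> odd q \<and> q
          < K \<longrightarrow> \<not> q dvd n) then 2 / (pi * real n) else 0)"
        if "n > 0" for n
        unfolding hc[OF that] by (simp add: Q_def)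
    qed (simp add: K_def)
    have opd: "odd_periodic d" unfolding d_def
        by (intro odd_periodic_diff odd_periodic_cmult odd_periodic_sine h)
    have Ld: "L2 d" unfolding d_def by (intro L2_diff L2_cmult L2_sine h)
    have Ld': "L2 (\<lambda>x. d (real N * x))" by (rule norm2_dilate(2)[OF opd N0 Ld])
    have eq: "?w x - (h x + \<sigma> * h (real N * x)) = (- 1) * d x + (- \<sigma>) * d (real N * x)" for x
      unfolding d_def sine_dilate mult_1_right by (simp add: algebra_simps)
    have "norm2 (\<lambda>x. ?w x - (h x + \<sigma> * h (real N * x)))
        \<le> 2 * norm2 (\<lambda>x. (- 1) * d x) + 2 * norm2 (\<lambda>x. (- \<sigma>) * d (real N * x))"
      unfolding eq by (intro norm2_add_le L2_cmult Ld Ld')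
    also have "\<dots> = 4 * norm2 d"
      unfolding norm2_cmult norm2_dilate(1)[OF opd N0] using \<sigma> by simp
    also have "\<dots> < e" using nd e by simp
    finally show "\<exists>g\<in>dilation_span \<Psi>. norm2 (\<lambda>x. ?w x - g x) < e" by (rule bexI[OF _ hs])
  qed
  from dilation_closure_cmult[OF op L this, of "pi / 4"]
  have "(\<lambda>x. pi / 4 * ?w x) \<in> dilation_closure \<Psi>" .
  moreover have "pi / 4 * ?w x = sine 1 x + \<sigma> * sine N x" for x by simp
  ultimately have "(\<lambda>x. sine 1 x + \<sigma> * sine N x) \<in> dilation_closure \<Psi>" by (simp only:)
  then show "sine 1 \<in> dilation_closure \<Psi>" by (rule alternating_cesaro[OF \<sigma> N op L])
qed

lemma norm2_sum_zero:
  assumes "finite A" "\<And>i. i \<in> A \<Longrightarrow> L2 (f i)" "\<And>i. i \<in> A \<Longrightarrow> norm2 (f i) = 0"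
  shows "norm2 (\<lambda>x. \<Sum>i\<in>A. f i x) = 0"
  using assms
proof (induction A rule: finite_induct)
  case empty
  then show ?case by (simp add: norm2_def)
next
  case (insert a A)
  have "norm2 (\<lambda>x. f a x + (\<Sum>i\<in>A. f i x)) \<le> 2 * norm2 (f a) + 2 * norm2 (\<lambda>x. \<Sum>i\<in>A. f i x)"
    using insert by (intro norm2_add_le L2_sum) auto
  then show ?case using insert norm2_nonneg[of "\<lambda>x. f a x + (\<Sum>i\<in>A. f i x)"] by simp
qed

text \<open>Agreement almost everywhere is enough: the odd extension of \<phi> and half of \<Psi>
  differ by an odd periodic function of norm 0, and dilation preserves norms, so all dilates of the
  difference are negligible. Doubling the coefficients absorbs the factor
  \<open>1 / 2\<close>.\<close>

proposition complete_if_two_scale: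
  fixes \<sigma> :: real and N :: nat
  assumes \<sigma>: "\<sigma>\<^sup>2 = 1" and N: "N > 1" and \<phi>: "L2 \<phi>"
    and ae: "AE x in unitI. \<phi> x = (square_wave x + \<sigma> * square_wave (real N * x)) / 2"
  shows "complete_dilates \<phi>"
  unfolding complete_dilates_def
proof (intro conjI allI impI)
  define \<Psi> where "\<Psi> x = square_wave x + \<sigma> * square_wave (real N * x)" for x
  have \<Psi>: "odd_periodic \<Psi>" "L2 \<Psi>" "sine 1 \<in> dilation_closure \<Psi>"
    using two_scale_closure[OF \<sigma> N] by (simp_all add: \<Psi>_def[abs_def])
  define \<Delta> where "\<Delta> x = odd_ext \<phi> x - 1 / 2 * \<Psi> x" for x
  have op\<phi>: "odd_periodic (odd_ext \<phi>)" using \<phi> by (simp add: L2_def odd_periodic_odd_ext)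
  have op\<Delta>: "odd_periodic \<Delta>" unfolding \<Delta>_def by (intro odd_periodic_diff odd_periodic_cmult op\<phi> \<Psi>)
  have m\<Delta>: "\<Delta> \<in> borel_measurable unitI"
    using op\<Delta> by (intro borel_measurable_unitI) (simp add: odd_periodic_def)
  have ae\<Delta>: "AE x in unitI. (\<Delta> x)\<^sup>2 = 0"
    using ae AE_space by eventually_elim (auto simp: \<Delta>_def \<Psi>_def space_unitI odd_ext_eq)
  have m2: "(\<lambda>x. (\<Delta> x)\<^sup>2) \<in> borel_measurable unitI" using m\<Delta> by measurable
  have n\<Delta>: "norm2 \<Delta> = 0"
    unfolding norm2_def using integral_cong_AE[OF m2 _ ae\<Delta>] by simp
  have L\<Delta>: "L2 \<Delta>"
    unfolding L2_def using m\<Delta> integrable_cong_AE[OF m2 _ ae\<Delta>] by simp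
  fix f :: "real \<Rightarrow> real" and e :: real assume f: "L2 f" and e: "e > 0"
  have "f \<in> dilation_closure \<Psi>" by (rule dilation_closure_UNIV[OF \<Psi> f])
  then obtain g where g: "g \<in> dilation_span \<Psi>" "norm2 (\<lambda>x. f x - g x) < e / 2"
    using e unfolding dilation_closure_def by (auto dest!: spec[of _ "e / 2"])
  then obtain n c where gc: "g = (\<lambda>x. \<Sum>k=1..n. c k * \<Psi> (real k * x))"
    unfolding dilation_span_def by blast
  let ?z = "\<lambda>x. \<Sum>k=1..n. (- 2 * c k) * \<Delta> (real k * x)"
  have z: "L2 ?z" "norm2 ?z = 0"
  proof -
    have *: "L2 (\<lambda>x. (- 2 * c k) * \<Delta> (real k * x)) \<and> norm2 (\<lambda>x. (- 2 * c k) * \<Delta> (real k * x)) = 0"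
      if "k \<in> {1..n}" for k
    proof -
      have k: "k > 0" using that by simp
      show ?thesis
        unfolding norm2_cmult norm2_dilate(1)[OF op\<Delta> k] n\<Delta>
        by (intro conjI L2_cmult norm2_dilate(2)[OF op\<Delta> k L\<Delta>]) simp
    qed
    show "L2 ?z" by (rule L2_sum) (use * in blast)
    show "norm2 ?z = 0" by (rule norm2_sum_zero) (use * in blast)+
  qed
  have eq: "f x - (\<Sum>k=1..n. (2 * c k) * odd_ext \<phi> (real k * x)) = (f x - g x) + ?z x" for x
  proof -
    have "(\<Sum>k=1..n. (2 * c k) * odd_ext \<phi> (real k * x)) = g x - ?z x"
      unfolding gc sum_subtractf[symmetric] by (intro sum.cong refl) (simp add: \<Delta>_def algebra_simps)
    then show ?thesis by simp
  qed
  have "norm2 (\<lambda>x. f x - (\<Sum>k=1..n. (2 * c k) * odd_ext \<phi> (real k * x)))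
      \<le> 2 * norm2 (\<lambda>x. f x - g x) + 2 * norm2 ?z"
    unfolding eq by (rule norm2_add_le[OF L2_diff[OF f L2_dilation_span[OF \<Psi>(1,2) g(1)]] z(1)])
  also have "\<dots> < e" using g(2) z(2) by simp
  finally show "\<exists>n::nat. \<exists>c::nat \<Rightarrow> real.
      integral\<^sup>L unitI (\<lambda>x. (f x - (\<Sum>k=1..n. c k * odd_ext \<phi> (real k * x)))\<^sup>2) < e"
    unfolding norm2_def by (intro exI)
qed (rule \<phi>)

section \<open>Unions of grid cells\<close>

definition cell :: "nat \<Rightarrow> nat \<Rightarrow> real set" where
  "cell N i = {real i / real N <..< real (Suc i) / real N}"

lemma mem_cell_iff:
  assumes "N > 0"
  shows "x \<in> cell N i \<longleftrightarrow> real i < real N * x \<and> real N * x < real (Suc i)"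
  using assms by (auto simp: cell_def divide_less_eq less_divide_eq mult.commute)

lemma cell_unique:
  assumes "N > 0" "x \<in> cell N i" "x \<in> cell N j"
  shows "i = j"
proof -
  have "real i < real (Suc j)" "real j < real (Suc i)"
    using assms by (auto simp: mem_cell_iff simp del: of_nat_Suc)
  then show ?thesis by linarith
qed

lemma grid_point_or_cell:
  assumes N: "N > 0" and x: "0 < x" "x < 1"
  obtains s where "0 < s" "s < N" "x = real s / real N" | i where "i < N" "x \<in> cell N i"
proof -
  define i where "i = nat \<lfloor>real N * x\<rfloor>"
  have "real N * x \<ge> 0" using x by simp
  then have i: "real i \<le> real N * x" "real N * x < real (Suc i)" unfolding i_def by linarith+
  have "real N * x < real N" using N x by simp
  then have "i < N" using i(1) by linarith
  show ?thesis
  proof (cases "real i = real N * x")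
    case True
    then have "x = real i / real N" using N by simp
    moreover have "i > 0" using True N x by (cases i) auto
    ultimately show ?thesis using that(1) \<open>i < N\<close> by blast
  next
    case False
    then have "x \<in> cell N i" using i N by (simp add: mem_cell_iff)
    then show ?thesis using that(2) \<open>i < N\<close> by blast
  qed
qed

lemma AE_unitI_cell:
  assumes "N > 0"
  shows "AE x in unitI. \<exists>i<N. x \<in> cell N i"
proof -
  have "AE x in lborel. x \<notin> (\<lambda>s. real s / real N) ` {..<N}"
    by (intro AE_not_in finite_imp_null_set_lborel) simp
  then have "AE x in unitI. x \<notin> (\<lambda>s. real s / real N) ` {..<N}"
    unfolding unitI_def by (subst AE_restrict_space_iff) (auto elim!: eventually_mono)
  then show ?thesis
    using AE_space
  proof eventually_elim
    case (elim x)
    then have x: "0 < x" "x < 1" by (auto simp: space_unitI)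
    show ?case using grid_point_or_cell[OF assms x] elim(1) by (metis imageI lessThan_iff)
  qed
qed

lemma square_wave_cell:
  assumes "real i < y" "y < real (Suc i)"
  shows "square_wave y = (if even i then 1 else - 1)"
proof -
  have per: "square_wave (x + 2 * real k) = square_wave x" for x k
    using odd_periodic_square_wave by (intro periodic_multiple) (simp add: odd_periodic_def)
  show ?thesis
  proof (cases "even i")
    case True
    then obtain j where j: "i = 2 * j" by blast
    have "square_wave y = square_wave (y - 2 * real j)" using per[of "y - 2 * real j" j] by simp
    also have "\<dots> = 1" using assms j by (simp add: square_wave_def odd_ext_eq)
    finally show ?thesis using True by simp
  next
    case False
    then obtain j where j: "i = 2 * j + 1" by (elim oddE)
    have "square_wave y = - square_wave (- y)" using odd_periodic_square_wave by (simp add: odd_periodic_def)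
    also have "square_wave (- y) = square_wave (2 * real (Suc j) - y)"
      using per[of "- y" "Suc j"] by (simp add: add.commute)
    also have "\<dots> = 1" using assms j by (simp add: square_wave_def odd_ext_eq)
    finally show ?thesis using False by simp
  qed
qed

text \<open>On cell \<open>i\<close> the wave at scale \<open>N\<close> is constant, with sign given
  by the parity of \<open>i\<close>, and the wave at scale 1 equals 1; so \<sigma> selects the even
  cells if it is 1 and the odd cells if it is -1.\<close>

lemma complete_if_parity_cells:
  assumes N: "N > 1" and V: "open V" and \<sigma>: "\<sigma>\<^sup>2 = (1::real)"
    and cells: "\<And>i x. i < N \<Longrightarrow> x \<in> cell N i \<Longrightarrow> indicator V x = (1 + \<sigma> * (if even i then 1 else - 1)) / 2"
  shows "complete_dilates (indicator V)"
proof (rule complete_if_two_scale[OF \<sigma> N])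
  show "L2 (indicator V)"
    using V by (intro L2_bounded[of _ 1] borel_measurable_unitI borel_measurable_indicator) (auto
        simp: indicator_def)
  have "AE x in unitI. \<exists>i<N. x \<in> cell N i" using N by (intro AE_unitI_cell) simp
  then show "AE x in unitI. indicator V x = (square_wave x + \<sigma> * square_wave (real N * x)) / 2"
    using AE_space
  proof eventually_elim
    case (elim x)
    then obtain i where i: "i < N" "x \<in> cell N i" by blast
    have "square_wave x = 1" using elim(2) by (simp add: space_unitI square_wave_def odd_ext_eq)
    moreover have "square_wave (real N * x) = (if even i then 1 else - 1)"
      using i N by (intro square_wave_cell) (auto simp: mem_cell_iff)
    ultimately show ?case using cells[OF i] by simp
  qed
qed

lemma sine_coeff_cells:
  assumes N: "N > 0" and n: "n > 0"
    and cells: "\<And>i x. i < N \<Longrightarrow> x \<in> cell N i \<Longrightarrow> \<phi> x = v (Suc i)"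
    and m: "\<phi> \<in> borel_measurable borel"
  shows "sine_coeff \<phi> n = grid_coeff N v n / (pi * real n)"
proof -
  have int: "integrable unitI (\<lambda>x. indicator (cell N i) x * sine n x)" for i
    by (rule L2_mult_integrable[OF _ L2_sine], rule L2_bounded[of _ 1])
      (auto simp: cell_def indicator_def intro!: borel_measurable_unitI borel_measurable_indicator)
  have "sine_coeff \<phi> n = integral\<^sup>L unitI (\<lambda>x. \<Sum>i<N. v (Suc i) * (indicator (cell N i) x * sine n x))"
    unfolding sine_coeff_def
  proof (rule integral_cong_AE)
    show "(\<lambda>x. \<phi> x * sine n x) \<in> borel_measurable unitI"
      using L2_sine[of n] by (intro borel_measurable_times borel_measurable_unitI[OF m]) (simp add: L2_def)
    show "(\<lambda>x. \<Sum>i<N. v (Suc i) * (indicator (cell N i) x * sine n x)) \<in> borel_measurable unitI"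
      using int by (intro borel_measurable_sum borel_measurable_times borel_measurable_const
          borel_measurable_integrable)
    show "AE x in unitI. \<phi> x * sine n x = (\<Sum>i<N. v (Suc i) * (indicator (cell N i) x * sine n x))"
      using AE_unitI_cell[OF N]
    proof eventually_elim
      case (elim x)
      then obtain i where i: "i < N" "x \<in> cell N i" by blast
      have "x \<in> cell N j \<longleftrightarrow> j = i" for j using cell_unique[OF N _ i(2)] i(2) by blast
      then have "(\<Sum>j<N. v (Suc j) * (indicator (cell N j) x * sine n x)) = (\<Sum>j<N.
          if j = i then v (Suc i) * sine n x else 0)"
        by (intro sum.cong refl) (simp add: indicator_def)
      then show ?case using cells[OF i] i(1) by simp
    qed
  qed
  also have "\<dots> = (\<Sum>i<N. v (Suc i) * integral\<^sup>L unitI (\<lambda>x. indicator (cell N i) x * sine n x))"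
    using int by (subst Bochner_Integration.integral_sum) auto
  also have "\<dots> = (\<Sum>i<N. v (Suc i) * ((cos (pi * real n * real i / real N)
      - cos (pi * real n * real (Suc i) / real N)) / (pi * real n)))"
  proof (intro sum.cong refl arg_cong2[where f = "(*)"])
    fix i assume "i \<in> {..<N}"
    then have i: "i < N" by simp
    let ?F = "\<lambda>x. - cos (pi * real n * x) / (pi * real n)"
    have "integral\<^sup>L unitI (\<lambda>x. indicator (cell N i) x * sine n x)
        = ?F (real (Suc i) / real N) - ?F (real i / real N)"
      unfolding cell_def sine_def
      by (rule integral_unitI_FTC) (use N n i in \<open>auto intro!: derivative_eq_intros
          continuous_intros simp: field_simps\<close>)
    then show "integral\<^sup>L unitI (\<lambda>x. indicator (cell N i) x * sine n x)
      = (cos (pi * real n * real i / real N) - cos (pi * real n * real (Suc i) / real N)) / (pi * real n)"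
      by (simp add: diff_divide_distrib)
  qed
  also have "\<dots> = grid_coeff N v n / (pi * real n)"
    unfolding grid_coeff_def sum_divide_distrib by simp
  finally show ?thesis .
qed

text \<open>A cell is connected and contains no frontier point, so it lies inside \<open>V\<close>
  or misses it.\<close>

lemma grid_set_cells:
  assumes N: "N > 0" and fr: "\<forall>x \<in> frontier V. \<exists>s::int. x = of_int s / real N"
      and x: "x \<in> cell N i" "y \<in> cell N i"
  shows "x \<in> V \<longleftrightarrow> y \<in> V"
proof -
  have "cell N i \<inter> frontier V = {}"
  proof (rule ccontr)
    assume "cell N i \<inter> frontier V \<noteq> {}"
    then obtain z and s :: int where z: "z \<in> cell N i" "z = of_int s / real N" using fr by blast
    then have "real i < of_int s" "of_int s < real (Suc i)" using N by (auto simp: mem_cell_iff)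
    then have "int i < s" "s < int i + 1" by linarith+
    then show False by simp
  qed
  moreover have "connected (cell N i)" unfolding cell_def by (rule connected_Ioo)
  ultimately show ?thesis using connected_Int_frontier[of "cell N i" V] x by blast
qed

lemma grid_point_neighbourhood:
  assumes N: "N > 0" and s: "0 < s" "s < N" and x: "\<bar>x - real s / real N\<bar> < 1 / real N" "x \<noteq> real s / real N"
  shows "x \<in> cell N (s - 1) \<or> x \<in> cell N s"
proof -
  have eq: "x - real s / real N = (real N * x - real s) / real N" using N by (simp add: field_simps)
  have "\<bar>real N * x - real s\<bar> < 1" using x(1) N unfolding eq abs_divide by (simp add: divide_less_cancel)
  moreover have "real N * x \<noteq> real s" using x(2) N by (auto simp: field_simps)
  ultimately show ?thesis using s N by (auto simp: mem_cell_iff abs_less_iff of_nat_diff)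
qed

lemma cell_adjacent_nonempty:
  assumes N: "N > 0" and s: "0 < s" and U: "open U" "real s / real N \<in> U"
  shows "U \<inter> cell N (s - 1) \<noteq> {}" "U \<inter> cell N s \<noteq> {}"
proof -
  let ?a = "real s / real N"
  obtain d where d: "d > 0" "ball ?a d \<subseteq> U" using U by (meson openE)
  define h where "h = min (d / 2) (1 / (2 * real N))"
  have h: "h > 0" "h < d" "real N * h < 1"
    using d(1) N by (auto simp: h_def min_def field_simps)
  have "?a + h \<in> U" "?a - h \<in> U" using d(2) h by (auto simp: dist_norm)
  moreover have "?a + h \<in> cell N s" "?a - h \<in> cell N (s - 1)"
    using h N s by (auto simp: mem_cell_iff algebra_simps of_nat_diff)
  ultimately show "U \<inter> cell N (s - 1) \<noteq> {}" "U \<inter> cell N s \<noteq> {}" by blast+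
qed

text \<open>Use the completely multiplicative \<mu> that is 0 at every prime.\<close>

lemma twists_nonvanishing_one:
  assumes "twists_nonvanishing A"
  shows "A 1 \<noteq> 0"
proof -
  define \<mu> :: "nat \<Rightarrow> complex" where "\<mu> n = (if n = 1 then 1 else 0)" for n
  have "(\<lambda>n. (norm (\<mu> n))\<^sup>2) summable_on {1}" by simp
  then have "(\<lambda>n. (norm (\<mu> n))\<^sup>2) summable_on UNIV"
    by (subst summable_on_cong_neutral[where T = "{1}" and g = "\<lambda>n. (norm (\<mu> n))\<^sup>2"]) (auto simp: \<mu>_def)
  then have "infsum (\<lambda>n. of_real (A n) * \<mu> n / of_nat n) UNIV \<noteq> 0"
    using assms unfolding twists_nonvanishing_def by (auto simp: \<mu>_def)
  also have "infsum (\<lambda>n. of_real (A n) * \<mu> n / of_nat n) UNIV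
      = infsum (\<lambda>n. of_real (A n) * \<mu> n / of_nat n) {1}"
    by (rule infsum_cong_neutral) (auto simp: \<mu>_def)
  finally show ?thesis by (auto simp: \<mu>_def)
qed

section \<open>Sets with boundary on the grid\<close>

locale grid_set =
  fixes N :: nat and V :: "real set"
  assumes N: "N > 1" and nondeg: "nondegenerate V"
    and fr: "\<forall>x \<in> frontier V. \<exists>s::int. x = of_int s / real N"
begin

text \<open>For positive \<open>i\<close> the sample point is the midpoint of the cell ending at
  \<open>i / N\<close>, which is cell \<open>i - 1\<close>; the shift matches the indexing in
  \<open>grid_coeff\<close>.\<close>

definition v :: "nat \<Rightarrow> real" where
  "v i = indicator V ((2 * real i - 1) / (2 * real N))"

lemma N0: "N > 0" using N by simp

lemma V_open: "open V" and V_subset: "V \<subseteq> {0<..<1}"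
  using nondeg by (auto simp: nondegenerate_def)

lemma v_cases: "v i = 0 \<or> v i = 1"
  by (simp add: v_def indicator_def)

lemma indicator_cell:
  assumes "x \<in> cell N i"
  shows "indicator V x = v (Suc i)"
proof -
  have "(2 * real (Suc i) - 1) / (2 * real N) \<in> cell N i"
    using N0 by (simp add: mem_cell_iff field_simps)
  from grid_set_cells[OF N0 fr assms this] show ?thesis by (simp add: v_def indicator_def)
qed

lemma grid_point_mem:
  assumes "0 < s" "real s / real N \<in> V"
  shows "v s = 1" "v (Suc s) = 1"
proof -
  obtain x y where xy: "x \<in> V" "x \<in> cell N (s - 1)" "y \<in> V" "y \<in> cell N s"
    using cell_adjacent_nonempty[OF N0 assms(1) V_open assms(2)] by blast
  show "v s = 1" using indicator_cell[OF xy(2)] xy(1) assms(1) by simp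
  show "v (Suc s) = 1" using indicator_cell[OF xy(4)] xy(3) by simp
qed

text \<open>Equal values on both sides would leave the point either outside the closure of
  \<open>V\<close> or isolated in its complement; the second is what non-degeneracy
  excludes.\<close>

lemma frontier_jump:
  assumes s: "0 < s" "s < N" and f: "real s / real N \<in> frontier V"
  shows "v (Suc s) \<noteq> v s"
proof
  assume eq: "v (Suc s) = v s"
  let ?a = "real s / real N"
  have aV: "?a \<notin> V" using f V_open by (simp add: frontier_def interior_open)
  have aI: "?a \<in> {0<..<1}" using s by simp
  have near: "indicator V x = v s" if "\<bar>x - ?a\<bar> < 1 / real N" "x \<noteq> ?a" for x
    using grid_point_neighbourhood[OF N0 s that] indicator_cell[of x "s
        - 1"] indicator_cell[of x s] s eq by auto
  show False
  proof (cases "v s = 0")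
    case True
    have "x \<notin> V" if "x \<in> ball ?a (1 / real N)" for x
    proof (cases "x = ?a")
      case False
      have "\<bar>x - ?a\<bar> < 1 / real N" using that by (simp add: dist_norm abs_minus_commute)
      from near[OF this False] True show ?thesis by (simp add: indicator_def split: if_splits)
    qed (use aV in simp)
    then have "ball ?a (1 / real N) \<inter> V = {}" by blast
    moreover have "?a \<in> closure V" using f by (simp add: frontier_def)
    moreover have "?a \<in> ball ?a (1 / real N)" using N0 by simp
    ultimately show False
      using open_Int_closure_eq_empty[OF open_ball, of ?a "1 / real N" V] by blast
  next
    case False
    then have v1: "v s = 1" using v_cases[of s] by blast
    have "?a islimpt ({0<..<1} - V)" using nondeg aV aI by (simp add: nondegenerate_def)
    then obtain y where "y \<in> {0<..<1} - V" "y \<in> ball ?a (1 / real N)" "y \<noteq> ?a"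
      using N0 unfolding islimpt_def by (metis centre_in_ball of_nat_0_less_iff open_ball
          zero_less_divide_1_iff)
    then show False using near[of y] v1 by (auto simp: dist_norm abs_minus_commute indicator_def
        split: if_splits)
  qed
qed

text \<open>A grid point inside the open set \<open>V\<close> would force the value 1 in both
  adjacent cells, so alternation keeps the grid points out and \<open>V\<close> is exactly a union
  of open cells.\<close>

lemma alternating_eq_Union_cells:
  assumes alt: "\<And>s. 0 < s \<Longrightarrow> s < N \<Longrightarrow> v (Suc s) \<noteq> v s"
  shows "V = (\<Union>i\<in>{i. i < N \<and> (odd i \<longleftrightarrow> v 1 = 0)}. cell N i)"
proof -
  have val: "v (Suc i) = 1 \<longleftrightarrow> (odd i \<longleftrightarrow> v 1 = 0)" if "i < N" for i
    using that
  proof (induction i)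
    case 0
    then show ?case using v_cases[of 1] by auto
  next
    case (Suc i)
    then show ?case using alt[of "Suc i"] v_cases[of "Suc i"] v_cases[of "Suc (Suc i)"] by auto
  qed
  show ?thesis
  proof (intro equalityI subsetI)
    fix x assume x: "x \<in> V"
    then have "0 < x" "x < 1" using V_subset by auto
    with N0 show "x \<in> (\<Union>i\<in>{i. i < N \<and> (odd i \<longleftrightarrow> v 1 = 0)}. cell N i)"
    proof (cases rule: grid_point_or_cell)
      case (1 s)
      then show ?thesis using grid_point_mem[of s] alt[of s] x by auto
    next
      case (2 i)
      then show ?thesis using indicator_cell[of x i] val[of i] x by auto
    qed
  next
    fix x assume "x \<in> (\<Union>i\<in>{i. i < N \<and> (odd i \<longleftrightarrow> v 1 = 0)}. cell N i)"
    then obtain i where i: "i < N" "odd i \<longleftrightarrow> v 1 = 0" "x \<in> cell N i" by blast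
    then have "v (Suc i) = 1" using val[OF i(1)] by blast
    with indicator_cell[OF i(3)] show "x \<in> V" by (simp add: indicator_def split: if_splits)
  qed
qed

end

lemma Union_odd_cells:
  assumes "odd N"
  shows "(\<Union>i\<in>{i. i < N \<and> odd i}. cell N i)
    = (\<Union>i\<in>{..<(N - 1) div 2}. {(2 * real i + 1) / real N <..< (2 * real i + 2) / real N})"
proof -
  have "{i. i < N \<and> odd i} = (\<lambda>j. 2 * j + 1) ` {..<(N - 1) div 2}"
    using assms by (auto elim!: oddE)
  then show ?thesis by (simp add: cell_def add.commute)
qed

lemma Union_even_cells:
  assumes "odd N"
  shows "(\<Union>i\<in>{i. i < N \<and> even i}. cell N i)
    = (\<Union>i\<in>{..(N - 1) div 2}. {2 * real i / real N <..< (2 * real i + 1) / real N})"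
proof -
  have "{i. i < N \<and> even i} = (\<lambda>j. 2 * j) ` {..(N - 1) div 2}"
    using assms by (auto elim!: oddE evenE)
  then show ?thesis by (simp add: cell_def add.commute)
qed

lemma complete_if_Union_cells:
  assumes N: "N > 1" and V: "open V" "V = (\<Union>i\<in>{i. i < N \<and> (odd i \<longleftrightarrow> b)}. cell N i)"
  shows "complete_dilates (indicator V)"
proof (rule complete_if_parity_cells[OF N V(1), of "if b then - 1 else 1"])
  fix i x assume i: "i < N" "x \<in> cell N i"
  have "x \<in> V \<longleftrightarrow> (odd i \<longleftrightarrow> b)"
  proof
    assume "x \<in> V"
    then obtain j where j: "odd j \<longleftrightarrow> b" "x \<in> cell N j" unfolding V(2) by blast
    then have "i = j" using N i(2) by (intro cell_unique[of N x]) auto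
    with j show "odd i \<longleftrightarrow> b" by simp
  qed (use i V(2) in blast)
  then show "indicator V x = (1 + (if b then - 1 else 1) * (if even i then 1 else - 1)) / (2::real)"
    by (auto simp: indicator_def)
qed simp

theorem theorem1p9:
  fixes p l :: nat and V :: "real set"
  assumes "prime p" and "p \<ge> 7" and "l \<ge> 1"
    and "nondegenerate V" and "V \<noteq> {0<..<1}"
    and "\<forall>x \<in> frontier V. \<exists>s::int. x = of_int s / real (p ^ l)"
    and "\<not> int p dvd Gcd {s::int. of_int s / real (p ^ l) \<in> frontier V}"
  shows "complete_dilates (indicator V) \<longleftrightarrow>
    V = (\<Union>i\<in>{..<(p ^ l - 1) div 2}.
           {(2 * real i + 1) / real (p ^ l) <..< (2 * real i + 2) / real (p ^ l)})
    \<or> V = (\<Union>i\<in>{..(p ^ l - 1) div 2}.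
           {(2 * real i) / real (p ^ l) <..< (2 * real i + 1) / real (p ^ l)})"
proof -
  define N where "N = p ^ l"
  have pN: "p dvd N" using assms(3) by (simp add: N_def dvd_power)
  have N1: "N > 1"
  proof -
    have "N > 0" using assms(1) by (simp add: N_def prime_gt_0_nat)
    with pN have "p \<le> N" by (rule dvd_imp_le)
    then show ?thesis using assms(2) by simp
  qed
  have "odd p" using assms(1,2) prime_odd_nat[of p] by auto
  then have oddN: "odd N" by (simp add: N_def)
  interpret grid_set N V
    by unfold_locales (use N1 assms(4,6) in \<open>simp_all add: N_def\<close>)
  have iff: "complete_dilates (indicator V) \<longleftrightarrow> (\<exists>b. V = (\<Union>i\<in>{i. i < N \<and> (odd i \<longleftrightarrow> b)}. cell N i))"
  proof
    assume cd: "complete_dilates (indicator V)"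
    define A where "A = grid_coeff N v"
    have nv: "twists_nonvanishing A"
    proof (rule twists_nonvanishing_if_complete[OF cd])
      fix n :: nat assume "n > 0"
      then show "sine_coeff (indicator V) n = A n / (pi * real n)"
        unfolding A_def using V_open
        by (intro sine_coeff_cells[OF N0]) (auto simp: indicator_cell)
    qed
    have "v (Suc s) \<noteq> v s" if s: "0 < s" "s < N" for s
    proof (rule character_forces_alternation[OF assms(1-3) N_def v_cases _ _ _ s])
      show "grid_coeff N v 1 \<noteq> 0" using twists_nonvanishing_one[OF nv] by (simp add: A_def)
      show "\<exists>\<sigma>::real. \<bar>\<sigma>\<bar> = 1 \<and> (\<forall>n>0. grid_coeff N v (u * n) = \<sigma> * grid_coeff N v n)"
        if u: "coprime u (2 * N)" for u
      proof -
        have "2 * N > 0" using N0 by simp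
        then obtain \<sigma> :: real where "\<bar>\<sigma>\<bar> = 1" "\<And>n. n > 0 \<Longrightarrow> A (u * n) = \<sigma> * A n"
        proof (rule unit_class_character[OF _ _ nv u])
          show "A a = A b" if "[a = b] (mod 2 * N)" for a b
            unfolding A_def by (rule grid_coeff_cong[OF N0 that])
        qed (rule that)
        then show ?thesis unfolding A_def by blast
      qed
      show "\<exists>s. 0 < s \<and> s < N \<and> \<not> p dvd s \<and> v (Suc s) \<noteq> v s"
      proof -
        have "\<exists>s::int. of_int s / real N \<in> frontier V \<and> \<not> int p dvd s"
        proof (rule ccontr)
          assume "\<not> ?thesis"
          then have "int p dvd Gcd {s::int. of_int s / real N \<in> frontier V}"
            by (intro Gcd_greatest) auto
          with assms(7) show False by (simp add: N_def)
        qed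
        then obtain s :: int where s: "of_int s / real N \<in> frontier V" "\<not> int p dvd s" by blast
        have "frontier V \<subseteq> {0..1}"
          using closure_mono[OF V_subset] by (auto simp: frontier_def)
        then have s01: "0 \<le> s" "s \<le> int N" using s(1) N0 by (auto simp: divide_simps)
        \<comment> \<open>Both ends of the grid have numerators divisible by \<open>p\<close>, so
          the frontier point obtained lies strictly between cells, where a jump is defined.\<close>
        have "s \<noteq> 0" "s \<noteq> int N" using s(2) pN by auto
        with s01 have "0 < s" "s < int N" by auto
        then obtain t where t: "s = int t" "0 < t" "t < N"
            by (metis of_nat_0_less_iff of_nat_less_iff zero_less_imp_eq_int)
        moreover have "\<not> p dvd t" using s(2) t(1) by simp
        moreover have "v (Suc t) \<noteq> v t" using frontier_jump[OF t(2,3)] s(1) t(1) by simp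
        ultimately show ?thesis by blast
      qed
    qed
    then have "V = (\<Union>i\<in>{i. i < N \<and> (odd i \<longleftrightarrow> v 1 = 0)}. cell N i)"
      by (rule alternating_eq_Union_cells)
    then show "\<exists>b. V = (\<Union>i\<in>{i. i < N \<and> (odd i \<longleftrightarrow> b)}. cell N i)" by blast
  next
    assume "\<exists>b. V = (\<Union>i\<in>{i. i < N \<and> (odd i \<longleftrightarrow> b)}. cell N i)"
    then show "complete_dilates (indicator V)"
      using complete_if_Union_cells[OF N1 V_open] by blast
  qed
  have "(\<exists>b. V = (\<Union>i\<in>{i. i < N \<and> (odd i \<longleftrightarrow> b)}. cell N i)) \<longleftrightarrow>
      V = (\<Union>i\<in>{i. i < N \<and> odd i}. cell N i) \<or> V = (\<Union>i\<in>{i. i < N \<and> even i}. cell N i)"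
    unfolding ex_bool_eq by simp
  then show ?thesis
    unfolding iff Union_odd_cells[OF oddN] Union_even_cells[OF oddN] by (simp only: N_def)
qed

end
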